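(* Consider the Cox proportional hazards model with right censoring, with baseline hazard $\lambda_0$, true regression parameter $\beta_0\in\mathbb{R}^d$, i.i.d. observations $(T_i,\Delta_i,Z_i)$, $i=1,\dots,n$, and maximum partial likelihood estimator $\hat\beta_n$, as described in the context. Assume that: (i) the end points $\tau_F$ and $\tau_G$ of the support of $F$ and $G$ satisfy $\tau_G<\tau_F\le\infty$ and $\mathbb{P}(T=\tau_G)>0$; (ii) there exists $\epsilon>0$ such that $\sup_{|\beta-\beta_0|\le\epsilon}\mathbb{E}\left[|Z|^2 e^{2\beta'Z}\right]<\infty$; (iii) there exists $\epsilon>0$ such that, for all $q\ge 1$ and $k=1,\dots,d$, $\sup_{|\beta-\beta_0|\le\epsilon}\mathbb{E}\left[Z_k^{2q}e^{q\beta'Z}\right]<\infty$; (iv) the baseline hazard $\lambda_0$ is continuous. Let $p\ge 1$. Then there exist events $E_n$ (for $n\geq 1$) with $\mathbb{P}(E_n)\to 1$ as $n\to\infty$, and a constant $K>0$, such that $$\limsup_{n\to\infty}\mathbb{E}\left[\mathbf{1}_{E_n}\,n^{p/2}\,|\hat\beta_n-\beta_0|^p\right]\le K.$$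
   Context: Notation: $|\cdot|$ is the Euclidean norm, $\beta'$ is the transpose of $\beta$, $Z_k$ is the $k$-th component of the vector $Z$, and $\mathbf{1}_A$ is the indicator of $A$. Model: $X\ge 0$ is the event time, $C\ge 0$ the censoring time, and $Z\in\mathbb{R}^d$ a covariate vector with distribution $F_Z$. Given $Z$, the variables $X$ and $C$ are independent. Conditionally on $Z=z$, $X$ has an absolutely continuous distribution function $F(x|z)$ with density $f(x|z)$, and $C$ has distribution function $G(x|z)$; the censoring mechanism is non-informative ($F$ and $G$ share no parameters). Here $\tau_F$ and $\tau_G$ are the right end points of the supports of the distributions of $X$ and $C$ respectively. The hazard function of $X$ at time $t$ given $Z=z$ is $$\lambda(t|z)=\lambda_0(t)e^{\beta_0'z},\qquad t\in\mathbb{R}^+,$$ where $\lambda_0\geq 0$ is the baseline hazard and $\beta_0\in\mathbb{R}^d$ is the vector of regression coefficients. Put $T=\min(X,C)$ and $\Delta=\mathbf{1}_{\{X\le C\}}$. One observes $n$ i.i.d. copies $(T_i,\Delta_i,Z_i)$, $i=1,\dots,n$, of $(T,\Delta,Z)$. Estimator: let $0<X_{(1)}<\cdots<X_{(m)}<\infty$ be the ordered observed event times (the ordered values of those $T_i$ with $\Delta_i=1$) and let $Z_{(i)}$ be the covariate vector of the subject whose event occurs at $X_{(i)}$. The maximum partial likelihood estimator $\hat\beta_n$ is the maximizer over $\beta\in\mathbb{R}^d$ of $$L(\beta)=\prod_{i=1}^m\frac{e^{\beta'Z_{(i)}}}{\sum_{j=1}^n\mathbf{1}_{\{T_j\ge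 X_{(i)}\}}e^{\beta'Z_j}}$$ (on the event where no maximizer exists, $\hat\beta_n$ may be defined arbitrarily). Standing nondegeneracy assumption (the usual regularity condition under which $n^{1/2}(\hat\beta_n-\beta_0)$ is asymptotically normal with positive definite covariance matrix): with $\Phi(u)=\mathbb{E}[\mathbf{1}_{\{T\ge u\}}e^{\beta_0'Z}]$, $D^1(u)=\mathbb{E}[\mathbf{1}_{\{T\ge u\}}Ze^{\beta_0'Z}]$ and $D^2(u)=\mathbb{E}[\mathbf{1}_{\{T\ge u\}}ZZ'e^{\beta_0'Z}]$, the matrix $$\int_0^{\tau_G}\left(\frac{D^2(u)}{\Phi(u)}-\frac{D^1(u)D^1(u)'}{\Phi(u)^2}\right)\Phi(u)\lambda_0(u)\,du$$ is positive definite. *)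

theory Defs
  imports "HOL-Probability.Probability"
begin

definition sigma_gen :: "'w measure \<Rightarrow> ('w \<Rightarrow> 'z::topological_space) \<Rightarrow> 'w measure" where
  "sigma_gen M Z = vimage_algebra (space M) Z borel"

definition cond_prob_given :: "'w measure \<Rightarrow> ('w \<Rightarrow> 'z::topological_space) \<Rightarrow> ('w \<Rightarrow> bool) \<Rightarrow> 'w \<Rightarrow> real" where
  "cond_prob_given M Z P = real_cond_exp M (sigma_gen M Z) (indicator {\<omega> \<in> space M. P \<omega>})"

definition cond_indep_given ::
  "'w measure \<Rightarrow> ('w \<Rightarrow> real) \<Rightarrow> ('w \<Rightarrow> real) \<Rightarrow> ('w \<Rightarrow> 'z::topological_space) \<Rightarrow> bool" where
  "cond_indep_given M X C Z \<longleftrightarrow>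
    (\<forall>A\<in>sets borel. \<forall>B\<in>sets borel. AE \<omega> in M.
      cond_prob_given M Z (\<lambda>\<omega>. X \<omega> \<in> A \<and> C \<omega> \<in> B) \<omega> =
      cond_prob_given M Z (\<lambda>\<omega>. X \<omega> \<in> A) \<omega> * cond_prob_given M Z (\<lambda>\<omega>. C \<omega> \<in> B) \<omega>)"

text \<open>\<open>H x z\<close> is the value at \<open>x\<close> of the conditional distribution function given \<open>Z = z\<close>.\<close>

definition cond_distribution_function ::
  "'w measure \<Rightarrow> ('w \<Rightarrow> real) \<Rightarrow> ('w \<Rightarrow> 'z::topological_space) \<Rightarrow> (real \<Rightarrow> 'z \<Rightarrow> real) \<Rightarrow> bool" where
  "cond_distribution_function M X Z H \<longleftrightarrow>
    (\<forall>z. \<exists>\<mu>. real_distribution \<mu> \<and> (\<forall>x. H x z = cdf \<mu> x)) \<and>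
    (\<forall>x. AE \<omega> in M. cond_prob_given M Z (\<lambda>\<omega>. X \<omega> \<le> x) \<omega> = H x (Z \<omega>))"

definition right_end_point :: "real measure \<Rightarrow> ereal" where
  "right_end_point \<mu> = Sup (ereal ` {x. \<forall>U. open U \<and> x \<in> U \<longrightarrow> measure \<mu> U > 0})"

text \<open>
  Population model. The distribution functions \<open>F\<close> and \<open>G\<close> are separate parameters and no relation
  between them is assumed, which is how non-informative censoring enters. The hazard \<open>f / (1 - F)\<close>
  is only meaningful, and only constrained, where \<open>F < 1\<close>.
\<close>

locale cox_model = prob_space M
  for M :: "'w measure"
    and X C :: "'w \<Rightarrow> real" and Z :: "'w \<Rightarrow> real ^ 'd"
    and F f G :: "real \<Rightarrow> real ^ 'd \<Rightarrow> real"
    and lambda0 :: "real \<Rightarrow> real" and beta0 :: "real ^ 'd" +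
  assumes measurable_X: "X \<in> borel_measurable M"
    and measurable_C: "C \<in> borel_measurable M"
    and measurable_Z: "Z \<in> borel_measurable M"
    and X_nonneg: "AE \<omega> in M. 0 \<le> X \<omega>"
    and C_nonneg: "AE \<omega> in M. 0 \<le> C \<omega>"
    and X_C_cond_indep: "cond_indep_given M X C Z"
    and X_given_Z: "cond_distribution_function M X Z F"
    and C_given_Z: "cond_distribution_function M C Z G"
    and f_nonneg: "\<And>x z. 0 \<le> f x z"
    and f_density: "\<And>x z. ((\<lambda>t. f t z) has_integral F x z) {..x}"
    and lambda0_nonneg: "\<And>t. 0 \<le> t \<Longrightarrow> 0 \<le> lambda0 t"
    and hazard: "\<And>t z. 0 \<le> t \<Longrightarrow> F t z < 1 \<Longrightarrow> f t z / (1 - F t z) = lambda0 t * exp (beta0 \<bullet> z)"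

text \<open>
  Observed data: the subjects are numbered \<open>0, 1, 2, \<dots>\<close>, and a sample of size \<open>n\<close> consists of the
  subjects \<open>i < n\<close>.
\<close>

locale cox_sample = cox_model M X C Z F f G lambda0 beta0
  for M :: "'w measure"
    and X C :: "'w \<Rightarrow> real" and Z :: "'w \<Rightarrow> real ^ 'd"
    and F f G :: "real \<Rightarrow> real ^ 'd \<Rightarrow> real"
    and lambda0 :: "real \<Rightarrow> real" and beta0 :: "real ^ 'd" +
  fixes Ti Di :: "nat \<Rightarrow> 'w \<Rightarrow> real" and Zi :: "nat \<Rightarrow> 'w \<Rightarrow> real ^ 'd"
  assumes sample_indep: "indep_vars (\<lambda>_. borel) (\<lambda>i \<omega>. (Ti i \<omega>, Di i \<omega>, Zi i \<omega>)) UNIV"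
    and sample_distr:
      "\<And>i. distr M borel (\<lambda>\<omega>. (Ti i \<omega>, Di i \<omega>, Zi i \<omega>)) =
            distr M borel (\<lambda>\<omega>. (min (X \<omega>) (C \<omega>), of_bool (X \<omega> \<le> C \<omega>), Z \<omega>))"

text \<open>
  Below, \<open>T\<close>, \<open>D\<close>, \<open>Z\<close> are the data of one realisation. Almost surely no two events occur at the
  same time and none at time 0, so \<open>event_subject\<close> picks the only candidate and all event times
  are positive.
\<close>

definition event_times :: "nat \<Rightarrow> (nat \<Rightarrow> real) \<Rightarrow> (nat \<Rightarrow> real) \<Rightarrow> real set" where
  "event_times n T D = {T i | i. i < n \<and> D i = 1}"

definition event_subject :: "nat \<Rightarrow> (nat \<Rightarrow> real) \<Rightarrow> (nat \<Rightarrow> real) \<Rightarrow> real \<Rightarrow> nat" where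
  "event_subject n T D t = (SOME i. i < n \<and> D i = 1 \<and> T i = t)"

definition partial_likelihood ::
  "nat \<Rightarrow> (nat \<Rightarrow> real) \<Rightarrow> (nat \<Rightarrow> real) \<Rightarrow> (nat \<Rightarrow> real ^ 'd) \<Rightarrow> real ^ 'd \<Rightarrow> real" where
  "partial_likelihood n T D Z \<beta> =
    (\<Prod>t\<in>event_times n T D.
      exp (\<beta> \<bullet> Z (event_subject n T D t)) / (\<Sum>j<n. indicator {t..} (T j) * exp (\<beta> \<bullet> Z j)))"

definition max_partial_likelihood_estimator ::
  "'w measure \<Rightarrow> (nat \<Rightarrow> 'w \<Rightarrow> real) \<Rightarrow> (nat \<Rightarrow> 'w \<Rightarrow> real) \<Rightarrow> (nat \<Rightarrow> 'w \<Rightarrow> real ^ 'd) \<Rightarrow>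
   (nat \<Rightarrow> 'w \<Rightarrow> real ^ 'd) \<Rightarrow> bool" where
  "max_partial_likelihood_estimator M Ti Di Zi b \<longleftrightarrow>
    (\<forall>n. b n \<in> borel_measurable M \<and>
      (AE \<omega> in M.
        let L = partial_likelihood n (\<lambda>i. Ti i \<omega>) (\<lambda>i. Di i \<omega>) (\<lambda>i. Zi i \<omega>)
        in (\<exists>\<beta>. is_arg_max L (\<lambda>_. True) \<beta>) \<longrightarrow> is_arg_max L (\<lambda>_. True) (b n \<omega>)))"

definition outer_product :: "real ^ 'd \<Rightarrow> real ^ 'd \<Rightarrow> real ^ 'd ^ 'd" where
  "outer_product v w = (\<chi> i j. v $ i * w $ j)"

definition positive_definite :: "real ^ 'd ^ 'd \<Rightarrow> bool" where
  "positive_definite A \<longleftrightarrow> transpose A = A \<and> (\<forall>v. v \<noteq> 0 \<longrightarrow> v \<bullet> (A *v v) > 0)"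

definition Phi :: "'w measure \<Rightarrow> ('w \<Rightarrow> real) \<Rightarrow> ('w \<Rightarrow> real ^ 'd) \<Rightarrow> real ^ 'd \<Rightarrow> real \<Rightarrow> real" where
  "Phi M T Z \<beta> u = (\<integral>\<omega>. indicator {u..} (T \<omega>) * exp (\<beta> \<bullet> Z \<omega>) \<partial>M)"

definition D1 :: "'w measure \<Rightarrow> ('w \<Rightarrow> real) \<Rightarrow> ('w \<Rightarrow> real ^ 'd) \<Rightarrow> real ^ 'd \<Rightarrow> real \<Rightarrow> real ^ 'd" where
  "D1 M T Z \<beta> u = (\<integral>\<omega>. (indicator {u..} (T \<omega>) * exp (\<beta> \<bullet> Z \<omega>)) *\<^sub>R Z \<omega> \<partial>M)"

definition D2 :: "'w measure \<Rightarrow> ('w \<Rightarrow> real) \<Rightarrow> ('w \<Rightarrow> real ^ 'd) \<Rightarrow> real ^ 'd \<Rightarrow> real \<Rightarrow> real ^ 'd ^ 'd" where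
  "D2 M T Z \<beta> u =
    (\<integral>\<omega>. (indicator {u..} (T \<omega>) * exp (\<beta> \<bullet> Z \<omega>)) *\<^sub>R outer_product (Z \<omega>) (Z \<omega>) \<partial>M)"

definition information_matrix ::
  "'w measure \<Rightarrow> ('w \<Rightarrow> real) \<Rightarrow> ('w \<Rightarrow> real ^ 'd) \<Rightarrow> (real \<Rightarrow> real) \<Rightarrow> real ^ 'd \<Rightarrow> ereal \<Rightarrow> real ^ 'd ^ 'd" where
  "information_matrix M T Z lambda0 \<beta> \<tau> =
    (LBINT u=0..\<tau>. (Phi M T Z \<beta> u * lambda0 u) *\<^sub>R
      ((1 / Phi M T Z \<beta> u) *\<^sub>R D2 M T Z \<beta> u -
       (1 / (Phi M T Z \<beta> u)\<^sup>2) *\<^sub>R outer_product (D1 M T Z \<beta> u) (D1 M T Z \<beta> u)))"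

end

theory Submission
  imports Defs
begin

text \<open>
  The negative log partial likelihood \<open>g\<close> is convex, and within distance \<open>kappa\<close> of \<open>beta0\<close> its second
  derivative is bounded below: restricting the risk sets to those at a suitable fixed time \<open>u\<close> and
  the exponential weights to a common lower bound leaves an empirical covariance matrix, which
  converges to a positive definite limit. Hence on an event of probability tending to one a maximizer exists
  and \<open>norm (betahat - beta0)\<close> is at most a constant times the norm of the score at \<open>beta0\<close> divided by \<open>n\<close>.

  The score is handled without martingales. By the hazard identity, \<open>\<Delta> (Z - D1 T / Phi T)\<close> has mean
  zero, so the score is a sum of independent centred variables plus the error of replacing \<open>D1 / Phi\<close> by its
  empirical version at the observed event times. That error is an average over \<open>i\<close> of sums over \<open>j\<close>
  which, conditionally on subject \<open>i\<close>, are again sums of independent centred variables. So \<open>sqrt n\<close>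
  times the mean score is dominated by a process all of whose moments are bounded in \<open>n\<close>.
\<close>

section \<open>Inequalities for convex functions and variance forms\<close>

text \<open>The atom of \<open>T\<close> at the end point keeps the argument elementary:
  \<open>Phi\<close> stays above \<open>Phi tau > 0\<close> at all observed times, so
  \<open>D1 / Phi\<close> is bounded and the risk sum at \<open>tau\<close> bounds from below every
  risk sum that occurs.

  The information matrix is an integral over time, and a priori different directions could draw
  their information from different times. One time \<open>u\<close> serves all of them because risk
  sets shrink: a direction in which \<open>Z\<close> is constant among the subjects at risk at
  \<open>u\<close> stays so later, and if no \<open>u\<close> were good, compactness of the unit
  sphere would produce a direction that is degenerate at all relevant times.

  Every random requirement is collected in one process \<open>control\<close>, all of whose moments
  are bounded in \<open>n\<close>. The events are \<open>control \<le> \<delta> * sqrt n\<close>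
  with a fixed \<open>\<delta>\<close>. Markov's inequality makes them likely, and on them the
  remaining argument is deterministic: \<open>sqrt n * norm (betahat - beta0)\<close> is at most a
  constant times \<open>control\<close>. So the same process yields the events and the moment bound
  for every \<open>p\<close>.\<close>

lemma power_sum_le_binomial2:
  fixes x y :: real
  assumes "q \<ge> 1"
  shows "(x + y) ^ (2*q) \<le> x ^ (2*q) + 2 * real q * x ^ (2*q - 1) * y
           + 2 ^ (2*q) * (x ^ (2*q - 2) * y\<^sup>2 + y ^ (2*q))"
proof -
  let ?N = "2 * q"
  let ?B = "x ^ (?N - 2) * y\<^sup>2 + y ^ ?N"
  have ev: "even (?N - 2)" by simp
  have B0: "0 \<le> ?B" using ev by (intro add_nonneg_nonneg mult_nonneg_nonneg) (auto intro: zero_le_even_power)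
  \<comment> \<open>For \<open>2 \<le> k \<le> 2q\<close> the monomial is dominated by one of the
    extreme cases \<open>k = 2\<close> and \<open>k = 2q\<close>, according to which of the absolute
    values of \<open>x\<close> and \<open>y\<close> is larger. The term linear in \<open>y\<close>
    stays exact, because in \<open>indep_sum_moment_le\<close> its expectation vanishes.\<close>
  have mono_term: "y ^ k * x ^ (?N - k) \<le> ?B" if "2 \<le> k" "k \<le> ?N" for k
  proof -
    have "y ^ k * x ^ (?N - k) \<le> \<bar>y\<bar> ^ k * \<bar>x\<bar> ^ (?N - k)"
      by (metis abs_ge_self abs_mult power_abs)
    also have "\<dots> \<le> ?B"
    proof (cases "\<bar>y\<bar> \<le> \<bar>x\<bar>")
      case True
      have "\<bar>y\<bar> ^ k * \<bar>x\<bar> ^ (?N - k) = \<bar>y\<bar>\<^sup>2 * (\<bar>y\<bar> ^ (k - 2) * \<bar>x\<bar> ^ (?N - k))"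
        using that by (metis le_add_diff_inverse mult.assoc power_add)
      also have "\<dots> \<le> \<bar>y\<bar>\<^sup>2 * (\<bar>x\<bar> ^ (k - 2) * \<bar>x\<bar> ^ (?N - k))"
        using True by (intro mult_left_mono mult_right_mono power_mono) auto
      also have "\<bar>x\<bar> ^ (k - 2) * \<bar>x\<bar> ^ (?N - k) = \<bar>x\<bar> ^ (?N - 2)"
        using that by (simp flip: power_add)
      also have "\<bar>y\<bar>\<^sup>2 * \<bar>x\<bar> ^ (?N - 2) = x ^ (?N - 2) * y\<^sup>2"
        using ev by (simp add: power_even_abs mult.commute)
      also have "\<dots> \<le> ?B" by (simp add: power_mult)
      finally show ?thesis .
    next
      case False
      have "\<bar>y\<bar> ^ k * \<bar>x\<bar> ^ (?N - k) \<le> \<bar>y\<bar> ^ k * \<bar>y\<bar> ^ (?N - k)"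
        using False by (intro mult_left_mono power_mono) auto
      also have "\<dots> = y ^ ?N" using that by (simp add: power_even_abs flip: power_add)
      also have "\<dots> \<le> ?B" using ev by (simp add: zero_le_even_power)
      finally show ?thesis .
    qed
    finally show ?thesis .
  qed
  have "(x + y) ^ ?N = (y + x) ^ ?N" by (simp add: add.commute)
  also have "\<dots> = (\<Sum>k\<le>?N. of_nat (?N choose k) * y ^ k * x ^ (?N - k))" by (rule binomial_ring)
  also have "{..?N} = {0,1} \<union> {2..?N}" using assms by auto
  also have "(\<Sum>k\<in>{0,1} \<union> {2..?N}. of_nat (?N choose k) * y ^ k * x ^ (?N - k)) =
     (\<Sum>k\<in>{0,1}. of_nat (?N choose k) * y ^ k * x ^ (?N - k)) +
     (\<Sum>k\<in>{2..?N}. of_nat (?N choose k) * y ^ k * x ^ (?N - k))"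
    by (rule sum.union_disjoint) auto
  also have "(\<Sum>k\<in>{0,1}. of_nat (?N choose k) * y ^ k * x ^ (?N - k)) = x ^ ?N + 2 * real q * x ^ (?N - 1) * y"
    by simp
  also have "(\<Sum>k\<in>{2..?N}. of_nat (?N choose k) * y ^ k * x ^ (?N - k)) \<le> (\<Sum>k\<in>{2..?N}. of_nat (?N choose k) * ?B)"
    by (rule sum_mono) (use mono_term in \<open>auto simp: mult.assoc intro!: mult_left_mono\<close>)
  also have "\<dots> = of_nat (\<Sum>k\<in>{2..?N}. ?N choose k) * ?B" by (simp add: sum_distrib_right)
  also have "\<dots> \<le> of_nat (\<Sum>k\<le>?N. ?N choose k) * ?B"
    using B0 by (intro mult_right_mono of_nat_mono sum_mono2) auto
  also have "(\<Sum>k\<le>?N. ?N choose k) = 2 ^ ?N" by (rule choose_row_sum)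
  finally show ?thesis by simp
qed

text \<open>Lagrange's identity. In the symmetrised form each coefficient is a product of two
  weights, so that monotonicity in the weights becomes visible; on the left the subtracted square
  hides it.\<close>

lemma variance_form_eq:
  fixes q x :: "'a \<Rightarrow> real"
  shows "(\<Sum>j\<in>J. q j) * (\<Sum>j\<in>J. q j * (x j)\<^sup>2) - (\<Sum>j\<in>J. q j * x j)\<^sup>2 =
         (\<Sum>j\<in>J. \<Sum>k\<in>J. q j * q k * (x j - x k)\<^sup>2) / 2"
proof -
  have "(\<Sum>j\<in>J. \<Sum>k\<in>J. q j * q k * (x j - x k)\<^sup>2) =
    (\<Sum>j\<in>J. \<Sum>k\<in>J. (q j * (x j)\<^sup>2) * q k) + (\<Sum>j\<in>J. \<Sum>k\<in>J. q j * (q k * (x k)\<^sup>2))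
     - 2 * (\<Sum>j\<in>J. \<Sum>k\<in>J. (q j * x j) * (q k * x k))"
    by (simp add: power2_eq_square algebra_simps sum.distrib sum_subtractf sum_distrib_left)
  also have "\<dots> = 2 * ((\<Sum>j\<in>J. q j) * (\<Sum>j\<in>J. q j * (x j)\<^sup>2) - (\<Sum>j\<in>J. q j * x j)\<^sup>2)"
    by (simp only: sum_product[symmetric] power2_eq_square) (simp add: algebra_simps)
  finally show ?thesis by simp
qed

lemma variance_form_mono:
  fixes p q x :: "'a \<Rightarrow> real"
  assumes "\<And>j. j \<in> J \<Longrightarrow> 0 \<le> q j" "\<And>j. j \<in> J \<Longrightarrow> q j \<le> p j"
  shows "(\<Sum>j\<in>J. q j) * (\<Sum>j\<in>J. q j * (x j)\<^sup>2) - (\<Sum>j\<in>J. q j * x j)\<^sup>2 \<le>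
         (\<Sum>j\<in>J. p j) * (\<Sum>j\<in>J. p j * (x j)\<^sup>2) - (\<Sum>j\<in>J. p j * x j)\<^sup>2"
  unfolding variance_form_eq
  by (intro divide_right_mono sum_mono mult_right_mono mult_mono) (use assms in \<open>auto intro: order_trans\<close>)

text \<open>Second-order Taylor expansion of \<open>s \<mapsto> ln (S s)\<close> on the unit
  interval. The second derivative is the variance form of the weights
  \<open>a j * exp (s * x j)\<close> divided by \<open>(S s)\<^sup>2\<close>. The common lower bound
  \<open>q\<close> of the weights makes the numerator independent of the unknown intermediate point,
  and \<open>D\<close> does the same for the denominator.\<close>

lemma log_sum_exp_lower:
  fixes a x q :: "'a \<Rightarrow> real"
  assumes a: "\<And>j. j \<in> J \<Longrightarrow> 0 \<le> a j" and pos: "(\<Sum>j\<in>J. a j) > 0"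
    and q0: "\<And>j. j \<in> J \<Longrightarrow> 0 \<le> q j"
    and q1: "\<And>j s. j \<in> J \<Longrightarrow> 0 \<le> s \<Longrightarrow> s \<le> 1 \<Longrightarrow> q j \<le> a j * exp (s * x j)"
    and D: "\<And>s. 0 \<le> s \<Longrightarrow> s \<le> 1 \<Longrightarrow> (\<Sum>j\<in>J. a j * exp (s * x j)) \<le> D"
  shows "ln (\<Sum>j\<in>J. a j) + (\<Sum>j\<in>J. a j * x j) / (\<Sum>j\<in>J. a j)
      + ((\<Sum>j\<in>J. q j) * (\<Sum>j\<in>J. q j * (x j)\<^sup>2) - (\<Sum>j\<in>J. q j * x j)\<^sup>2) / (2 * D\<^sup>2)
      \<le> ln (\<Sum>j\<in>J. a j * exp (x j))"
proof -
  define S where "S s = (\<Sum>j\<in>J. a j * exp (s * x j))" for s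
  define S1 where "S1 s = (\<Sum>j\<in>J. a j * exp (s * x j) * x j)" for s
  define S2 where "S2 s = (\<Sum>j\<in>J. a j * exp (s * x j) * (x j)\<^sup>2)" for s
  have finJ: "finite J" using pos by (metis less_irrefl sum.infinite)
  obtain j0 where j0: "j0 \<in> J" "a j0 > 0"
    using pos a by (metis less_irrefl linorder_not_less sum_nonpos)
  have Spos: "S s > 0" for s
  proof -
    have "0 < a j0 * exp (s * x j0)" using j0 by simp
    also have "\<dots> \<le> S s" unfolding S_def by (rule member_le_sum) (use j0 a finJ in auto)
    finally show ?thesis .
  qed
  have dS: "(S has_real_derivative S1 s) (at s)" for s
    unfolding S_def S1_def by (auto intro!: derivative_eq_intros sum.cong simp: mult_ac)
  have dS1: "(S1 has_real_derivative S2 s) (at s)" for s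
    unfolding S1_def S2_def by (auto intro!: derivative_eq_intros sum.cong simp: mult_ac power2_eq_square)
  let ?d2 = "\<lambda>s. (S2 s * S s - S1 s * S1 s) / (S s * S s)"
  have d1: "((\<lambda>s. ln (S s)) has_real_derivative S1 s / S s) (at s)" for s
    using dS[of s] Spos[of s] by (auto intro!: derivative_eq_intros)
  have d2: "((\<lambda>s. S1 s / S s) has_real_derivative ?d2 s) (at s)" for s
    by (rule DERIV_divide[OF dS1 dS]) (use Spos[of s] in auto)
  define diff where "diff = (\<lambda>m::nat. if m = 0 then (\<lambda>s. ln (S s)) else if m = 1 then (\<lambda>s. S1 s / S s) else ?d2)"
  have "\<exists>t>0. t < 1 \<and> ln (S 1) = (\<Sum>m<2. diff m 0 / fact m * 1 ^ m) + diff 2 t / fact 2 * 1 ^ 2"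
    by (rule Maclaurin[where f="\<lambda>s. ln (S s)"]) (auto simp: diff_def less_Suc_eq numeral_2_eq_2 intro: d1 d2[simplified])
  then obtain t where t: "0 < t" "t < 1" and eq: "ln (S 1) = ln (S 0) + S1 0 / S 0 + ?d2 t / 2"
    by (auto simp: diff_def numeral_2_eq_2)
  let ?V = "(\<Sum>j\<in>J. q j) * (\<Sum>j\<in>J. q j * (x j)\<^sup>2) - (\<Sum>j\<in>J. q j * x j)\<^sup>2"
  have V0: "0 \<le> ?V" unfolding variance_form_eq
    by (intro divide_nonneg_nonneg sum_nonneg mult_nonneg_nonneg) (use q0 in auto)
  have V1: "?V \<le> S2 t * S t - S1 t * S1 t"
    using variance_form_mono[of J q "\<lambda>j. a j * exp (t * x j)" x] q0 q1 t
    by (simp add: S_def S1_def S2_def power2_eq_square mult.commute)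
  have "?V / D\<^sup>2 \<le> ?d2 t"
    using V0 V1 D[of t] t Spos[of t] unfolding S_def[symmetric]
    by (intro frac_le) (auto simp: power2_eq_square intro!: mult_mono)
  thus ?thesis using eq by (simp add: S_def S1_def)
qed

text \<open>The quadratic lower bound is only available on a ball. The condition on \<open>U\<close>
  makes \<open>g\<close> exceed \<open>g x\<close> on its boundary sphere, and convexity along rays
  from \<open>x\<close> propagates this outwards. Hence the sublevel set of \<open>g x\<close> lies
  inside the ball, where compactness gives a minimizer and the quadratic bound gives the distance
  estimate.\<close>

lemma convex_quadratic_growth_minimizer:
  fixes g :: "'a::euclidean_space \<Rightarrow> real"
  assumes conv: "convex_on UNIV g"
    and low: "\<And>h. norm h \<le> r \<Longrightarrow> g x + U \<bullet> h + c / 2 * (norm h)\<^sup>2 \<le> g (x + h)"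
    and r: "r > 0" and c: "c > 0" and U: "norm U < c * r / 2"
  shows "\<exists>y. \<forall>z. g y \<le> g z" and "g y \<le> g x \<Longrightarrow> norm (y - x) \<le> 2 / c * norm U"
proof -
  have sph: "g x < g (x + h)" if "norm h = r" for h
  proof -
    have "\<bar>U \<bullet> h\<bar> \<le> norm U * r" using Cauchy_Schwarz_ineq2[of U h] that by simp
    also have "\<dots> < c * r / 2 * r" using U r by simp
    finally have "0 < U \<bullet> h + c / 2 * r\<^sup>2" by (simp add: power2_eq_square)
    thus ?thesis using low[of h] that by simp
  qed
  have out: "norm (y - x) < r" if "g y \<le> g x" for y
  proof (rule ccontr)
    assume "\<not> norm (y - x) < r"
    hence n: "norm (y - x) \<ge> r" by simp
    define s where "s = r / norm (y - x)"
    have s: "0 < s" "s \<le> 1" using n r by (auto simp: s_def divide_simps)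
    have "g (x + s *\<^sub>R (y - x)) = g ((1 - s) *\<^sub>R x + s *\<^sub>R y)" by (simp add: algebra_simps)
    also have "\<dots> \<le> (1 - s) * g x + s * g y" using s by (intro convex_onD[OF conv]) auto
    also have "\<dots> \<le> (1 - s) * g x + s * g x" using that s by (intro add_left_mono mult_left_mono) auto
    also have "\<dots> = g x" by (simp add: algebra_simps)
    finally have "g (x + s *\<^sub>R (y - x)) \<le> g x" .
    moreover have "norm (s *\<^sub>R (y - x)) = r" using n r by (auto simp: s_def)
    ultimately show False using sph[of "s *\<^sub>R (y - x)"] by simp
  qed
  have cont: "continuous_on (cball x r) g"
    using convex_on_continuous[OF open_UNIV conv] continuous_on_subset by blast
  obtain y where y: "y \<in> cball x r" "\<And>z. z \<in> cball x r \<Longrightarrow> g y \<le> g z"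
    using continuous_attains_inf[OF compact_cball _ cont] r by fastforce
  have "g y \<le> g z" for z
  proof (cases "g z \<le> g x")
    case True
    from out[OF this] show ?thesis by (intro y(2)) (simp add: dist_norm norm_minus_commute)
  next
    case False
    with y(2)[of x] r show ?thesis by simp
  qed
  thus "\<exists>y. \<forall>z. g y \<le> g z" by blast
  show "norm (y - x) \<le> 2 / c * norm U" if "g y \<le> g x" for y
  proof -
    let ?h = "y - x"
    have "c / 2 * (norm ?h)\<^sup>2 \<le> - (U \<bullet> ?h)" using low[of ?h] out[OF that] that by simp
    also have "\<dots> \<le> norm U * norm ?h" using Cauchy_Schwarz_ineq2[of U ?h] by simp
    finally have "(c / 2 * norm ?h) * norm ?h \<le> norm U * norm ?h" by (simp add: power2_eq_square mult_ac)
    hence "norm ?h = 0 \<or> c / 2 * norm ?h \<le> norm U"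
      by (metis mult_right_le_imp_le norm_ge_zero order_le_less)
    thus ?thesis using c by (auto simp: field_simps)
  qed
qed

section \<open>Moments of sums of independent random variables\<close>

text \<open>The constant in the bound of order \<open>n ^ q\<close> for the moment of order
  \<open>2q\<close> of a sum of \<open>n\<close> independent centred variables. The recursion
  mirrors the binomial expansion: the power of two is the sum of the binomial coefficients,
  \<open>moment_const m q * m\<close> comes from the quadratic term and \<open>m\<close> from the
  pure power of the new summand.\<close>

fun moment_const :: "real \<Rightarrow> nat \<Rightarrow> real" where
  "moment_const m 0 = 1"
| "moment_const m (Suc q) = 2 ^ (2 * Suc q) * (moment_const m q * m + m)"

lemma moment_const_nonneg: "0 \<le> m \<Longrightarrow> 0 \<le> moment_const m q"
  by (induction q) auto

context prob_space
begin

text \<open>Independence makes the joint law a product, so by Tonelli's theorem a bound that holds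
  for every frozen value of the first variable survives integration over it. This replaces
  conditioning on one subject of the sample.\<close>

lemma indep_var_nn_integral_le:
  assumes ind: "indep_var N1 X N2 Y" and k: "k \<in> borel_measurable (N1 \<Otimes>\<^sub>M N2)"
    and le: "\<And>x. x \<in> space N1 \<Longrightarrow> (\<integral>\<^sup>+\<omega>. k (x, Y \<omega>) \<partial>M) \<le> c"
  shows "(\<integral>\<^sup>+\<omega>. k (X \<omega>, Y \<omega>) \<partial>M) \<le> c"
proof -
  note [measurable] = indep_var_rv1[OF ind] indep_var_rv2[OF ind] k
  interpret X: prob_space "distr M N1 X" by (rule prob_space_distr) simp
  interpret Y: prob_space "distr M N2 Y" by (rule prob_space_distr) simp
  have "(\<integral>\<^sup>+\<omega>. k (X \<omega>, Y \<omega>) \<partial>M) = (\<integral>\<^sup>+p. k p \<partial>distr M (N1 \<Otimes>\<^sub>M N2) (\<lambda>\<omega>. (X \<omega>, Y \<omega>)))"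
    by (simp add: nn_integral_distr)
  also have "distr M (N1 \<Otimes>\<^sub>M N2) (\<lambda>\<omega>. (X \<omega>, Y \<omega>)) = distr M N1 X \<Otimes>\<^sub>M distr M N2 Y"
    using ind by (simp add: indep_var_distribution_eq)
  also have "(\<integral>\<^sup>+p. k p \<partial>(distr M N1 X \<Otimes>\<^sub>M distr M N2 Y)) =
      (\<integral>\<^sup>+x. \<integral>\<^sup>+y. k (x, y) \<partial>distr M N2 Y \<partial>distr M N1 X)"
    by (rule Y.nn_integral_fst[symmetric]) simp
  also have "\<dots> \<le> (\<integral>\<^sup>+x. c \<partial>distr M N1 X)"
  proof (rule nn_integral_mono)
    fix x assume "x \<in> space (distr M N1 X)"
    hence x: "x \<in> space N1" by simp
    have "(\<integral>\<^sup>+y. k (x, y) \<partial>distr M N2 Y) = (\<integral>\<^sup>+\<omega>. k (x, Y \<omega>) \<partial>M)"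
      using x by (intro nn_integral_distr) measurable
    thus "(\<integral>\<^sup>+y. k (x, y) \<partial>distr M N2 Y) \<le> c" using le[OF x] by simp
  qed
  also have "\<dots> = c" using X.emeasure_space_1 by (simp add: X.emeasure_space_1)
  finally show ?thesis .
qed

lemma indep_sum_power_integrable:
  fixes \<xi> :: "'i \<Rightarrow> 'a \<Rightarrow> real"
  assumes "indep_vars (\<lambda>_. borel) \<xi> I" "finite I" "\<And>i r. i \<in> I \<Longrightarrow> integrable M (\<lambda>\<omega>. \<xi> i \<omega> ^ r)"
  shows "integrable M (\<lambda>\<omega>. (\<Sum>i\<in>I. \<xi> i \<omega>) ^ r)"
  using assms(2,1,3)
proof (induction I arbitrary: r rule: finite_induct)
  case empty
  thus ?case by simp
next
  case (insert i I)
  have ind: "indep_var borel (\<xi> i) borel (\<lambda>\<omega>. \<Sum>i\<in>I. \<xi> i \<omega>)"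
    using indep_vars_sum[OF insert(1,2,4)] .
  have IH: "integrable M (\<lambda>\<omega>. (\<Sum>i\<in>I. \<xi> i \<omega>) ^ s)" for s
    by (rule insert.IH) (use insert.prems in \<open>auto intro: indep_vars_subset\<close>)
  have "integrable M (\<lambda>\<omega>. \<xi> i \<omega> ^ a * (\<Sum>i\<in>I. \<xi> i \<omega>) ^ b)" for a b
    using indep_var_integrable[OF indep_var_compose[OF ind, of "\<lambda>x. x ^ a" borel "\<lambda>x. x ^ b" borel]]
      insert.prems(2)[of i a] IH[of b] by (simp add: o_def)
  hence "integrable M (\<lambda>\<omega>. \<Sum>k\<le>r. of_nat (r choose k) * (\<xi> i \<omega> ^ k * (\<Sum>i\<in>I. \<xi> i \<omega>) ^ (r - k)))"
    by (intro Bochner_Integration.integrable_sum integrable_mult_right) auto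
  thus ?case using insert by (simp add: binomial_ring mult.assoc)
qed

lemma expectation_affine4:
  fixes f1 f2 f3 f4 :: "'a \<Rightarrow> real"
  assumes "integrable M f1" "integrable M f2" "integrable M f3" "integrable M f4"
  shows "expectation (\<lambda>\<omega>. f1 \<omega> + c * f2 \<omega> + d * (f3 \<omega> + f4 \<omega>)) =
        expectation f1 + c * expectation f2 + d * (expectation f3 + expectation f4)"
  using assms by simp

text \<open>Two nested inductions, on the exponent and on the index set. Adding one summand raises
  the moment of order \<open>2 (q + 1)\<close> by a quantity of order \<open>n ^ q\<close> only,
  since the linear term of the expansion vanishes; \<open>n\<close> such increments give
  \<open>n ^ (q + 1)\<close>.\<close>

lemma indep_sum_moment_le:
  fixes \<xi> :: "'i \<Rightarrow> 'a \<Rightarrow> real"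
  assumes "indep_vars (\<lambda>_. borel) \<xi> I" "finite I" "\<And>i r. i \<in> I \<Longrightarrow> integrable M (\<lambda>\<omega>. \<xi> i \<omega> ^ r)"
    and "\<And>i. i \<in> I \<Longrightarrow> expectation (\<xi> i) = 0"
    and "\<And>i r. i \<in> I \<Longrightarrow> 1 \<le> r \<Longrightarrow> r \<le> q \<Longrightarrow> expectation (\<lambda>\<omega>. \<xi> i \<omega> ^ (2 * r)) \<le> m" and m: "0 \<le> m"
  shows "expectation (\<lambda>\<omega>. (\<Sum>i\<in>I. \<xi> i \<omega>) ^ (2 * q)) \<le> moment_const m q * real (card I) ^ q"
  using assms(1-5)
proof (induction q arbitrary: I)
  case 0
  thus ?case by (simp add: prob_space)
next
  case (Suc q)
  note IHq = Suc.IH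
  note c0 = moment_const_nonneg[OF m]
  from Suc.prems(2,1,3-5) show ?case
  proof (induction I rule: finite_induct)
    case empty
    thus ?case by simp
  next
    case (insert i I)
    let ?S = "\<lambda>\<omega>. \<Sum>i\<in>I. \<xi> i \<omega>" and ?N = "2 * Suc q" and ?n = "real (card I)"
    have sub: "indep_vars (\<lambda>_. borel) \<xi> I" using insert.prems(1) by (rule indep_vars_subset) auto
    have ind: "indep_var borel (\<xi> i) borel ?S"
      using indep_vars_sum[OF insert(1,2,4)] .
    have intS: "integrable M (\<lambda>\<omega>. ?S \<omega> ^ s)" for s
      by (rule indep_sum_power_integrable[OF sub]) (use insert in auto)
    have int\<xi>: "integrable M (\<lambda>\<omega>. \<xi> i \<omega> ^ s)" for s using insert.prems by auto
    have indp: "indep_var borel (\<lambda>\<omega>. \<xi> i \<omega> ^ a) borel (\<lambda>\<omega>. ?S \<omega> ^ b)" for a b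
      using indep_var_compose[OF ind, of "\<lambda>x. x ^ a" borel "\<lambda>x. x ^ b" borel] by (simp add: o_def)
    have intp: "integrable M (\<lambda>\<omega>. ?S \<omega> ^ b * \<xi> i \<omega> ^ a)" for a b
      using indep_var_integrable[OF indp int\<xi> intS] by (simp add: mult.commute)
    have ep: "expectation (\<lambda>\<omega>. ?S \<omega> ^ b * \<xi> i \<omega> ^ a) =
        expectation (\<lambda>\<omega>. ?S \<omega> ^ b) * expectation (\<lambda>\<omega>. \<xi> i \<omega> ^ a)" for a b
      using indep_var_lebesgue_integral[OF indp int\<xi> intS] by (simp add: mult.commute)
    have "expectation (\<lambda>\<omega>. (?S \<omega> + \<xi> i \<omega>) ^ ?N) \<le>
      expectation (\<lambda>\<omega>. ?S \<omega> ^ ?N + 2 * real (Suc q) * (?S \<omega> ^ (?N - 1) * \<xi> i \<omega> ^ 1)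
           + 2 ^ ?N * (?S \<omega> ^ (?N - 2) * \<xi> i \<omega> ^ 2 + \<xi> i \<omega> ^ ?N))"
    proof (rule integral_mono)
      show "integrable M (\<lambda>\<omega>. (?S \<omega> + \<xi> i \<omega>) ^ ?N)"
        using indep_sum_power_integrable[OF insert.prems(1), of ?N] insert.hyps insert.prems(2)
        by (simp add: add.commute del: power_Suc mult_Suc_right)
      show "integrable M (\<lambda>\<omega>. ?S \<omega> ^ ?N + 2 * real (Suc q) * (?S \<omega> ^ (?N - 1) * \<xi> i \<omega> ^ 1)
           + 2 ^ ?N * (?S \<omega> ^ (?N - 2) * \<xi> i \<omega> ^ 2 + \<xi> i \<omega> ^ ?N))"
        by (intro Bochner_Integration.integrable_add integrable_mult_right intS intp int\<xi>)
    next
      fix \<omega>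
      show "(?S \<omega> + \<xi> i \<omega>) ^ ?N \<le> ?S \<omega> ^ ?N + 2 * real (Suc q) * (?S \<omega> ^ (?N - 1) * \<xi> i \<omega> ^ 1)
           + 2 ^ ?N * (?S \<omega> ^ (?N - 2) * \<xi> i \<omega> ^ 2 + \<xi> i \<omega> ^ ?N)"
        using power_sum_le_binomial2[of "Suc q" "?S \<omega>" "\<xi> i \<omega>"] by (simp only: mult.assoc power_one_right)
    qed
    also have "\<dots> = expectation (\<lambda>\<omega>. ?S \<omega> ^ ?N) + 2 * real (Suc q) * expectation (\<lambda>\<omega>. ?S \<omega> ^ (?N - 1) * \<xi> i \<omega> ^ 1)
           + 2 ^ ?N * (expectation (\<lambda>\<omega>. ?S \<omega> ^ (?N - 2) * \<xi> i \<omega> ^ 2) + expectation (\<lambda>\<omega>. \<xi> i \<omega> ^ ?N))"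
      by (rule expectation_affine4[OF intS[of ?N] intp[of "?N - 1" 1] intp[of "?N - 2" 2] int\<xi>[of ?N]])
    \<comment> \<open>Independence factors both mixed terms; the linear one contains the mean of the
      new summand and disappears.\<close>
    also have "\<dots> = expectation (\<lambda>\<omega>. ?S \<omega> ^ ?N)
           + 2 ^ ?N * (expectation (\<lambda>\<omega>. ?S \<omega> ^ (2 * q)) * expectation (\<lambda>\<omega>. \<xi> i \<omega> ^ (2 * 1)) + expectation (\<lambda>\<omega>. \<xi> i \<omega> ^ ?N))"
      unfolding ep using insert.prems(3)[of i] by simp
    also have "\<dots> \<le> moment_const m (Suc q) * ?n ^ Suc q
           + 2 ^ ?N * ((moment_const m q * ?n ^ q) * m + m)"
    proof (intro add_mono mult_left_mono mult_mono)
      show "expectation (\<lambda>\<omega>. ?S \<omega> ^ ?N) \<le> moment_const m (Suc q) * ?n ^ Suc q"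
        by (rule insert.IH[OF sub]) (use insert.prems in auto)
      show "expectation (\<lambda>\<omega>. ?S \<omega> ^ (2 * q)) \<le> moment_const m q * ?n ^ q"
        by (rule IHq[OF sub]) (use insert in auto)
      show "expectation (\<lambda>\<omega>. \<xi> i \<omega> ^ (2 * 1)) \<le> m" by (rule insert.prems(4)) auto
      show "expectation (\<lambda>\<omega>. \<xi> i \<omega> ^ ?N) \<le> m" by (rule insert.prems(4)) auto
    qed (use c0 in \<open>auto intro!: Bochner_Integration.integral_nonneg simp: power_mult\<close>)
    also have "\<dots> \<le> moment_const m (Suc q) * ?n ^ Suc q
           + 2 ^ ?N * ((moment_const m q * (?n + 1) ^ q) * m + m * (?n + 1) ^ q)"
      using c0[of q] m by (intro add_left_mono mult_left_mono add_mono mult_right_mono power_mono)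
        (auto intro!: mult_left_le one_le_power simp: mult_le_cancel_left1)
    also have "\<dots> = moment_const m (Suc q) * (?n * ?n ^ q + (?n + 1) ^ q)"
      by (simp add: algebra_simps)
    also have "\<dots> \<le> moment_const m (Suc q) * (?n * (?n + 1) ^ q + (?n + 1) ^ q)"
      using c0[of "Suc q"] by (intro mult_left_mono add_right_mono power_mono) auto
    also have "\<dots> = moment_const m (Suc q) * (?n + 1) ^ Suc q" by (simp add: algebra_simps)
    also have "?n + 1 = real (card (insert i I))" using insert by simp
    finally show ?case using insert by (simp add: add.commute)
  qed
qed

text \<open>Boundedness in every space \<open>L^q\<close>, uniformly in \<open>n\<close>. The
  nonnegative integral encodes finiteness without separate integrability conditions. Since
  \<open>K\<close> may be negative, in which case \<open>ennreal K\<close> is 0, later proofs pass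
  to \<open>max 0 K\<close>.\<close>

definition bounded_moments :: "(nat \<Rightarrow> 'a \<Rightarrow> real) \<Rightarrow> bool" where
  "bounded_moments A \<longleftrightarrow> (\<forall>n. A n \<in> borel_measurable M) \<and>
    (\<forall>q. \<exists>K. \<forall>n. (\<integral>\<^sup>+\<omega>. ennreal (\<bar>A n \<omega>\<bar> ^ q) \<partial>M) \<le> ennreal K)"

lemma bounded_momentsI_even:
  assumes [measurable]: "\<And>n. A n \<in> borel_measurable M"
    and "\<And>q. 1 \<le> q \<Longrightarrow> \<exists>K. \<forall>n. (\<integral>\<^sup>+\<omega>. ennreal (A n \<omega> ^ (2 * q)) \<partial>M) \<le> ennreal K"
  shows "bounded_moments A"
  unfolding bounded_moments_def
proof (intro conjI allI)
  fix q
  obtain K where K: "\<And>n. (\<integral>\<^sup>+\<omega>. ennreal (A n \<omega> ^ (2 * Suc q)) \<partial>M) \<le> ennreal K"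
    using assms(2)[of "Suc q"] by auto
  have le: "\<bar>x\<bar> ^ q \<le> 1 + x ^ (2 * Suc q)" for x :: real
  proof (cases "\<bar>x\<bar> \<le> 1")
    case True
    have "\<bar>x\<bar> ^ q \<le> 1" using True by (simp add: power_le_one)
    moreover have "0 \<le> x ^ (2 * Suc q)" by (simp add: zero_le_even_power del: power_Suc)
    ultimately show ?thesis by linarith
  next
    case False
    have "\<bar>x\<bar> ^ q \<le> \<bar>x\<bar> ^ (2 * Suc q)" using False by (intro power_increasing) auto
    thus ?thesis by (simp add: power_even_abs)
  qed
  have "(\<integral>\<^sup>+\<omega>. ennreal (\<bar>A n \<omega>\<bar> ^ q) \<partial>M) \<le> ennreal (1 + max 0 K)" for n
  proof -
    have "(\<integral>\<^sup>+\<omega>. ennreal (\<bar>A n \<omega>\<bar> ^ q) \<partial>M) \<le> (\<integral>\<^sup>+\<omega>. 1 + ennreal (A n \<omega> ^ (2 * Suc q)) \<partial>M)"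
    proof (rule nn_integral_mono)
      fix \<omega>
      have "ennreal (\<bar>A n \<omega>\<bar> ^ q) \<le> ennreal (1 + A n \<omega> ^ (2 * Suc q))" by (rule ennreal_leI[OF le])
      also have "\<dots> = 1 + ennreal (A n \<omega> ^ (2 * Suc q))"
        by (simp add: zero_le_even_power del: power_Suc mult_Suc_right)
      finally show "ennreal (\<bar>A n \<omega>\<bar> ^ q) \<le> 1 + ennreal (A n \<omega> ^ (2 * Suc q))" .
    qed
    also have "\<dots> = 1 + (\<integral>\<^sup>+\<omega>. ennreal (A n \<omega> ^ (2 * Suc q)) \<partial>M)"
      by (subst nn_integral_add) (auto simp: emeasure_space_1)
    also have "\<dots> \<le> 1 + ennreal K" using K by (intro add_left_mono) auto
    also have "\<dots> = ennreal (1 + max 0 K)" by (simp add: max_def ennreal_neg)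
    finally show ?thesis .
  qed
  thus "\<exists>K. \<forall>n. (\<integral>\<^sup>+\<omega>. ennreal (\<bar>A n \<omega>\<bar> ^ q) \<partial>M) \<le> ennreal K" by blast
qed simp

lemma bounded_moments_measurable [measurable_dest]: "bounded_moments A \<Longrightarrow> A n \<in> borel_measurable M"
  by (simp add: bounded_moments_def)

lemma bounded_moments_add:
  assumes "bounded_moments A" "bounded_moments B"
  shows "bounded_moments (\<lambda>n \<omega>. A n \<omega> + B n \<omega>)"
  unfolding bounded_moments_def
proof (intro conjI allI)
  fix q
  note [measurable] = assms
  from assms obtain K L where K: "\<And>n. (\<integral>\<^sup>+\<omega>. ennreal (\<bar>A n \<omega>\<bar> ^ q) \<partial>M) \<le> ennreal K"
    and L: "\<And>n. (\<integral>\<^sup>+\<omega>. ennreal (\<bar>B n \<omega>\<bar> ^ q) \<partial>M) \<le> ennreal L"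
    unfolding bounded_moments_def by meson
  have le: "\<bar>x + y\<bar> ^ q \<le> 2 ^ q * (\<bar>x\<bar> ^ q + \<bar>y\<bar> ^ q)" for x y :: real
  proof -
    have "\<bar>x + y\<bar> ^ q \<le> (2 * max \<bar>x\<bar> \<bar>y\<bar>) ^ q" by (intro power_mono) auto
    also have "\<dots> \<le> 2 ^ q * (\<bar>x\<bar> ^ q + \<bar>y\<bar> ^ q)"
      by (simp add: power_mult_distrib max_def)
    finally show ?thesis .
  qed
  have "(\<integral>\<^sup>+\<omega>. ennreal (\<bar>A n \<omega> + B n \<omega>\<bar> ^ q) \<partial>M) \<le> ennreal (2 ^ q * (max 0 K + max 0 L))" for n
  proof -
    have "(\<integral>\<^sup>+\<omega>. ennreal (\<bar>A n \<omega> + B n \<omega>\<bar> ^ q) \<partial>M) \<le>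
      (\<integral>\<^sup>+\<omega>. ennreal (2 ^ q) * (ennreal (\<bar>A n \<omega>\<bar> ^ q) + ennreal (\<bar>B n \<omega>\<bar> ^ q)) \<partial>M)"
      using le by (intro nn_integral_mono) (simp flip: ennreal_plus ennreal_mult)
    also have "\<dots> = ennreal (2 ^ q) * ((\<integral>\<^sup>+\<omega>. ennreal (\<bar>A n \<omega>\<bar> ^ q) \<partial>M) + (\<integral>\<^sup>+\<omega>. ennreal (\<bar>B n \<omega>\<bar> ^ q) \<partial>M))"
      by (simp add: nn_integral_cmult nn_integral_add)
    also have "\<dots> \<le> ennreal (2 ^ q) * (ennreal (max 0 K) + ennreal (max 0 L))"
      using K[of n] L[of n] by (intro mult_left_mono add_mono) (auto simp: max_def ennreal_neg)
    also have "\<dots> = ennreal (2 ^ q * (max 0 K + max 0 L))" by (simp add: ennreal_mult)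
    finally show ?thesis .
  qed
  thus "\<exists>K. \<forall>n. (\<integral>\<^sup>+\<omega>. ennreal (\<bar>A n \<omega> + B n \<omega>\<bar> ^ q) \<partial>M) \<le> ennreal K" by blast
qed (intro borel_measurable_add bounded_moments_measurable assms)

lemma bounded_moments_cmult:
  assumes "bounded_moments A"
  shows "bounded_moments (\<lambda>n \<omega>. c * A n \<omega>)"
  unfolding bounded_moments_def
proof (intro conjI allI)
  fix q
  note [measurable] = assms
  from assms obtain K where K: "\<And>n. (\<integral>\<^sup>+\<omega>. ennreal (\<bar>A n \<omega>\<bar> ^ q) \<partial>M) \<le> ennreal K"
    unfolding bounded_moments_def by meson
  have "(\<integral>\<^sup>+\<omega>. ennreal (\<bar>c * A n \<omega>\<bar> ^ q) \<partial>M) \<le> ennreal (\<bar>c\<bar> ^ q * max 0 K)" for n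
  proof -
    have "(\<integral>\<^sup>+\<omega>. ennreal (\<bar>c * A n \<omega>\<bar> ^ q) \<partial>M) = ennreal (\<bar>c\<bar> ^ q) * (\<integral>\<^sup>+\<omega>. ennreal (\<bar>A n \<omega>\<bar> ^ q) \<partial>M)"
      by (subst nn_integral_cmult[symmetric]) (auto simp: abs_mult power_mult_distrib ennreal_mult)
    also have "\<dots> \<le> ennreal (\<bar>c\<bar> ^ q) * ennreal (max 0 K)"
      using K[of n] by (intro mult_left_mono) (auto simp: max_def ennreal_neg)
    also have "\<dots> = ennreal (\<bar>c\<bar> ^ q * max 0 K)" by (simp add: ennreal_mult)
    finally show ?thesis .
  qed
  thus "\<exists>K. \<forall>n. (\<integral>\<^sup>+\<omega>. ennreal (\<bar>c * A n \<omega>\<bar> ^ q) \<partial>M) \<le> ennreal K" by blast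
qed (intro borel_measurable_times borel_measurable_const bounded_moments_measurable assms)

lemma bounded_moments_zero: "bounded_moments (\<lambda>n \<omega>. 0)"
  unfolding bounded_moments_def by (auto simp: power_0_left emeasure_space_1 intro!: exI[of _ 1])

lemma bounded_moments_sum:
  assumes "\<And>k. k \<in> I \<Longrightarrow> bounded_moments (A k)"
  shows "bounded_moments (\<lambda>n \<omega>. \<Sum>k\<in>I. A k n \<omega>)"
proof (cases "finite I")
  case True
  thus ?thesis using assms
    by (induction I rule: finite_induct) (auto intro: bounded_moments_add bounded_moments_zero)
qed (simp add: bounded_moments_zero)

lemma bounded_moments_abs:
  "bounded_moments A \<Longrightarrow> bounded_moments (\<lambda>n \<omega>. \<bar>A n \<omega>\<bar>)"
  by (simp add: bounded_moments_def borel_measurable_abs)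

text \<open>Markov's inequality with the first moment: the exceptional probability is of order
  \<open>1 / sqrt n\<close> for each fixed \<open>\<delta>\<close>.\<close>

lemma bounded_moments_prob_tendsto_1:
  assumes A: "bounded_moments A" and \<delta>: "\<delta> > 0"
  shows "(\<lambda>n. prob {\<omega> \<in> space M. \<bar>A n \<omega>\<bar> \<le> \<delta> * sqrt (real n)}) \<longlonglongrightarrow> 1"
proof -
  note [measurable] = A
  from A obtain K where K: "\<And>n. (\<integral>\<^sup>+\<omega>. ennreal (\<bar>A n \<omega>\<bar> ^ 1) \<partial>M) \<le> ennreal K"
    unfolding bounded_moments_def by meson
  let ?E = "\<lambda>n. {\<omega> \<in> space M. \<bar>A n \<omega>\<bar> \<le> \<delta> * sqrt (real n)}"
  have low: "1 - max 0 K / \<delta> / sqrt (real n) \<le> prob (?E n)" if n: "n \<ge> 1" for n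
  proof -
    let ?F = "{\<omega> \<in> space M. 1 \<le> ennreal (1 / (\<delta> * sqrt n)) * ennreal \<bar>A n \<omega>\<bar>}"
    have p: "0 < \<delta> * sqrt n" using n \<delta> by simp
    have "emeasure M ?F \<le> ennreal (1 / (\<delta> * sqrt n)) * (\<integral>\<^sup>+\<omega>. ennreal \<bar>A n \<omega>\<bar> * indicator (space M) \<omega> \<partial>M)"
      by (rule nn_integral_Markov_inequality) auto
    also have "(\<integral>\<^sup>+\<omega>. ennreal \<bar>A n \<omega>\<bar> * indicator (space M) \<omega> \<partial>M) = (\<integral>\<^sup>+\<omega>. ennreal \<bar>A n \<omega>\<bar> \<partial>M)"
      by (intro nn_integral_cong) auto
    also have "\<dots> \<le> ennreal (max 0 K)" using K[of n] by (auto simp: max_def ennreal_neg)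
    finally have "emeasure M ?F \<le> ennreal (1 / (\<delta> * sqrt n)) * ennreal (max 0 K)"
      by (simp add: mult_left_mono)
    also have "\<dots> = ennreal (max 0 K / \<delta> / sqrt n)" using p \<delta>
      by (subst ennreal_mult[symmetric]) (auto simp: field_simps)
    finally have F: "prob ?F \<le> max 0 K / \<delta> / sqrt n"
      using p \<delta> by (simp add: emeasure_eq_measure)
    have "space M - ?E n \<subseteq> ?F"
      using p by (auto simp: field_simps simp flip: ennreal_mult ennreal_1 intro!: ennreal_leI)
    hence "prob (space M - ?E n) \<le> prob ?F" by (intro finite_measure_mono) auto
    moreover have "prob (space M - ?E n) = 1 - prob (?E n)" by (rule prob_compl) measurable
    ultimately show ?thesis using F by simp
  qed
  have "(\<lambda>n. max 0 K / \<delta> / sqrt (real n)) \<longlonglongrightarrow> 0"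
    by (rule real_tendsto_divide_at_top[OF tendsto_const])
       (rule filterlim_compose[OF sqrt_at_top filterlim_real_sequentially])
  from tendsto_diff[OF tendsto_const[of 1] this]
  have "(\<lambda>n. 1 - max 0 K / \<delta> / sqrt (real n)) \<longlonglongrightarrow> 1" by simp
  moreover have "eventually (\<lambda>n. 1 - max 0 K / \<delta> / sqrt (real n) \<le> prob (?E n)) sequentially"
    by (rule eventually_sequentiallyI[of 1]) (rule low)
  moreover have "eventually (\<lambda>n. prob (?E n) \<le> 1) sequentially" by simp
  ultimately show ?thesis by (rule tendsto_sandwich[OF _ _ _ tendsto_const, rotated -1])
qed

lemma indep_sum_moment_nn:
  fixes \<xi> :: "'i \<Rightarrow> 'a \<Rightarrow> real"
  assumes ind: "indep_vars (\<lambda>_. borel) \<xi> I" and fin: "finite I"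
    and int: "\<And>i r. i \<in> I \<Longrightarrow> integrable M (\<lambda>\<omega>. \<xi> i \<omega> ^ r)"
    and "\<And>i. i \<in> I \<Longrightarrow> expectation (\<xi> i) = 0"
    and m: "\<And>i r. i \<in> I \<Longrightarrow> expectation (\<lambda>\<omega>. \<xi> i \<omega> ^ (2 * r)) \<le> m r" and m0: "\<And>r. 0 \<le> m r"
  shows "(\<integral>\<^sup>+\<omega>. ennreal ((\<Sum>i\<in>I. \<xi> i \<omega>) ^ (2 * q)) \<partial>M) \<le> ennreal (moment_const (\<Sum>r\<le>q. m r) q * real (card I) ^ q)"
proof -
  have "(\<integral>\<^sup>+\<omega>. ennreal ((\<Sum>i\<in>I. \<xi> i \<omega>) ^ (2 * q)) \<partial>M) = ennreal (expectation (\<lambda>\<omega>. (\<Sum>i\<in>I. \<xi> i \<omega>) ^ (2 * q)))"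
    by (rule nn_integral_eq_integral[OF indep_sum_power_integrable[OF ind fin int]]) (auto simp: zero_le_even_power)
  also have "\<dots> \<le> ennreal (moment_const (\<Sum>r\<le>q. m r) q * real (card I) ^ q)"
  proof (rule ennreal_leI, rule indep_sum_moment_le[OF ind fin int assms(4)])
    fix i r assume "i \<in> I" "1 \<le> r" "r \<le> q"
    \<comment> \<open>\<open>indep_sum_moment_le\<close> asks for one bound on all even moments up
      to order \<open>2q\<close>; the sum of the individual bounds provides it.\<close>
    have "m r \<le> (\<Sum>r\<le>q. m r)" using \<open>r \<le> q\<close> m0 by (intro member_le_sum) auto
    thus "expectation (\<lambda>\<omega>. \<xi> i \<omega> ^ (2 * r)) \<le> (\<Sum>r\<le>q. m r)" using m[OF \<open>i \<in> I\<close>] order_trans by blast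
  qed (use m0 in \<open>auto intro: sum_nonneg\<close>)
  finally show ?thesis .
qed

lemma bounded_moments_indep_sum:
  assumes ind: "indep_vars (\<lambda>_. N) W UNIV" and k[measurable]: "k \<in> borel_measurable N"
    and int: "\<And>i r. integrable M (\<lambda>\<omega>. k (W i \<omega>) ^ r :: real)"
    and zero: "\<And>i. expectation (\<lambda>\<omega>. k (W i \<omega>)) = 0"
    and m: "\<And>i r. expectation (\<lambda>\<omega>. k (W i \<omega>) ^ (2 * r)) \<le> m r"
  shows "bounded_moments (\<lambda>n \<omega>. (\<Sum>i<n. k (W i \<omega>)) / sqrt (real n))"
proof (rule bounded_momentsI_even)
  have [measurable]: "W i \<in> measurable M N" for i using ind by (simp add: indep_vars_def)
  show "(\<lambda>\<omega>. (\<Sum>i<n. k (W i \<omega>)) / sqrt (real n)) \<in> borel_measurable M" for n by measurable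
  have m0: "0 \<le> m r" for r
    by (rule order_trans[OF _ m[of 0]]) (auto intro!: Bochner_Integration.integral_nonneg simp: zero_le_even_power)
  fix q :: nat assume q: "1 \<le> q"
  let ?c = "moment_const (\<Sum>r\<le>q. m r) q"
  have "(\<integral>\<^sup>+\<omega>. ennreal (((\<Sum>i<n. k (W i \<omega>)) / sqrt (real n)) ^ (2 * q)) \<partial>M) \<le> ennreal ?c" for n
  \<comment> \<open>For the empty sample the quotient is \<open>0 / 0 = 0\<close>, and its power
    vanishes because \<open>q\<close> is positive.\<close>
  proof (cases "n = 0")
    case True
    thus ?thesis using q by (simp add: power_0_left)
  next
    case n: False
    have indk: "indep_vars (\<lambda>_. borel) (\<lambda>i \<omega>. k (W i \<omega>)) {..<n}"
      by (rule indep_vars_compose2[OF indep_vars_subset[OF ind]]) auto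
    have e: "(x / sqrt (real n)) ^ (2 * q) = (1 / real n ^ q) * x ^ (2 * q)" for x
      by (simp add: power_divide power_mult)
    have "(\<integral>\<^sup>+\<omega>. ennreal (((\<Sum>i<n. k (W i \<omega>)) / sqrt (real n)) ^ (2 * q)) \<partial>M) =
      ennreal (1 / real n ^ q) * (\<integral>\<^sup>+\<omega>. ennreal ((\<Sum>i<n. k (W i \<omega>)) ^ (2 * q)) \<partial>M)"
      unfolding e by (subst nn_integral_cmult[symmetric]) (auto simp: zero_le_even_power simp flip: ennreal_mult)
    also have "\<dots> \<le> ennreal (1 / real n ^ q) * ennreal (?c * real n ^ q)"
      using indep_sum_moment_nn[OF indk _ int zero m m0, of q] by (intro mult_left_mono) auto
    also have "\<dots> = ennreal ?c"
      using n moment_const_nonneg[of "\<Sum>r\<le>q. m r" q] sum_nonneg[of "{..q}" m] m0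
      by (subst ennreal_mult[symmetric]) auto
    finally show ?thesis .
  qed
  thus "\<exists>K. \<forall>n. (\<integral>\<^sup>+\<omega>. ennreal (((\<Sum>i<n. k (W i \<omega>)) / sqrt (real n)) ^ (2 * q)) \<partial>M) \<le> ennreal K"
    by blast
qed

lemma even_power_add_le:
  fixes x y :: real
  shows "(x + y) ^ (2 * q) \<le> 2 ^ (2 * q) * (x ^ (2 * q) + y ^ (2 * q))"
proof -
  have "(x + y) ^ (2 * q) = \<bar>x + y\<bar> ^ (2 * q)" by (simp add: power_even_abs)
  also have "\<dots> \<le> (2 * max \<bar>x\<bar> \<bar>y\<bar>) ^ (2 * q)" by (intro power_mono) auto
  also have "\<dots> \<le> 2 ^ (2 * q) * (\<bar>x\<bar> ^ (2 * q) + \<bar>y\<bar> ^ (2 * q))"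
    by (simp add: power_mult_distrib max_def del: power_even_abs power_even_abs_numeral)
  finally show ?thesis by (simp add: power_even_abs)
qed

text \<open>
  Conditionally on \<open>W i\<close> the inner sum is, up to its diagonal term, a sum of independent centred
  variables; averaging over \<open>i\<close> therefore needs no uniform control in the first argument of \<open>k\<close>.
\<close>

lemma bounded_moments_indep_kernel:
  assumes ind: "indep_vars (\<lambda>_. N) W UNIV" and k[measurable]: "k \<in> borel_measurable (N \<Otimes>\<^sub>M N)"
    and int: "\<And>x i r. x \<in> space N \<Longrightarrow> integrable M (\<lambda>\<omega>. k (x, W i \<omega>) ^ r :: real)"
    and zero: "\<And>x i. x \<in> space N \<Longrightarrow> expectation (\<lambda>\<omega>. k (x, W i \<omega>)) = 0"
    and m: "\<And>x i r. x \<in> space N \<Longrightarrow> expectation (\<lambda>\<omega>. k (x, W i \<omega>) ^ (2 * r)) \<le> m r"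
    and diag: "\<And>i r. (\<integral>\<^sup>+\<omega>. ennreal (k (W i \<omega>, W i \<omega>) ^ (2 * r)) \<partial>M) \<le> ennreal (m r)"
  shows "bounded_moments (\<lambda>n \<omega>. (\<Sum>i<n. \<bar>\<Sum>j<n. k (W i \<omega>, W j \<omega>)\<bar> / sqrt (real n)) / real n)"
proof (rule bounded_momentsI_even)
  have W[measurable]: "W i \<in> measurable M N" for i using ind by (simp add: indep_vars_def)
  show "(\<lambda>\<omega>. (\<Sum>i<n. \<bar>\<Sum>j<n. k (W i \<omega>, W j \<omega>)\<bar> / sqrt (real n)) / real n) \<in> borel_measurable M" for n
    by measurable
  obtain x0 where x0: "x0 \<in> space N" using measurable_space[OF W[of 0]] not_empty by auto
  have m0: "0 \<le> m r" for r
    by (rule order_trans[OF _ m[OF x0, of 0]])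
       (auto intro!: Bochner_Integration.integral_nonneg simp: zero_le_even_power)
  fix q :: nat assume q: "1 \<le> q"
  let ?c = "moment_const (\<Sum>r\<le>q. m r) q"
  have c0: "0 \<le> ?c" using m0 by (intro moment_const_nonneg sum_nonneg) auto
  let ?K = "2 ^ (2 * q) * (m q + ?c)"
  have K0: "0 \<le> ?K" using m0 c0 by simp
  have row: "(\<integral>\<^sup>+\<omega>. ennreal ((\<Sum>j<n. k (W i \<omega>, W j \<omega>)) ^ (2 * q)) \<partial>M) \<le> ennreal (?K * real n ^ q)"
    if i: "i < n" for i n
  proof -
    let ?J = "{..<n} - {i}"
    have off: "(\<integral>\<^sup>+\<omega>. ennreal ((\<Sum>j\<in>?J. k (W i \<omega>, W j \<omega>)) ^ (2 * q)) \<partial>M) \<le> ennreal (?c * real n ^ q)"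
    proof -
      define h where "h p = ennreal ((\<Sum>j\<in>?J. k (fst p i, snd p j)) ^ (2 * q))"
        for p :: "(nat \<Rightarrow> 'b) \<times> (nat \<Rightarrow> 'b)"
      \<comment> \<open>The single index \<open>i\<close> and the remaining indices form disjoint
        blocks of an independent family. Freezing the first block turns the inner sum into a sum of
        independent centred variables; the diagonal term is left out because it is not centred after
        freezing.\<close>
      have ij: "indep_var (PiM {i} (\<lambda>_. N)) (\<lambda>\<omega>. restrict (\<lambda>i. W i \<omega>) {i})
          (PiM ?J (\<lambda>_. N)) (\<lambda>\<omega>. restrict (\<lambda>i. W i \<omega>) ?J)"
        by (rule indep_var_restrict[OF ind]) auto
      have "(\<integral>\<^sup>+\<omega>. h (restrict (\<lambda>i. W i \<omega>) {i}, restrict (\<lambda>i. W i \<omega>) ?J) \<partial>M) \<le> ennreal (?c * real n ^ q)"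
      proof (rule indep_var_nn_integral_le[OF ij])
        have [measurable]: "(\<lambda>p. fst p i) \<in> measurable (PiM {i} (\<lambda>_. N) \<Otimes>\<^sub>M PiM ?J (\<lambda>_. N)) N"
          by (rule measurable_compose[OF measurable_fst]) (rule measurable_component_singleton, simp)
        have [measurable]: "(\<lambda>p. snd p j) \<in> measurable (PiM {i} (\<lambda>_. N) \<Otimes>\<^sub>M PiM ?J (\<lambda>_. N)) N" if "j \<in> ?J" for j
          by (rule measurable_compose[OF measurable_snd]) (rule measurable_component_singleton[OF that])
        show "h \<in> borel_measurable (PiM {i} (\<lambda>_. N) \<Otimes>\<^sub>M PiM ?J (\<lambda>_. N))"
          unfolding h_def
          by (intro measurable_compose[OF _ measurable_ennreal] borel_measurable_power borel_measurable_sum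
             measurable_compose[OF _ k] measurable_Pair) measurable
      next
        fix x assume x: "x \<in> space (PiM {i} (\<lambda>_. N))"
        hence xi: "x i \<in> space N" by (auto simp: space_PiM)
        have "indep_vars (\<lambda>_. borel) (\<lambda>j \<omega>. k (x i, W j \<omega>)) ?J"
          using xi by (intro indep_vars_compose2[OF indep_vars_subset[OF ind]]) auto
        from indep_sum_moment_nn[OF this _ int[OF xi] zero[OF xi] m[OF xi] m0, of q]
        have "(\<integral>\<^sup>+\<omega>. ennreal ((\<Sum>j\<in>?J. k (x i, W j \<omega>)) ^ (2 * q)) \<partial>M) \<le> ennreal (?c * real (card ?J) ^ q)"
          by simp
        also have "\<dots> \<le> ennreal (?c * real n ^ q)"
          using c0 i by (intro ennreal_leI mult_left_mono power_mono) auto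
        also have "(\<integral>\<^sup>+\<omega>. ennreal ((\<Sum>j\<in>?J. k (x i, W j \<omega>)) ^ (2 * q)) \<partial>M) =
            (\<integral>\<^sup>+\<omega>. h (x, restrict (\<lambda>i. W i \<omega>) ?J) \<partial>M)"
          by (simp add: h_def)
        finally show "(\<integral>\<^sup>+\<omega>. h (x, restrict (\<lambda>i. W i \<omega>) ?J) \<partial>M) \<le> ennreal (?c * real n ^ q)" .
      qed
      thus ?thesis by (simp add: h_def)
    qed
    have split: "(\<Sum>j<n. k (W i \<omega>, W j \<omega>)) = k (W i \<omega>, W i \<omega>) + (\<Sum>j\<in>?J. k (W i \<omega>, W j \<omega>))" for \<omega>
      using i by (subst sum.remove[of _ i]) auto
    have "(\<integral>\<^sup>+\<omega>. ennreal ((\<Sum>j<n. k (W i \<omega>, W j \<omega>)) ^ (2 * q)) \<partial>M) \<le>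
      (\<integral>\<^sup>+\<omega>. ennreal (2 ^ (2 * q)) * (ennreal (k (W i \<omega>, W i \<omega>) ^ (2 * q)) +
           ennreal ((\<Sum>j\<in>?J. k (W i \<omega>, W j \<omega>)) ^ (2 * q))) \<partial>M)"
    proof (rule nn_integral_mono)
      fix \<omega>
      show "ennreal ((\<Sum>j<n. k (W i \<omega>, W j \<omega>)) ^ (2 * q)) \<le> ennreal (2 ^ (2 * q)) * (ennreal (k (W i \<omega>, W i \<omega>) ^ (2 * q)) +
           ennreal ((\<Sum>j\<in>?J. k (W i \<omega>, W j \<omega>)) ^ (2 * q)))"
        unfolding split using even_power_add_le[of "k (W i \<omega>, W i \<omega>)" "\<Sum>j\<in>?J. k (W i \<omega>, W j \<omega>)" q]
        by (simp add: zero_le_even_power ennreal_leI flip: ennreal_plus ennreal_mult)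
    qed
    also have "\<dots> = ennreal (2 ^ (2 * q)) * ((\<integral>\<^sup>+\<omega>. ennreal (k (W i \<omega>, W i \<omega>) ^ (2 * q)) \<partial>M) +
        (\<integral>\<^sup>+\<omega>. ennreal ((\<Sum>j\<in>?J. k (W i \<omega>, W j \<omega>)) ^ (2 * q)) \<partial>M))"
      by (simp add: nn_integral_cmult nn_integral_add)
    also have "\<dots> \<le> ennreal (2 ^ (2 * q)) * (ennreal (m q * real n ^ q) + ennreal (?c * real n ^ q))"
    proof (intro mult_left_mono add_mono off)
      have "m q \<le> m q * real n ^ q" using mult_left_mono[OF one_le_power[of "real n" q] m0[of q]] i by simp
      thus "(\<integral>\<^sup>+\<omega>. ennreal (k (W i \<omega>, W i \<omega>) ^ (2 * q)) \<partial>M) \<le> ennreal (m q * real n ^ q)"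
        using order_trans[OF diag ennreal_leI] by blast
    qed simp
    also have "\<dots> = ennreal (?K * real n ^ q)"
      using m0 c0 by (simp add: algebra_simps flip: ennreal_plus ennreal_mult)
    finally show ?thesis .
  qed
  have "(\<integral>\<^sup>+\<omega>. ennreal (((\<Sum>i<n. \<bar>\<Sum>j<n. k (W i \<omega>, W j \<omega>)\<bar> / sqrt (real n)) / real n) ^ (2 * q)) \<partial>M) \<le> ennreal ?K" for n
  proof (cases "n = 0")
    case True
    thus ?thesis using q by (simp add: power_0_left)
  next
    case n: False
    \<comment> \<open>Convexity of the even power with equal weights \<open>1 / n\<close>. The root
      contributes \<open>n ^ q\<close> to the denominator and the average one more factor
      \<open>n\<close>.\<close>
    have jensen: "((\<Sum>i<n. \<bar>a i\<bar> / sqrt (real n)) / real n) ^ (2 * q) \<le> 1 / real n ^ Suc q * (\<Sum>i<n. a i ^ (2 * q))" for a :: "nat \<Rightarrow> real"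
    proof -
      have "(\<Sum>i<n. (1 / real n) *\<^sub>R (\<bar>a i\<bar> / sqrt (real n))) ^ (2 * q) \<le> (\<Sum>i<n. (1 / real n) * (\<bar>a i\<bar> / sqrt (real n)) ^ (2 * q))"
        using n by (intro convex_on_sum[OF _ _ convex_power_even]) auto
      also have "\<dots> = 1 / real n ^ Suc q * (\<Sum>i<n. a i ^ (2 * q))"
        by (simp add: power_divide power_mult sum_distrib_left)
      finally show ?thesis by (simp add: sum_divide_distrib mult.commute)
    qed
    have "(\<integral>\<^sup>+\<omega>. ennreal (((\<Sum>i<n. \<bar>\<Sum>j<n. k (W i \<omega>, W j \<omega>)\<bar> / sqrt (real n)) / real n) ^ (2 * q)) \<partial>M) \<le>
      (\<integral>\<^sup>+\<omega>. ennreal (1 / real n ^ Suc q) * (\<Sum>i<n. ennreal ((\<Sum>j<n. k (W i \<omega>, W j \<omega>)) ^ (2 * q))) \<partial>M)"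
    proof (rule nn_integral_mono)
      fix \<omega>
      let ?a = "\<lambda>i. \<Sum>j<n. k (W i \<omega>, W j \<omega>)"
      have "ennreal (((\<Sum>i<n. \<bar>?a i\<bar> / sqrt (real n)) / real n) ^ (2 * q)) \<le>
          ennreal (1 / real n ^ Suc q * (\<Sum>i<n. ?a i ^ (2 * q)))"
        by (rule ennreal_leI[OF jensen])
      also have "\<dots> = ennreal (1 / real n ^ Suc q) * ennreal (\<Sum>i<n. ?a i ^ (2 * q))"
        by (rule ennreal_mult) (auto intro: sum_nonneg simp: zero_le_even_power)
      also have "ennreal (\<Sum>i<n. ?a i ^ (2 * q)) = (\<Sum>i<n. ennreal (?a i ^ (2 * q)))"
        by (rule sum_ennreal[symmetric]) (simp add: zero_le_even_power)
      finally show "ennreal (((\<Sum>i<n. \<bar>?a i\<bar> / sqrt (real n)) / real n) ^ (2 * q)) \<le>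
          ennreal (1 / real n ^ Suc q) * (\<Sum>i<n. ennreal (?a i ^ (2 * q)))" .
    qed
    also have "\<dots> = ennreal (1 / real n ^ Suc q) * (\<Sum>i<n. \<integral>\<^sup>+\<omega>. ennreal ((\<Sum>j<n. k (W i \<omega>, W j \<omega>)) ^ (2 * q)) \<partial>M)"
      by (subst nn_integral_cmult, measurable) (subst nn_integral_sum, auto)
    also have "\<dots> \<le> ennreal (1 / real n ^ Suc q) * (\<Sum>i<n. ennreal (?K * real n ^ q))"
      by (intro mult_left_mono sum_mono row) auto
    also have "(\<Sum>i<n. ennreal (?K * real n ^ q)) = ennreal (\<Sum>i<n. ?K * real n ^ q)"
      using K0 by (intro sum_ennreal) (auto intro!: mult_nonneg_nonneg)
    also have "ennreal (1 / real n ^ Suc q) * ennreal (\<Sum>i<n. ?K * real n ^ q) = ennreal ?K"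
      using K0 n by (subst ennreal_mult[symmetric]) (auto intro!: mult_nonneg_nonneg)
    finally show ?thesis .
  qed
  thus "\<exists>K. \<forall>n. (\<integral>\<^sup>+\<omega>. ennreal (((\<Sum>i<n. \<bar>\<Sum>j<n. k (W i \<omega>, W j \<omega>)\<bar> / sqrt (real n)) / real n) ^ (2 * q)) \<partial>M) \<le> ennreal K"
    by blast
qed

end

section \<open>The compensator of the observed events\<close>

lemma subalgebra_sigma_gen:
  assumes "Z \<in> borel_measurable M"
  shows "subalgebra M (sigma_gen M Z)"
  using assms measurable_iff_sets[of Z M borel]
  by (auto simp: subalgebra_def sigma_gen_def)

lemma measurable_sigma_gen: "Z \<in> measurable (sigma_gen M Z) borel"
  unfolding sigma_gen_def by (rule measurable_vimage_algebra1) auto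

text \<open>Over a mesh of \<open>N\<close> equal cells the increments of \<open>\<psi>\<close>
  telescope, so the total error is a constant divided by \<open>N\<close>. A bound that is merely
  linear in the cell length would not suffice; the extra factor \<open>\<psi> s - \<psi> u\<close>
  makes the sum vanish in the limit.\<close>

lemma eq_if_mesh_bound:
  fixes D \<psi> :: "real \<Rightarrow> real"
  assumes "0 \<le> t" "0 \<le> L" and b: "\<And>s u. 0 \<le> s \<Longrightarrow> s \<le> u \<Longrightarrow> u \<le> t \<Longrightarrow> \<bar>D u - D s\<bar> \<le> L * (u - s) * (\<psi> s - \<psi> u)"
  shows "D t = D 0"
proof -
  have bound: "\<bar>D t - D 0\<bar> \<le> L * t * (\<psi> 0 - \<psi> t) / real N" if N: "N \<ge> 1" for N
  proof -
    define x where "x i = t * real i / real N" for i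
    have x: "x 0 = 0" "x N = t" using N by (auto simp: x_def)
    have step: "x (Suc i) - x i = t / real N" for i by (simp add: x_def field_simps flip: diff_divide_distrib)
    have "\<bar>D t - D 0\<bar> = \<bar>\<Sum>i<N. D (x (Suc i)) - D (x i)\<bar>"
      using sum_lessThan_telescope[of "\<lambda>i. D (x i)" N] by (simp add: x)
    also have "\<dots> \<le> (\<Sum>i<N. \<bar>D (x (Suc i)) - D (x i)\<bar>)" by (rule sum_abs)
    also have "\<dots> \<le> (\<Sum>i<N. L * (t / real N) * (\<psi> (x i) - \<psi> (x (Suc i))))"
    proof (rule sum_mono)
      fix i assume i: "i \<in> {..<N}"
      have "0 \<le> x i" "x i \<le> x (Suc i)" using assms by (auto simp: x_def intro!: divide_right_mono mult_left_mono)
      moreover have "x (Suc i) \<le> t"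
        using assms i N by (auto simp: x_def divide_le_eq intro!: mult_left_mono)
      ultimately show "\<bar>D (x (Suc i)) - D (x i)\<bar> \<le> L * (t / real N) * (\<psi> (x i) - \<psi> (x (Suc i)))"
        using b[of "x i" "x (Suc i)"] unfolding step by simp
    qed
    also have "\<dots> = L * (t / real N) * (\<psi> (x 0) - \<psi> (x N))"
      by (simp only: sum_distrib_left[symmetric] sum_lessThan_telescope'[of "\<lambda>i. \<psi> (x i)"])
    finally show ?thesis by (simp add: x)
  qed
  have "(\<lambda>N. L * t * (\<psi> 0 - \<psi> t) / real N) \<longlonglongrightarrow> 0"
    by (rule real_tendsto_divide_at_top[OF tendsto_const filterlim_real_sequentially])
  moreover have "eventually (\<lambda>N. \<bar>D t - D 0\<bar> \<le> L * t * (\<psi> 0 - \<psi> t) / real N) sequentially"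
    by (rule eventually_sequentiallyI[of 1]) (rule bound)
  ultimately have "\<bar>D t - D 0\<bar> \<le> 0" by (rule tendsto_lowerbound) simp
  thus ?thesis by simp
qed

section \<open>Increments of the conditional distribution function under the hazard identity\<close>

context cox_model
begin

declare measurable_X [measurable] measurable_C [measurable] measurable_Z [measurable]

lemma F_cdf: "\<exists>\<mu>. real_distribution \<mu> \<and> (\<forall>x. F x z = cdf \<mu> x)"
  using X_given_Z by (auto simp: cond_distribution_function_def)

lemma F_mono: "s \<le> t \<Longrightarrow> F s z \<le> F t z"
  using F_cdf[of z] finite_borel_measure.cdf_nondecreasing[OF real_distribution.finite_borel_measure_M]
  by metis

lemma F_bounds: "0 \<le> F t z" "F t z \<le> 1"
proof -
  obtain \<mu> where \<mu>: "real_distribution \<mu>" and F: "\<And>x. F x z = cdf \<mu> x" using F_cdf by blast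
  show "0 \<le> F t z" unfolding F
    by (rule finite_borel_measure.cdf_nonneg[OF real_distribution.finite_borel_measure_M[OF \<mu>]])
  show "F t z \<le> 1" unfolding F by (rule real_distribution.cdf_bounded_prob[OF \<mu>])
qed

lemma F_has_integral:
  assumes "s \<le> t"
  shows "((\<lambda>u. f u z) has_integral (F t z - F s z)) {s..t}"
proof -
  have "((\<lambda>u. if u \<in> {..x} then f u z else 0) has_integral F x z) UNIV" for x
    unfolding has_integral_restrict_UNIV by (rule f_density)
  from has_integral_diff[OF this[of t] this[of s]]
  have "((\<lambda>u. (if u \<in> {..t} then f u z else 0) - (if u \<in> {..s} then f u z else 0)) has_integral (F t z - F s z)) UNIV" .
  hence "((\<lambda>u. if u \<in> {s..t} then f u z else 0) has_integral (F t z - F s z)) UNIV"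
    by (rule has_integral_spike[of "{s}", rotated 2]) (use assms in auto)
  thus ?thesis by (simp only: has_integral_restrict_UNIV)
qed

lemma F_continuous: "continuous_on {a..b} (\<lambda>t. F t z)"
proof -
  have int: "(\<lambda>u. f u z) integrable_on {a..b}" if "a \<le> b"
    using F_has_integral[OF that] by blast
  have eq: "F t z = F a z + integral {a..t} (\<lambda>u. f u z)" if "t \<in> {a..b}" for t
    using integral_unique[OF F_has_integral[of a t z]] that by simp
  have cont: "continuous_on {a..b} (\<lambda>t. F a z + integral {a..t} (\<lambda>u. f u z))" if "a \<le> b"
    by (rule continuous_on_add[OF continuous_on_const indefinite_integral_continuous_1[OF int[OF that]]])
  show ?thesis
  proof (cases "a \<le> b")
    case True
    have "continuous_on {a..b} (\<lambda>t. F t z) \<longleftrightarrow>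
        continuous_on {a..b} (\<lambda>t. F a z + integral {a..t} (\<lambda>u. f u z))"
      by (rule continuous_on_cong[OF refl eq])
    with True cont show ?thesis by simp
  qed simp
qed

text \<open>Where \<open>F < 1\<close>, the hazard identity says that the density is
  \<open>1 - F\<close> times the hazard. As \<open>1 - F\<close> decreases in time, replacing it by
  its value at either end of the cell gives the two bounds. They hold for each \<open>z\<close>
  separately and so require no measurability in \<open>z\<close>.\<close>

lemma F_increment:
  assumes "0 \<le> s" "s \<le> t" and cont: "continuous_on {0..t} lambda0"
  shows "(1 - F t z) * (exp (beta0 \<bullet> z) * integral {s..t} lambda0) \<le> F t z - F s z" (is ?lower)
    and "F t z - F s z \<le> (1 - F s z) * (exp (beta0 \<bullet> z) * integral {s..t} lambda0)" (is ?upper)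
proof -
  let ?e = "exp (beta0 \<bullet> z)"
  have cont': "continuous_on {s..u} lambda0" if "u \<le> t" for u
    using assms that by (intro continuous_on_subset[OF cont]) auto
  have li: "(lambda0 has_integral integral {s..u} lambda0) {s..u}" if "u \<le> t" for u
    by (intro integrable_integral integrable_continuous_interval cont' that)
  have feq: "f u z = (1 - F u z) * (?e * lambda0 u)" if "u \<in> {s..v}" "F v z < 1" for u v
  proof -
    have "F u z < 1" using that F_mono[of u v z] by auto
    thus ?thesis using hazard[of u z] that assms by (auto simp: field_simps)
  qed
  have l0: "0 \<le> ?e * lambda0 u" if "u \<in> {s..v}" for u v using that assms lambda0_nonneg by auto
  have up: "F u z - F s z \<le> (1 - F s z) * (?e * integral {s..u} lambda0)" if u: "s \<le> u" "u \<le> t" "F u z < 1" for u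
  proof (rule has_integral_le[OF F_has_integral[OF u(1)]])
    show "((\<lambda>x. (1 - F s z) * (?e * lambda0 x)) has_integral (1 - F s z) * (?e * integral {s..u} lambda0)) {s..u}"
      by (intro has_integral_mult_right li u)
    fix x assume x: "x \<in> {s..u}"
    show "f x z \<le> (1 - F s z) * (?e * lambda0 x)"
      unfolding feq[OF x u(3)] using l0[OF x] F_mono[of s x z] x by (intro mult_right_mono) auto
  qed
  have Lmono: "integral {s..u} lambda0 \<le> integral {s..t} lambda0" "0 \<le> integral {s..t} lambda0" if "u \<le> t" for u
  proof -
    show "integral {s..u} lambda0 \<le> integral {s..t} lambda0"
      using that assms lambda0_nonneg
      by (intro integral_subset_le integrable_continuous_interval cont') auto
    show "0 \<le> integral {s..t} lambda0"
      using assms lambda0_nonneg by (intro Henstock_Kurzweil_Integration.integral_nonneg integrable_continuous_interval cont') auto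
  qed
  show ?upper
  proof (cases "F t z < 1")
    case True
    thus ?thesis using up assms by auto
  next
    case False
    hence Ft: "F t z = 1" using F_bounds(2)[of t z] by auto
    let ?K = "(1 - F s z) * (?e * integral {s..t} lambda0)"
    have K0: "0 \<le> ?K" using Lmono(2)[of t] F_bounds(2)[of s z] by auto
    \<comment> \<open>The hazard identity says nothing at times where \<open>F\<close> has reached
      1. By continuity every level \<open>y < 1\<close> above \<open>F s z\<close> is attained
      inside the cell; the bound holds at that time, and \<open>y\<close> may then tend to
      1.\<close>
    have "y \<le> F s z + ?K" if y: "y < 1" for y
    proof (cases "F s z \<le> y")
      case True
      obtain u where u: "s \<le> u" "u \<le> t" "F u z = y"
        using IVT'[of "\<lambda>t. F t z" s y t] True y Ft F_continuous assms by auto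
      have "F u z - F s z \<le> (1 - F s z) * (?e * integral {s..u} lambda0)" using up u y by auto
      also have "\<dots> \<le> ?K" using F_bounds(2)[of s z] Lmono(1) u by (intro mult_left_mono) auto
      finally show ?thesis using u by simp
    qed (use K0 in auto)
    hence "1 \<le> F s z + ?K" by (rule dense_le)
    thus ?thesis using Ft by simp
  qed
  show ?lower
  proof (cases "F t z < 1")
    case True
    show ?thesis
    proof (rule has_integral_le[OF _ F_has_integral[OF assms(2)]])
      show "((\<lambda>x. (1 - F t z) * (?e * lambda0 x)) has_integral (1 - F t z) * (?e * integral {s..t} lambda0)) {s..t}"
        by (intro has_integral_mult_right li order_refl)
      fix x assume x: "x \<in> {s..t}"
      show "(1 - F t z) * (?e * lambda0 x) \<le> f x z"
        unfolding feq[OF x True] using l0[OF x] F_mono[of x t z] x by (intro mult_right_mono) auto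
    qed
  next
    case False
    hence "F t z = 1" using F_bounds(2)[of t z] by auto
    thus ?thesis using F_bounds(2)[of s z] by simp
  qed
qed

lemma sigma_finite_subalgebra_Z: "sigma_finite_subalgebra M (sigma_gen M Z)"
  by (intro finite_measure_subalgebra_is_sigma_finite)
     (simp add: finite_measure_subalgebra_def finite_measure_subalgebra_axioms_def
        subalgebra_sigma_gen finite_measure_axioms)

sublocale CE: sigma_finite_subalgebra M "sigma_gen M Z"
  by (rule sigma_finite_subalgebra_Z)

lemma cond_prob_F: "AE \<omega> in M. cond_prob_given M Z (\<lambda>\<omega>. X \<omega> \<le> x) \<omega> = F x (Z \<omega>)"
  using X_given_Z by (auto simp: cond_distribution_function_def)

text \<open>Nonnegativity of \<open>X\<close> forces \<open>F\<close> to vanish almost surely at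
  each negative time, and continuity of \<open>F\<close> carries this to time 0. The exceptional
  null set depends on the time, hence the passage along the sequence
  \<open>- 1 / Suc n\<close>.\<close>

lemma AE_X_pos: "AE \<omega> in M. 0 < X \<omega>"
proof -
  have "AE \<omega> in M. F (- 1 / real (Suc n)) (Z \<omega>) = 0" for n
  proof -
    define x where "x = - 1 / real (Suc n)"
    have neg: "x < 0" by (simp add: x_def field_simps)
    have "AE \<omega> in M. real_cond_exp M (sigma_gen M Z) (indicator {\<omega>\<in>space M. X \<omega> \<le> x}) \<omega> =
        real_cond_exp M (sigma_gen M Z) (\<lambda>_. 0) \<omega>"
      by (rule CE.real_cond_exp_cong) (use X_nonneg neg in \<open>auto elim!: eventually_mono simp: indicator_def\<close>)
    moreover have "AE \<omega> in M. real_cond_exp M (sigma_gen M Z) (\<lambda>_. 0) \<omega> = 0"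
      by (rule CE.real_cond_exp_F_meas) auto
    ultimately show ?thesis using cond_prob_F[of x]
      unfolding cond_prob_given_def x_def[symmetric] by eventually_elim simp
  qed
  hence "AE \<omega> in M. \<forall>n. F (- 1 / real (Suc n)) (Z \<omega>) = 0" by (simp add: AE_all_countable)
  hence F0: "AE \<omega> in M. F 0 (Z \<omega>) = 0"
  proof eventually_elim
    case (elim \<omega>)
    have lim: "(\<lambda>n. - 1 / real (Suc n)) \<longlonglongrightarrow> 0"
      using tendsto_minus[OF LIMSEQ_inverse_real_of_nat] by (simp add: inverse_eq_divide)
    have "(\<lambda>n. F (- 1 / real (Suc n)) (Z \<omega>)) \<longlonglongrightarrow> F 0 (Z \<omega>)"
      by (rule continuous_on_tendsto_compose[OF F_continuous[of "-1" 0] lim]) (auto simp: field_simps)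
    hence "(\<lambda>n::nat. 0) \<longlonglongrightarrow> F 0 (Z \<omega>)" by (simp only: elim[rule_format])
    thus ?case by (simp only: LIMSEQ_const_iff)
  qed
  let ?I = "indicator {\<omega>\<in>space M. X \<omega> \<le> 0} :: 'w \<Rightarrow> real"
  have "prob {\<omega>\<in>space M. X \<omega> \<le> 0} = expectation ?I" by simp
  also have "\<dots> = expectation (real_cond_exp M (sigma_gen M Z) ?I)"
    by (intro CE.real_cond_exp_int(2)[symmetric]) (auto simp: integrable_indicator_iff less_top[symmetric])
  also have "\<dots> = expectation (\<lambda>_. 0)"
    by (rule integral_cong_AE) (use F0 cond_prob_F[of 0] in \<open>auto simp: cond_prob_given_def\<close>)
  finally have "prob {\<omega>\<in>space M. X \<omega> \<le> 0} = 0" by simp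
  hence "AE \<omega> in M. \<omega> \<notin> {\<omega>\<in>space M. X \<omega> \<le> 0}"
    by (intro AE_not_in) (auto simp: null_sets_def emeasure_eq_measure)
  thus ?thesis using AE_space by eventually_elim auto
qed

text \<open>By conditional independence each conditional probability is an increment or a tail of
  \<open>F\<close> times the conditional probability of \<open>C \<in> A\<close>; multiplying
  \<open>F_increment\<close> by the latter gives both bounds.\<close>

lemma cond_prob_bounds:
  assumes s: "0 \<le> s" "s \<le> t" and cont: "continuous_on {0..t} lambda0" and A: "A \<in> sets borel"
  shows "AE \<omega> in M. cond_prob_given M Z (\<lambda>\<omega>. s < X \<omega> \<and> X \<omega> \<le> t \<and> C \<omega> \<in> A) \<omega> \<le>
      exp (beta0 \<bullet> Z \<omega>) * integral {s..t} lambda0 * cond_prob_given M Z (\<lambda>\<omega>. s < X \<omega> \<and> C \<omega> \<in> A) \<omega>"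
    and "AE \<omega> in M. exp (beta0 \<bullet> Z \<omega>) * integral {s..t} lambda0 * cond_prob_given M Z (\<lambda>\<omega>. t < X \<omega> \<and> C \<omega> \<in> A) \<omega> \<le>
      cond_prob_given M Z (\<lambda>\<omega>. s < X \<omega> \<and> X \<omega> \<le> t \<and> C \<omega> \<in> A) \<omega>"
proof -
  note [measurable] = A
  let ?P = "cond_prob_given M Z"
  have int: "integrable M (indicator B :: 'w \<Rightarrow> real)" if "B \<in> sets M" for B
    using that by (auto simp: integrable_indicator_iff less_top[symmetric])
  have prodeq: "AE \<omega> in M. ?P (\<lambda>\<omega>. X \<omega> \<in> A' \<and> C \<omega> \<in> A) \<omega> = ?P (\<lambda>\<omega>. X \<omega> \<in> A') \<omega> * ?P (\<lambda>\<omega>. C \<omega> \<in> A) \<omega>"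
    if "A' \<in> sets borel" for A'
    using X_C_cond_indep that A by (auto simp: cond_indep_given_def)
  have rdiff: "AE \<omega> in M. real_cond_exp M (sigma_gen M Z) (\<lambda>\<omega>. indicator S \<omega> - indicator T \<omega>) \<omega> =
      real_cond_exp M (sigma_gen M Z) (indicator S) \<omega> - real_cond_exp M (sigma_gen M Z) (indicator T) \<omega>"
    if "S \<in> sets M" "T \<in> sets M" for S T
    by (rule CE.real_cond_exp_diff[OF int[OF that(1)] int[OF that(2)]])
  have st: "AE \<omega> in M. ?P (\<lambda>\<omega>. X \<omega> \<in> {s<..t}) \<omega> = F t (Z \<omega>) - F s (Z \<omega>)"
  proof -
    have eq: "(indicator {\<omega>\<in>space M. X \<omega> \<in> {s<..t}} :: 'w \<Rightarrow> real) =
      (\<lambda>\<omega>. indicator {\<omega>\<in>space M. X \<omega> \<le> t} \<omega> - indicator {\<omega>\<in>space M. X \<omega> \<le> s} \<omega>)"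
      using s by (auto simp: indicator_def fun_eq_iff)
    have "AE \<omega> in M. ?P (\<lambda>\<omega>. X \<omega> \<in> {s<..t}) \<omega> = ?P (\<lambda>\<omega>. X \<omega> \<le> t) \<omega> - ?P (\<lambda>\<omega>. X \<omega> \<le> s) \<omega>"
      unfolding cond_prob_given_def eq by (rule rdiff) measurable
    thus ?thesis using cond_prob_F[of s] cond_prob_F[of t] by eventually_elim simp
  qed
  have gt: "AE \<omega> in M. ?P (\<lambda>\<omega>. X \<omega> \<in> {u<..}) \<omega> = 1 - F u (Z \<omega>)" for u
  proof -
    have eq: "(indicator {\<omega>\<in>space M. X \<omega> \<in> {u<..}} :: 'w \<Rightarrow> real) =
      (\<lambda>\<omega>. indicator (space M) \<omega> - indicator {\<omega>\<in>space M. X \<omega> \<le> u} \<omega>)"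
      by (auto simp: indicator_def fun_eq_iff)
    have "AE \<omega> in M. ?P (\<lambda>\<omega>. X \<omega> \<in> {u<..}) \<omega> =
        real_cond_exp M (sigma_gen M Z) (indicator (space M)) \<omega> - ?P (\<lambda>\<omega>. X \<omega> \<le> u) \<omega>"
      unfolding cond_prob_given_def eq by (rule rdiff) measurable
    moreover have "AE \<omega> in M. real_cond_exp M (sigma_gen M Z) (indicator (space M)) \<omega> = indicator (space M) \<omega>"
    proof (rule CE.real_cond_exp_F_meas)
      have "space M = space (sigma_gen M Z)" by (simp add: sigma_gen_def)
      thus "indicator (space M) \<in> borel_measurable (sigma_gen M Z)" by simp
    qed (rule int, simp)
    ultimately show ?thesis using cond_prob_F[of u] AE_space by eventually_elim simp
  qed
  have pos: "AE \<omega> in M. 0 \<le> ?P (\<lambda>\<omega>. C \<omega> \<in> A) \<omega>"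
    unfolding cond_prob_given_def by (rule CE.real_cond_exp_pos) auto
  have 1: "(\<lambda>\<omega>. s < X \<omega> \<and> X \<omega> \<le> t \<and> C \<omega> \<in> A) = (\<lambda>\<omega>. X \<omega> \<in> {s<..t} \<and> C \<omega> \<in> A)"
    and 2: "(\<lambda>\<omega>. u < X \<omega> \<and> C \<omega> \<in> A) = (\<lambda>\<omega>. X \<omega> \<in> {u<..} \<and> C \<omega> \<in> A)" for u
    by auto
  have b: "{s<..t} \<in> sets borel" "{u<..} \<in> sets borel" for u :: real by auto
  show "AE \<omega> in M. ?P (\<lambda>\<omega>. s < X \<omega> \<and> X \<omega> \<le> t \<and> C \<omega> \<in> A) \<omega> \<le>
      exp (beta0 \<bullet> Z \<omega>) * integral {s..t} lambda0 * ?P (\<lambda>\<omega>. s < X \<omega> \<and> C \<omega> \<in> A) \<omega>"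
    unfolding 1 2 using prodeq[OF b(1)] prodeq[OF b(2)[of s]] st gt[of s] pos
  proof eventually_elim
    case (elim \<omega>)
    from mult_right_mono[OF F_increment(2)[OF s cont, of "Z \<omega>"] elim(5)]
    show ?case unfolding elim(1-4) by (simp add: mult_ac)
  qed
  show "AE \<omega> in M. exp (beta0 \<bullet> Z \<omega>) * integral {s..t} lambda0 * ?P (\<lambda>\<omega>. t < X \<omega> \<and> C \<omega> \<in> A) \<omega> \<le>
      ?P (\<lambda>\<omega>. s < X \<omega> \<and> X \<omega> \<le> t \<and> C \<omega> \<in> A) \<omega>"
    unfolding 1 2 using prodeq[OF b(1)] prodeq[OF b(2)[of t]] st gt[of t] pos
  proof eventually_elim
    case (elim \<omega>)
    from mult_right_mono[OF F_increment(1)[OF s cont, of "Z \<omega>"] elim(5)]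
    show ?case unfolding elim(1-4) by (simp add: mult_ac)
  qed
qed

end

text \<open>The working form of the hypotheses. \<open>tau\<close> is the finite real value of the
  end point of the censoring times, and \<open>kappa\<close> is a radius around \<open>beta0\<close>
  within which all exponential moments are finite, with the norm of \<open>Z\<close> in the exponent
  in place of a direction.\<close>

locale cox_horizon = cox_model M X C Z F f G lambda0 beta0
  for M :: "'w measure" and X C :: "'w \<Rightarrow> real" and Z :: "'w \<Rightarrow> real ^ 'd"
    and F f G :: "real \<Rightarrow> real ^ 'd \<Rightarrow> real" and lambda0 :: "real \<Rightarrow> real" and beta0 :: "real ^ 'd" +
  fixes tau kappa :: real
  assumes tau_nonneg: "0 \<le> tau"
    and lambda0_continuous: "continuous_on {0..tau} lambda0"
    and kappa_pos: "0 < kappa"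
    and moments: "\<And>q::nat. integrable M (\<lambda>\<omega>. exp (beta0 \<bullet> Z \<omega> + kappa * norm (Z \<omega>)) ^ q)"
    and AE_T_le_tau: "AE \<omega> in M. min (X \<omega>) (C \<omega>) \<le> tau"
    and T_atom: "0 < prob {\<omega> \<in> space M. min (X \<omega>) (C \<omega>) = tau}"
begin

definition T :: "'w \<Rightarrow> real" where "T \<omega> = min (X \<omega>) (C \<omega>)"

text \<open>Cutting the hazard to \<open>{0..tau}\<close> makes it nonnegative, bounded and Borel
  measurable on the whole line, while continuity of \<open>lambda0\<close> is only known on that
  interval.\<close>

definition lam :: "real \<Rightarrow> real" where "lam u = indicator {0..tau} u * lambda0 u"

abbreviation expZ :: "'w \<Rightarrow> real" where "expZ \<omega> \<equiv> exp (beta0 \<bullet> Z \<omega>)"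

lemma measurable_T [measurable]: "T \<in> borel_measurable M"
  unfolding T_def by measurable

lemma measurable_lam [measurable]: "lam \<in> borel_measurable borel"
  using borel_measurable_continuous_on_indicator[OF _ lambda0_continuous] by (simp add: lam_def[abs_def])

lemma lam_nonneg: "0 \<le> lam u"
  using lambda0_nonneg[of u] by (auto simp: lam_def indicator_def)

lemma lam_bounded: "\<exists>L\<ge>0. \<forall>u. lam u \<le> L"
proof -
  have "compact (lambda0 ` {0..tau})" by (intro compact_continuous_image lambda0_continuous compact_Icc)
  hence "bounded (lambda0 ` {0..tau})" by (rule compact_imp_bounded)
  then obtain L where "\<forall>x\<in>{0..tau}. \<bar>lambda0 x\<bar> \<le> L" by (auto simp: bounded_iff)
  hence "lam u \<le> max 0 L" for u by (force simp: lam_def indicator_def abs_le_iff max_def)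
  thus ?thesis by (intro exI[of _ "max 0 L"]) auto
qed

text \<open>Translates the gauge integral of \<open>F_increment\<close> into a Lebesgue integral.
  Half-open cells are used because they tile an interval without overlap.\<close>

lemma lam_integral:
  assumes "0 \<le> s" "s \<le> t" "t \<le> tau"
  shows "integrable lborel (\<lambda>u. indicator {s<..t} u * lam u)"
    and "(\<integral>u. indicator {s<..t} u * lam u \<partial>lborel) = integral {s..t} lambda0"
proof -
  have c: "continuous_on {s..t} lambda0" by (rule continuous_on_subset[OF lambda0_continuous]) (use assms in auto)
  have si: "set_integrable lborel {s..t} lambda0" by (rule borel_integrable_atLeastAtMost') (rule c)
  have ae: "AE u in lborel. indicator {s..t} u * lambda0 u = indicator {s<..t} u * lam u"
    using AE_lborel_singleton[of s]
    by eventually_elim (use assms in \<open>auto simp: lam_def indicator_def\<close>)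
  have [measurable]: "(\<lambda>u. indicator {s..t} u * lambda0 u) \<in> borel_measurable lborel"
    using si by (auto simp: set_integrable_def)
  show "integrable lborel (\<lambda>u. indicator {s<..t} u * lam u)"
    by (rule integrable_cong_AE_imp[OF _ _ ae]) (use si in \<open>auto simp: set_integrable_def\<close>)
  have "(\<integral>u. indicator {s<..t} u * lam u \<partial>lborel) = (LINT u:{s..t}|lborel. lambda0 u)"
    unfolding set_lebesgue_integral_def by (rule integral_cong_AE) (use ae in auto)
  also have "\<dots> = integral {s..t} lambda0" by (rule set_borel_integral_eq_integral(2)[OF si])
  finally show "(\<integral>u. indicator {s<..t} u * lam u \<partial>lborel) = integral {s..t} lambda0" .
qed

lemma integrable_expZ: "integrable M expZ"
proof (rule Bochner_Integration.integrable_bound[OF moments[of 1]])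
  have "0 \<le> kappa * norm (Z \<omega>)" for \<omega> using kappa_pos by simp
  thus "AE \<omega> in M. norm (expZ \<omega>) \<le> norm (exp (beta0 \<bullet> Z \<omega> + kappa * norm (Z \<omega>)) ^ 1)" by simp
qed measurable

text \<open>The conditional bounds are integrated against the indicator of \<open>Z \<in> B\<close>.
  Both this indicator and \<open>expZ\<close> are measurable with respect to the sigma-algebra of
  \<open>Z\<close>, so they pass through the conditional expectation.\<close>

lemma event_prob_bounds:
  assumes s: "0 \<le> s" "s \<le> t" "t \<le> tau" and [measurable]: "A \<in> sets borel" "B \<in> sets borel"
  shows "prob {\<omega> \<in> space M. s < X \<omega> \<and> X \<omega> \<le> t \<and> C \<omega> \<in> A \<and> Z \<omega> \<in> B} \<le>
      integral {s..t} lambda0 * expectation (\<lambda>\<omega>. indicator B (Z \<omega>) * expZ \<omega> * indicator {\<omega> \<in> space M. s < X \<omega> \<and> C \<omega> \<in> A} \<omega>)" (is ?upper)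
    and "integral {s..t} lambda0 * expectation (\<lambda>\<omega>. indicator B (Z \<omega>) * expZ \<omega> * indicator {\<omega> \<in> space M. t < X \<omega> \<and> C \<omega> \<in> A} \<omega>) \<le>
      prob {\<omega> \<in> space M. s < X \<omega> \<and> X \<omega> \<le> t \<and> C \<omega> \<in> A \<and> Z \<omega> \<in> B}" (is ?lower)
proof -
  let ?Lam = "integral {s..t} lambda0" and ?P = "cond_prob_given M Z"
  let ?w = "\<lambda>\<omega>. indicator B (Z \<omega>) * expZ \<omega>"
  have cont: "continuous_on {0..t} lambda0" by (rule continuous_on_subset[OF lambda0_continuous]) (use s in auto)
  note [measurable] = measurable_sigma_gen[of Z M]
  have [measurable]: "(\<lambda>\<omega>. indicator B (Z \<omega>) :: real) \<in> borel_measurable (sigma_gen M Z)"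
    by measurable
  have [measurable]: "?w \<in> borel_measurable (sigma_gen M Z)" by measurable
  let ?Q = "\<lambda>u \<omega>. u < X \<omega> \<and> C \<omega> \<in> A" and ?R = "\<lambda>\<omega>. s < X \<omega> \<and> X \<omega> \<le> t \<and> C \<omega> \<in> A"
  have iR: "integrable M (\<lambda>\<omega>. indicator B (Z \<omega>) * indicator {\<omega> \<in> space M. ?R \<omega>} \<omega> :: real)"
    by (rule integrable_const_bound[of _ 1]) (auto simp: indicator_def)
  have iQ: "integrable M (\<lambda>\<omega>. ?w \<omega> * indicator {\<omega> \<in> space M. ?Q u \<omega>} \<omega>)" for u
    by (rule Bochner_Integration.integrable_bound[OF integrable_expZ]) (auto simp: indicator_def)
  have mR: "indicator {\<omega> \<in> space M. ?R \<omega>} \<in> borel_measurable M" by measurable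
  have mQ: "indicator {\<omega> \<in> space M. ?Q u \<omega>} \<in> borel_measurable M" for u by measurable
  have R: "integrable M (\<lambda>\<omega>. indicator B (Z \<omega>) * ?P ?R \<omega>)"
    "expectation (\<lambda>\<omega>. indicator B (Z \<omega>) * ?P ?R \<omega>) = prob {\<omega> \<in> space M. s < X \<omega> \<and> X \<omega> \<le> t \<and> C \<omega> \<in> A \<and> Z \<omega> \<in> B}"
  proof -
    show "integrable M (\<lambda>\<omega>. indicator B (Z \<omega>) * ?P ?R \<omega>)"
      unfolding cond_prob_given_def by (rule CE.real_cond_exp_intg(1)[OF iR]) measurable
    have "expectation (\<lambda>\<omega>. indicator B (Z \<omega>) * ?P ?R \<omega>) = expectation (\<lambda>\<omega>. indicator B (Z \<omega>) * indicator {\<omega> \<in> space M. ?R \<omega>} \<omega>)"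
      unfolding cond_prob_given_def by (rule CE.real_cond_exp_intg(2)[OF iR]) measurable
    also have "\<dots> = expectation (indicator {\<omega> \<in> space M. s < X \<omega> \<and> X \<omega> \<le> t \<and> C \<omega> \<in> A \<and> Z \<omega> \<in> B})"
      by (intro Bochner_Integration.integral_cong) (auto simp: indicator_def)
    finally show "expectation (\<lambda>\<omega>. indicator B (Z \<omega>) * ?P ?R \<omega>) = prob {\<omega> \<in> space M. s < X \<omega> \<and> X \<omega> \<le> t \<and> C \<omega> \<in> A \<and> Z \<omega> \<in> B}"
      by simp
  qed
  have Q: "integrable M (\<lambda>\<omega>. ?w \<omega> * ?P (?Q u) \<omega>)"
    "expectation (\<lambda>\<omega>. ?w \<omega> * ?P (?Q u) \<omega>) = expectation (\<lambda>\<omega>. ?w \<omega> * indicator {\<omega> \<in> space M. ?Q u \<omega>} \<omega>)" for u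
    unfolding cond_prob_given_def
    by (rule CE.real_cond_exp_intg(1)[OF iQ], measurable) (rule CE.real_cond_exp_intg(2)[OF iQ], measurable)
  have iQ': "integrable M (\<lambda>\<omega>. ?Lam * (?w \<omega> * ?P (?Q u) \<omega>))" for u using Q(1)[of u] by simp
  have "expectation (\<lambda>\<omega>. indicator B (Z \<omega>) * ?P ?R \<omega>) \<le> expectation (\<lambda>\<omega>. ?Lam * (?w \<omega> * ?P (?Q s) \<omega>))"
    by (rule integral_mono_AE[OF R(1) iQ'])
       (use cond_prob_bounds(1)[OF s(1,2) cont assms(4)] in \<open>auto elim!: eventually_mono simp: indicator_def mult_ac\<close>)
  thus ?upper by (simp only: R(2) integral_mult_right_zero Q(2))
  have "expectation (\<lambda>\<omega>. ?Lam * (?w \<omega> * ?P (?Q t) \<omega>)) \<le> expectation (\<lambda>\<omega>. indicator B (Z \<omega>) * ?P ?R \<omega>)"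
    by (rule integral_mono_AE[OF iQ' R(1)])
       (use cond_prob_bounds(2)[OF s(1,2) cont assms(4)] in \<open>auto elim!: eventually_mono simp: indicator_def mult_ac\<close>)
  thus ?lower by (simp only: R(2) integral_mult_right_zero Q(2))
qed

text \<open>
  The conditional distribution function is not assumed to be jointly measurable, so the compensator
  is not obtained from Fubini's theorem but from two-sided bounds on the cells of a mesh, which are
  tight because the at-risk mean is monotone.
\<close>

lemma event_prob_eq:
  assumes t: "0 \<le> t" "t \<le> tau" and B[measurable]: "B \<in> sets borel"
  defines "\<psi> \<equiv> \<lambda>u. expectation (\<lambda>\<omega>. indicator B (Z \<omega>) * (indicator {u..} (T \<omega>) * expZ \<omega>))"
  shows "integrable lborel (\<lambda>u. indicator {0<..t} u * lam u * \<psi> u)"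
    and "prob {\<omega> \<in> space M. X \<omega> \<le> C \<omega> \<and> T \<omega> \<le> t \<and> Z \<omega> \<in> B} = (\<integral>u. indicator {0<..t} u * lam u * \<psi> u \<partial>lborel)"
proof -
  have int: "integrable M (\<lambda>\<omega>. indicator B (Z \<omega>) * (indicator S (T \<omega>) * expZ \<omega>))" if [measurable]: "S \<in> sets borel" for S
    by (rule Bochner_Integration.integrable_bound[OF integrable_expZ]) (auto simp: indicator_def)
  have \<psi>_anti: "antimono \<psi>"
    unfolding \<psi>_def by (intro antimonoI integral_mono int) (auto simp: indicator_def)
  have [measurable]: "\<psi> \<in> borel_measurable borel"
  proof -
    have "mono (\<lambda>u. - \<psi> u)" using \<psi>_anti by (auto simp: mono_def antimono_def)
    hence "(\<lambda>u. - (- \<psi> u)) \<in> borel_measurable borel" by (intro borel_measurable_uminus borel_measurable_mono)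
    thus ?thesis by simp
  qed
  have \<psi>0: "0 \<le> \<psi> u" for u unfolding \<psi>_def by (intro Bochner_Integration.integral_nonneg) (auto simp: indicator_def)
  have \<psi>_le: "\<psi> u \<le> expectation expZ" for u
    unfolding \<psi>_def by (intro integral_mono int integrable_expZ) (auto simp: indicator_def)
  have I: "integrable lborel (\<lambda>u. indicator {s<..v} u * lam u * \<psi> u)" if "0 \<le> s" "s \<le> v" "v \<le> tau" for s v
  proof (rule Bochner_Integration.integrable_bound)
    show "integrable lborel (\<lambda>u. expectation expZ * (indicator {s<..v} u * lam u))"
      using lam_integral(1)[OF that] by simp
    show "AE u in lborel. norm (indicator {s<..v} u * lam u * \<psi> u) \<le> norm (expectation expZ * (indicator {s<..v} u * lam u))"
    proof (rule AE_I2)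
      fix u
      have "\<bar>lam u * \<psi> u\<bar> \<le> \<bar>expectation expZ * lam u\<bar>"
        using mult_left_mono[OF \<psi>_le lam_nonneg, of u u] mult_nonneg_nonneg[OF lam_nonneg \<psi>0, of u u]
        by (simp add: mult.commute)
      thus "norm (indicator {s<..v} u * lam u * \<psi> u) \<le> norm (expectation expZ * (indicator {s<..v} u * lam u))"
        by (simp add: indicator_def)
    qed
  qed measurable
  show "integrable lborel (\<lambda>u. indicator {0<..t} u * lam u * \<psi> u)" using I[of 0 t] t by simp
  let ?m = "\<lambda>s u. prob {\<omega> \<in> space M. s < X \<omega> \<and> X \<omega> \<le> u \<and> X \<omega> \<le> C \<omega> \<and> Z \<omega> \<in> B}"
  let ?I = "\<lambda>s v. \<integral>u. indicator {s<..v} u * lam u * \<psi> u \<partial>lborel"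
  \<comment> \<open>Strict inequalities fit the cells: an uncensored event in \<open>(s, u]\<close>
    forces \<open>C > s\<close>, and is in turn guaranteed by \<open>X\<close> in the cell and
    \<open>C > u\<close>. Thus the cell bounds involve \<open>T > s\<close> and
    \<open>T > u\<close>, while \<open>\<psi>\<close> inside the cell lies between the corresponding
    means.\<close>
  define \<phi> where "\<phi> u = expectation (\<lambda>\<omega>. indicator B (Z \<omega>) * (indicator {u<..} (T \<omega>) * expZ \<omega>))" for u
  have \<phi>_le: "\<phi> u \<le> \<psi> u" "s < u \<Longrightarrow> \<psi> u \<le> \<phi> s" for s u
    unfolding \<phi>_def \<psi>_def by (intro integral_mono int; auto simp: indicator_def)+
  have \<phi>_anti: "s \<le> u \<Longrightarrow> \<phi> u \<le> \<phi> s" for s u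
    unfolding \<phi>_def by (intro integral_mono int) (auto simp: indicator_def)
  have \<phi>_eq: "expectation (\<lambda>\<omega>. indicator B (Z \<omega>) * expZ \<omega> * indicator {\<omega> \<in> space M. u < X \<omega> \<and> C \<omega> \<in> {u<..}} \<omega>) = \<phi> u" for u
    unfolding \<phi>_def by (intro Bochner_Integration.integral_cong) (auto simp: indicator_def T_def)
  obtain L where L: "0 \<le> L" "\<And>u. lam u \<le> L" using lam_bounded by blast
  \<comment> \<open>The event probability of the cell and its candidate integral both lie between
    \<open>?Lam * \<phi> u\<close> and \<open>?Lam * \<phi> s\<close>, which yields the product of
    two small factors that \<open>eq_if_mesh_bound\<close> asks for.\<close>
  have m_bounds: "\<bar>?m s u - ?I s u\<bar> \<le> L * (u - s) * (\<phi> s - \<phi> u)" if su: "0 \<le> s" "s \<le> u" "u \<le> tau" for s u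
  proof -
    let ?Lam = "integral {s..u} lambda0"
    have "?Lam * \<phi> u \<le> prob {\<omega> \<in> space M. s < X \<omega> \<and> X \<omega> \<le> u \<and> C \<omega> \<in> {u<..} \<and> Z \<omega> \<in> B}"
      using event_prob_bounds(2)[OF su, of "{u<..}" B] unfolding \<phi>_eq by simp
    also have "\<dots> \<le> ?m s u" by (intro finite_measure_mono) auto
    finally have 1: "?Lam * \<phi> u \<le> ?m s u" .
    have "?m s u \<le> prob {\<omega> \<in> space M. s < X \<omega> \<and> X \<omega> \<le> u \<and> C \<omega> \<in> {s<..} \<and> Z \<omega> \<in> B}"
      by (intro finite_measure_mono) auto
    also have "\<dots> \<le> ?Lam * \<phi> s"
      using event_prob_bounds(1)[OF su, of "{s<..}" B] unfolding \<phi>_eq by simp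
    finally have 2: "?m s u \<le> ?Lam * \<phi> s" .
    have mid: "\<phi> u \<le> \<psi> v" "\<psi> v \<le> \<phi> s" if "s < v" "v \<le> u" for v
      using \<phi>_anti[of v u] \<phi>_le(1)[of v] \<phi>_le(2)[of s v] that by auto
    have "(\<integral>v. indicator {s<..u} v * lam v * \<phi> u \<partial>lborel) \<le> ?I s u"
      using lam_integral(1)[OF su] mid lam_nonneg
      by (intro integral_mono I su) (auto simp: indicator_def intro!: mult_left_mono)
    hence 3: "?Lam * \<phi> u \<le> ?I s u" by (simp add: lam_integral(2)[OF su])
    have "?I s u \<le> (\<integral>v. indicator {s<..u} v * lam v * \<phi> s \<partial>lborel)"
      using lam_integral(1)[OF su] mid lam_nonneg
      by (intro integral_mono I su) (auto simp: indicator_def intro!: mult_left_mono)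
    hence 4: "?I s u \<le> ?Lam * \<phi> s" by (simp add: lam_integral(2)[OF su])
    have "?Lam = (\<integral>v. indicator {s<..u} v * lam v \<partial>lborel)" by (simp add: lam_integral(2)[OF su])
    also have "\<dots> \<le> (\<integral>v. indicator {s<..u} v * L \<partial>lborel)"
    proof (rule integral_mono[OF lam_integral(1)[OF su]])
      show "integrable lborel (\<lambda>v. indicator {s<..u} v * L)"
        by (intro integrable_mult_left integrable_real_indicator) (use su in auto)
    qed (use L in \<open>auto simp: indicator_def\<close>)
    also have "\<dots> = L * (u - s)" using su by simp
    finally have 5: "?Lam \<le> L * (u - s)" .
    have "\<bar>?m s u - ?I s u\<bar> \<le> ?Lam * \<phi> s - ?Lam * \<phi> u" using 1 2 3 4 by linarith
    also have "\<dots> = ?Lam * (\<phi> s - \<phi> u)" by (simp add: algebra_simps)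
    also have "\<dots> \<le> L * (u - s) * (\<phi> s - \<phi> u)" using 5 \<phi>_anti[OF su(2)] by (intro mult_right_mono) auto
    finally show ?thesis .
  qed
  have m_add: "?m 0 u = ?m 0 s + ?m s u" if "0 \<le> s" "s \<le> u" for s u
  proof -
    have "{\<omega> \<in> space M. 0 < X \<omega> \<and> X \<omega> \<le> u \<and> X \<omega> \<le> C \<omega> \<and> Z \<omega> \<in> B} =
      {\<omega> \<in> space M. 0 < X \<omega> \<and> X \<omega> \<le> s \<and> X \<omega> \<le> C \<omega> \<and> Z \<omega> \<in> B} \<union>
      {\<omega> \<in> space M. s < X \<omega> \<and> X \<omega> \<le> u \<and> X \<omega> \<le> C \<omega> \<and> Z \<omega> \<in> B}" using that by auto
    thus ?thesis by (simp only:) (subst finite_measure_Union; auto)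
  qed
  have I_add: "?I 0 u = ?I 0 s + ?I s u" if "0 \<le> s" "s \<le> u" "u \<le> tau" for s u
  proof -
    have "?I 0 u = (\<integral>v. indicator {0<..s} v * lam v * \<psi> v + indicator {s<..u} v * lam v * \<psi> v \<partial>lborel)"
      using that by (intro Bochner_Integration.integral_cong) (auto simp: indicator_def)
    also have "\<dots> = ?I 0 s + ?I s u" using that by (intro Bochner_Integration.integral_add I) auto
    finally show ?thesis .
  qed
  have "?m 0 t - ?I 0 t = ?m 0 0 - ?I 0 0"
  proof (rule eq_if_mesh_bound[of t L "\<lambda>u. ?m 0 u - ?I 0 u" \<phi>])
    fix s u assume "0 \<le> s" "s \<le> u" "u \<le> t"
    thus "\<bar>(?m 0 u - ?I 0 u) - (?m 0 s - ?I 0 s)\<bar> \<le> L * (u - s) * (\<phi> s - \<phi> u)"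
      using m_bounds[of s u] m_add[of s u] I_add[of s u] t by simp
  qed (use t L in auto)
  also have "{\<omega> \<in> space M. 0 < X \<omega> \<and> X \<omega> \<le> 0 \<and> X \<omega> \<le> C \<omega> \<and> Z \<omega> \<in> B} = {}" by auto
  finally have "?m 0 t = ?I 0 t" by simp
  moreover have "prob {\<omega> \<in> space M. X \<omega> \<le> C \<omega> \<and> T \<omega> \<le> t \<and> Z \<omega> \<in> B} = ?m 0 t"
    by (rule finite_measure_eq_AE) (use AE_X_pos in \<open>auto elim!: eventually_mono simp: T_def\<close>)
  ultimately show "prob {\<omega> \<in> space M. X \<omega> \<le> C \<omega> \<and> T \<omega> \<le> t \<and> Z \<omega> \<in> B} = ?I 0 t" by simp
qed

text \<open>Extends \<open>event_prob_eq\<close> to every real \<open>t\<close>: beyond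
  \<open>tau\<close> almost surely nothing is observed, and below 0 there are almost surely no
  events. In this form the identity can be read as an equality of measures on a generating
  class.\<close>

lemma event_emeasure_eq:
  assumes B[measurable]: "B \<in> sets borel"
  shows "emeasure M {\<omega> \<in> space M. X \<omega> \<le> C \<omega> \<and> T \<omega> \<le> t \<and> Z \<omega> \<in> B} =
    (\<integral>\<^sup>+u. \<integral>\<^sup>+\<omega>. ennreal (lam u * indicator {..t} u * (indicator B (Z \<omega>) * (indicator {u..} (T \<omega>) * expZ \<omega>))) \<partial>M \<partial>lborel)"
proof -
  define \<psi> where "\<psi> u = expectation (\<lambda>\<omega>. indicator B (Z \<omega>) * (indicator {u..} (T \<omega>) * expZ \<omega>))" for u
  have int: "integrable M (\<lambda>\<omega>. indicator B (Z \<omega>) * (indicator {u..} (T \<omega>) * expZ \<omega>))" for u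
    by (rule Bochner_Integration.integrable_bound[OF integrable_expZ]) (auto simp: indicator_def)
  have \<psi>0: "0 \<le> \<psi> u" for u unfolding \<psi>_def by (intro Bochner_Integration.integral_nonneg) (auto simp: indicator_def)
  have inner: "(\<integral>\<^sup>+\<omega>. ennreal (c * (indicator B (Z \<omega>) * (indicator {u..} (T \<omega>) * expZ \<omega>))) \<partial>M) = ennreal (c * \<psi> u)"
    if "0 \<le> c" for c u
    using that int unfolding \<psi>_def
    by (subst nn_integral_eq_integral) (auto simp: indicator_def)
  have rhs: "(\<integral>\<^sup>+u. \<integral>\<^sup>+\<omega>. ennreal (lam u * indicator {..t} u * (indicator B (Z \<omega>) * (indicator {u..} (T \<omega>) * expZ \<omega>))) \<partial>M \<partial>lborel)
    = (\<integral>\<^sup>+u. ennreal (lam u * indicator {..t} u * \<psi> u) \<partial>lborel)"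
    by (intro nn_integral_cong inner) (simp add: lam_nonneg)
  show ?thesis
  proof (cases "0 \<le> t")
    case True
    define t' where "t' = min t tau"
    have t': "0 \<le> t'" "t' \<le> tau" using True tau_nonneg by (auto simp: t'_def)
    have "emeasure M {\<omega> \<in> space M. X \<omega> \<le> C \<omega> \<and> T \<omega> \<le> t \<and> Z \<omega> \<in> B} =
        emeasure M {\<omega> \<in> space M. X \<omega> \<le> C \<omega> \<and> T \<omega> \<le> t' \<and> Z \<omega> \<in> B}"
      by (rule emeasure_eq_AE)
         (use AE_T_le_tau in \<open>auto elim!: eventually_mono simp: t'_def T_def[symmetric]\<close>)
    also have "\<dots> = ennreal (\<integral>u. indicator {0<..t'} u * lam u * \<psi> u \<partial>lborel)"
      using event_prob_eq(2)[OF t' B] by (simp add: emeasure_eq_measure \<psi>_def)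
    also have "\<dots> = (\<integral>\<^sup>+u. ennreal (indicator {0<..t'} u * lam u * \<psi> u) \<partial>lborel)"
      using event_prob_eq(1)[OF t' B] \<psi>0 lam_nonneg unfolding \<psi>_def[symmetric]
      by (subst nn_integral_eq_integral) (auto intro!: AE_I2 mult_nonneg_nonneg)
    also have "\<dots> = (\<integral>\<^sup>+u. ennreal (lam u * indicator {..t} u * \<psi> u) \<partial>lborel)"
    proof (rule nn_integral_cong_AE)
      show "AE u in lborel. ennreal (indicator {0<..t'} u * lam u * \<psi> u) = ennreal (lam u * indicator {..t} u * \<psi> u)"
        using AE_lborel_singleton[of 0]
        by eventually_elim (auto simp: indicator_def lam_def t'_def)
    qed
    finally show ?thesis unfolding rhs .
  next
    case False
    have "emeasure M {\<omega> \<in> space M. X \<omega> \<le> C \<omega> \<and> T \<omega> \<le> t \<and> Z \<omega> \<in> B} = emeasure M {}"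
    proof (rule emeasure_eq_AE)
      show "AE \<omega> in M. (\<omega> \<in> {\<omega> \<in> space M. X \<omega> \<le> C \<omega> \<and> T \<omega> \<le> t \<and> Z \<omega> \<in> B}) = (\<omega> \<in> {})"
        using AE_X_pos by eventually_elim (use False in \<open>auto simp: T_def\<close>)
    qed auto
    also have "\<dots> = (\<integral>\<^sup>+u. ennreal (lam u * indicator {..t} u * \<psi> u) \<partial>(lborel :: real measure))"
    proof -
      have z: "lam u * indicator {..t} u * \<psi> u = 0" for u using False by (auto simp: lam_def indicator_def)
      show ?thesis by (simp only: z) simp
    qed
    finally show ?thesis unfolding rhs .
  qed
qed

text \<open>At \<open>t = tau\<close> the event identity states that two measures on the covariate
  space agree on every Borel set \<open>B\<close>: the law of \<open>Z\<close> restricted to the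
  events, and the image of the weighted product of Lebesgue measure and \<open>M\<close>.
  Integrating \<open>h\<close> against either side gives the claim.\<close>

lemma nn_integral_event_Z:
  assumes h[measurable]: "h \<in> borel_measurable borel"
  shows "(\<integral>\<^sup>+\<omega>. indicator {\<omega> \<in> space M. X \<omega> \<le> C \<omega>} \<omega> * h (Z \<omega>) \<partial>M) =
    (\<integral>\<^sup>+u. \<integral>\<^sup>+\<omega>. ennreal (lam u * (indicator {u..} (T \<omega>) * expZ \<omega>)) * h (Z \<omega>) \<partial>M \<partial>lborel)"
proof -
  let ?w = "\<lambda>p. ennreal (lam (fst p) * (indicator {fst p..} (T (snd p)) * expZ (snd p)))"
  have [measurable]: "?w \<in> borel_measurable (lborel \<Otimes>\<^sub>M M)"
  proof -
    have eq: "?w = (\<lambda>p. ennreal (lam (fst p) * (of_bool (fst p \<le> T (snd p)) * expZ (snd p))))"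
      by (auto simp: indicator_def fun_eq_iff)
    show ?thesis unfolding eq by measurable
  qed
  define N1 where "N1 = distr (density M (indicator {\<omega> \<in> space M. X \<omega> \<le> C \<omega>})) borel Z"
  define N2 where "N2 = distr (density (lborel \<Otimes>\<^sub>M M) ?w) borel (\<lambda>p. Z (snd p))"
  have "N1 = N2"
  proof (rule measure_eqI)
    show "sets N1 = sets N2" by (simp add: N1_def N2_def)
    fix B assume "B \<in> sets N1"
    hence [measurable]: "B \<in> sets borel" by (simp add: N1_def)
    have "emeasure N1 B = emeasure M {\<omega> \<in> space M. X \<omega> \<le> C \<omega> \<and> Z \<omega> \<in> B}"
      unfolding N1_def by (subst emeasure_distr, measurable) (subst emeasure_density, auto
         simp: nn_integral_indicator[symmetric] simp del: nn_integral_indicator intro!: nn_integral_cong simp: indicator_def)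
    also have "\<dots> = emeasure M {\<omega> \<in> space M. X \<omega> \<le> C \<omega> \<and> T \<omega> \<le> tau \<and> Z \<omega> \<in> B}"
      by (rule emeasure_eq_AE) (use AE_T_le_tau in \<open>auto elim!: eventually_mono simp: T_def\<close>)
    also have "\<dots> = (\<integral>\<^sup>+u. \<integral>\<^sup>+\<omega>. ?w (u, \<omega>) * indicator B (Z \<omega>) \<partial>M \<partial>lborel)"
      unfolding event_emeasure_eq[OF \<open>B \<in> sets borel\<close>]
      by (intro nn_integral_cong) (auto simp: indicator_def lam_def)
    also have "\<dots> = (\<integral>\<^sup>+p. ?w p * indicator B (Z (snd p)) \<partial>(lborel \<Otimes>\<^sub>M M))"
      by (subst nn_integral_fst[symmetric]) auto
    also have "\<dots> = emeasure N2 B"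
      unfolding N2_def by (subst emeasure_distr, measurable) (subst emeasure_density, auto
         intro!: nn_integral_cong simp: indicator_def space_pair_measure)
    finally show "emeasure N1 B = emeasure N2 B" .
  qed
  have "(\<integral>\<^sup>+\<omega>. indicator {\<omega> \<in> space M. X \<omega> \<le> C \<omega>} \<omega> * h (Z \<omega>) \<partial>M) = nn_integral N1 h"
    unfolding N1_def by (simp add: nn_integral_distr nn_integral_density)
  also have "\<dots> = (\<integral>\<^sup>+p. ?w p * h (Z (snd p)) \<partial>(lborel \<Otimes>\<^sub>M M))"
    unfolding \<open>N1 = N2\<close> N2_def by (simp add: nn_integral_distr nn_integral_density)
  also have "\<dots> = (\<integral>\<^sup>+u. \<integral>\<^sup>+\<omega>. ?w (u, \<omega>) * h (Z \<omega>) \<partial>M \<partial>lborel)"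
    by (subst nn_integral_fst[symmetric]) auto
  finally show ?thesis by simp
qed

lemma integrable_at_risk: "integrable M (\<lambda>\<omega>. indicator {u..} (T \<omega>) * expZ \<omega>)"
  by (rule Bochner_Integration.integrable_bound[OF integrable_expZ]) (auto simp: indicator_def)

lemma Phi_nn: "ennreal (Phi M T Z beta0 u) = (\<integral>\<^sup>+\<omega>. ennreal (indicator {u..} (T \<omega>) * expZ \<omega>) \<partial>M)"
  unfolding Phi_def by (rule nn_integral_eq_integral[symmetric, OF integrable_at_risk]) auto

lemma Phi_nonneg: "0 \<le> Phi M T Z beta0 u"
  unfolding Phi_def by (rule Bochner_Integration.integral_nonneg) auto

lemma Phi_anti: "u \<le> v \<Longrightarrow> Phi M T Z beta0 v \<le> Phi M T Z beta0 u"
  unfolding Phi_def by (intro integral_mono integrable_at_risk) (auto simp: indicator_def)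

lemma measurable_Phi [measurable]: "Phi M T Z beta0 \<in> borel_measurable borel"
proof -
  have "mono (\<lambda>u. - Phi M T Z beta0 u)" using Phi_anti by (auto simp: mono_def)
  hence "(\<lambda>u. - (- Phi M T Z beta0 u)) \<in> borel_measurable borel"
    by (intro borel_measurable_uminus borel_measurable_mono)
  thus ?thesis by simp
qed

text \<open>With \<open>B\<close> the whole space, \<open>event_emeasure_eq\<close> shows that the
  law of \<open>T\<close> restricted to the events and the measure with density
  \<open>lam * Phi\<close> have the same distribution function. This and
  \<open>nn_integral_event_Z\<close> are the two marginal identities behind the centring of the
  score.\<close>

lemma nn_integral_event_T:
  assumes k[measurable]: "k \<in> borel_measurable borel"
  shows "(\<integral>\<^sup>+\<omega>. indicator {\<omega> \<in> space M. X \<omega> \<le> C \<omega>} \<omega> * k (T \<omega>) \<partial>M) =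
    (\<integral>\<^sup>+u. ennreal (lam u * Phi M T Z beta0 u) * k u \<partial>lborel)"
proof -
  define N1 where "N1 = distr (density M (indicator {\<omega> \<in> space M. X \<omega> \<le> C \<omega>})) borel T"
  define N2 where "N2 = density lborel (\<lambda>u. ennreal (lam u * Phi M T Z beta0 u))"
  have e1: "emeasure N1 S = emeasure M {\<omega> \<in> space M. X \<omega> \<le> C \<omega> \<and> T \<omega> \<in> S}"
    if [measurable]: "S \<in> sets borel" for S
    unfolding N1_def by (subst emeasure_distr, measurable) (subst emeasure_density, auto
       simp: nn_integral_indicator[symmetric] simp del: nn_integral_indicator intro!: nn_integral_cong simp: indicator_def)
  have e: "emeasure N1 {..t} = emeasure N2 {..t}" for t
  proof -
    have U: "(UNIV :: (real ^ 'd) set) \<in> sets borel" by simp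
    have "emeasure N1 {..t} = emeasure M {\<omega> \<in> space M. X \<omega> \<le> C \<omega> \<and> T \<omega> \<le> t \<and> Z \<omega> \<in> UNIV}"
      by (simp add: e1)
    also have "\<dots> = (\<integral>\<^sup>+u. \<integral>\<^sup>+\<omega>. ennreal (lam u * indicator {..t} u) * ennreal (indicator {u..} (T \<omega>) * expZ \<omega>) \<partial>M \<partial>lborel)"
      unfolding event_emeasure_eq[OF U]
      by (intro nn_integral_cong) (simp add: ennreal_mult lam_nonneg flip: mult.assoc)
    also have "\<dots> = (\<integral>\<^sup>+u. ennreal (lam u * indicator {..t} u) * ennreal (Phi M T Z beta0 u) \<partial>lborel)"
      unfolding Phi_nn by (intro nn_integral_cong nn_integral_cmult) measurable
    also have "\<dots> = (\<integral>\<^sup>+u. ennreal (lam u * Phi M T Z beta0 u) * indicator {..t} u \<partial>lborel)"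
      by (intro nn_integral_cong) (auto simp: indicator_def ennreal_mult lam_nonneg Phi_nonneg)
    also have "\<dots> = emeasure N2 {..t}" unfolding N2_def by (subst emeasure_density) auto
    finally show ?thesis .
  qed
  have f1: "finite_borel_measure N1"
  proof -
    have "emeasure N1 UNIV < \<infinity>" by (simp add: e1 emeasure_eq_measure)
    hence "finite_measure N1" by (intro finite_measureI) (auto simp: N1_def)
    thus ?thesis by (simp add: finite_borel_measure_def finite_borel_measure_axioms_def N1_def)
  qed
  have f2: "finite_borel_measure N2"
  proof -
    have "emeasure N2 UNIV = (\<integral>\<^sup>+u. ennreal (lam u * Phi M T Z beta0 u) \<partial>lborel)"
      unfolding N2_def by (subst emeasure_density) auto
    also have "\<dots> = emeasure N2 {..tau}"
      unfolding N2_def by (subst emeasure_density, measurable) (intro nn_integral_cong, simp add: indicator_def lam_def)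
    also have "\<dots> < \<infinity>" unfolding e[symmetric] by (simp add: e1 emeasure_eq_measure)
    finally have "finite_measure N2" by (intro finite_measureI) (auto simp: N2_def)
    thus ?thesis by (simp add: finite_borel_measure_def finite_borel_measure_axioms_def N2_def)
  qed
  have "N1 = N2"
    by (rule cdf_unique'[OF f1 f2]) (simp add: cdf_def[abs_def] measure_def e)
  have "(\<integral>\<^sup>+\<omega>. indicator {\<omega> \<in> space M. X \<omega> \<le> C \<omega>} \<omega> * k (T \<omega>) \<partial>M) = nn_integral N1 k"
    unfolding N1_def by (simp add: nn_integral_distr nn_integral_density)
  also have "\<dots> = (\<integral>\<^sup>+u. ennreal (lam u * Phi M T Z beta0 u) * k u \<partial>lborel)"
    unfolding \<open>N1 = N2\<close> N2_def by (simp add: nn_integral_density)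
  finally show ?thesis .
qed

end

section \<open>Exponential moments and the centring of the score\<close>

lemma power_norm_le_exp:
  fixes x k :: real
  assumes "0 \<le> x" "0 < k"
  shows "x ^ m \<le> fact m / k ^ m * exp (k * x)"
proof -
  have "(\<Sum>n\<in>{m}. (k * x) ^ n /\<^sub>R fact n) \<le> (\<Sum>n. (k * x) ^ n /\<^sub>R fact n)"
    by (rule sum_le_suminf[OF summable_exp_generic]) (use assms in auto)
  hence "(k * x) ^ m / fact m \<le> exp (k * x)" by (simp add: exp_def field_simps)
  thus ?thesis using assms by (simp add: field_simps power_mult_distrib)
qed

context cox_horizon
begin

abbreviation Y :: "'w \<Rightarrow> real" where "Y \<omega> \<equiv> exp (beta0 \<bullet> Z \<omega> + kappa * norm (Z \<omega>))"

abbreviation event :: "'w set" where "event \<equiv> {\<omega> \<in> space M. X \<omega> \<le> C \<omega>}"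

text \<open>A common form for the population quantities: \<open>exp (beta0 \<bullet> z)\<close>
  gives \<open>Phi\<close>, the same times \<open>z $ k\<close> gives the components of
  \<open>D1\<close>, and \<open>weight\<close> gives the means of the lower-bound
  covariance.\<close>

definition at_risk_mean :: "(real ^ 'd \<Rightarrow> real) \<Rightarrow> real \<Rightarrow> real" where
  "at_risk_mean h u = expectation (\<lambda>\<omega>. indicator {u..} (T \<omega>) * h (Z \<omega>))"

text \<open>The affine bound in \<open>Y\<close> covers bounded functions and functions of
  exponential size alike, and its powers are combinations of the moments assumed in the
  locale.\<close>

lemma integrable_power_dominated:
  assumes [measurable]: "g \<in> borel_measurable M" and le: "\<And>\<omega>. \<bar>g \<omega>\<bar> \<le> c * Y \<omega> + c"
  shows "integrable M (\<lambda>\<omega>. g \<omega> ^ r)"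
    and "expectation (\<lambda>\<omega>. g \<omega> ^ (2 * r)) \<le> expectation (\<lambda>\<omega>. (c * Y \<omega> + c) ^ (2 * r))"
proof -
  have int: "integrable M (\<lambda>\<omega>. (c * Y \<omega> + c) ^ r)" for r
  proof -
    have "integrable M (\<lambda>\<omega>. \<Sum>k\<le>r. of_nat (r choose k) * (c ^ k * Y \<omega> ^ k) * c ^ (r - k))"
      by (intro Bochner_Integration.integrable_sum integrable_mult_left integrable_mult_right moments)
    thus ?thesis by (simp add: binomial_ring power_mult_distrib)
  qed
  show i: "integrable M (\<lambda>\<omega>. g \<omega> ^ r)" for r
    by (rule Bochner_Integration.integrable_bound[OF int[of r]])
       (auto simp: power_abs intro!: AE_I2 power_mono order_trans[OF le])
  show "expectation (\<lambda>\<omega>. g \<omega> ^ (2 * r)) \<le> expectation (\<lambda>\<omega>. (c * Y \<omega> + c) ^ (2 * r))"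
  proof (rule integral_mono[OF i int])
    fix \<omega>
    show "g \<omega> ^ (2 * r) \<le> (c * Y \<omega> + c) ^ (2 * r)"
      using power_mono[OF le abs_ge_zero, of \<omega> "2 * r"] by (simp add: power_even_abs)
  qed
qed

lemma integrable_dominated:
  assumes "g \<in> borel_measurable M" and "\<And>\<omega>. \<bar>g \<omega>\<bar> \<le> c * Y \<omega> + c"
  shows "integrable M (\<lambda>\<omega>. g \<omega> :: real)"
  using integrable_power_dominated(1)[OF assms, of 1] by simp

lemma norm_power_exp_le:
  "norm z ^ m * exp (beta0 \<bullet> z) \<le> fact m / kappa ^ m * exp (beta0 \<bullet> z + kappa * norm z)"
  using mult_right_mono[OF power_norm_le_exp[OF norm_ge_zero kappa_pos, of z m], of "exp (beta0 \<bullet> z)"]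
  by (simp add: exp_add mult_ac)

lemma integrable_norm_power_exp: "integrable M (\<lambda>\<omega>. norm (Z \<omega>) ^ m * expZ \<omega>)"
proof (rule integrable_dominated[where c="fact m / kappa ^ m"])
  show "\<bar>norm (Z \<omega>) ^ m * expZ \<omega>\<bar> \<le> fact m / kappa ^ m * Y \<omega> + fact m / kappa ^ m" for \<omega>
    using norm_power_exp_le[of "Z \<omega>" m] kappa_pos by (simp add: abs_mult add_increasing2)
qed measurable

text \<open>Moments of \<open>Z\<close> are only controlled under an exponential weight. On the
  events this weight comes for free: \<open>nn_integral_event_Z\<close> inserts the factor
  \<open>expZ\<close>, at the price of the finite integral of \<open>lam\<close>.\<close>

lemma integrable_event_norm_power: "integrable M (\<lambda>\<omega>. indicator event \<omega> * norm (Z \<omega>) ^ m)"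
proof (rule integrableI_bounded)
  let ?K = "expectation (\<lambda>\<omega>. norm (Z \<omega>) ^ m * expZ \<omega>)"
  have "(\<integral>\<^sup>+\<omega>. ennreal (norm (indicator event \<omega> * norm (Z \<omega>) ^ m)) \<partial>M) =
      (\<integral>\<^sup>+\<omega>. indicator event \<omega> * ennreal (norm (Z \<omega>) ^ m) \<partial>M)"
    by (intro nn_integral_cong) (auto simp: indicator_def)
  also have "\<dots> = (\<integral>\<^sup>+u. \<integral>\<^sup>+\<omega>. ennreal (lam u * (indicator {u..} (T \<omega>) * expZ \<omega>)) * ennreal (norm (Z \<omega>) ^ m) \<partial>M \<partial>lborel)"
    by (rule nn_integral_event_Z) measurable
  also have "\<dots> \<le> (\<integral>\<^sup>+u. \<integral>\<^sup>+\<omega>. ennreal (lam u) * ennreal (norm (Z \<omega>) ^ m * expZ \<omega>) \<partial>M \<partial>lborel)"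
    by (intro nn_integral_mono) (auto simp: indicator_def lam_nonneg mult_ac simp flip: ennreal_mult)
  also have "\<dots> = (\<integral>\<^sup>+u. ennreal (lam u) * ennreal ?K \<partial>lborel)"
    by (intro nn_integral_cong) (simp add: nn_integral_cmult nn_integral_eq_integral[OF integrable_norm_power_exp])
  also have "\<dots> = (\<integral>\<^sup>+u. ennreal (lam u) \<partial>lborel) * ennreal ?K"
    by (rule nn_integral_multc) measurable
  also have "(\<integral>\<^sup>+u. ennreal (lam u) \<partial>lborel) = (\<integral>\<^sup>+u. ennreal (indicator {0<..tau} u * lam u) \<partial>lborel)"
    by (rule nn_integral_cong_AE, use AE_lborel_singleton[of 0] in eventually_elim) (auto simp: lam_def indicator_def)
  also have "\<dots> = ennreal (\<integral>u. indicator {0<..tau} u * lam u \<partial>lborel)"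
    using lam_integral(1)[of 0 tau] tau_nonneg lam_nonneg by (intro nn_integral_eq_integral) auto
  also have "\<dots> * ennreal ?K < \<infinity>" by (simp add: ennreal_mult_less_top)
  finally show "(\<integral>\<^sup>+\<omega>. ennreal (norm (indicator event \<omega> * norm (Z \<omega>) ^ m)) \<partial>M) < \<infinity>" .
qed measurable

lemma measurable_at_risk_mean [measurable]:
  assumes [measurable]: "h \<in> borel_measurable borel"
  shows "at_risk_mean h \<in> borel_measurable borel"
proof -
  have "at_risk_mean h = (\<lambda>u. expectation (\<lambda>\<omega>. of_bool (u \<le> T \<omega>) * h (Z \<omega>)))"
    by (auto simp: at_risk_mean_def fun_eq_iff indicator_def)
  thus ?thesis by simp
qed

lemma Phi_eq: "Phi M T Z beta0 = at_risk_mean (\<lambda>z. exp (beta0 \<bullet> z))"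
  by (simp add: Phi_def at_risk_mean_def fun_eq_iff)

lemma prob_at_risk_pos: "u \<le> tau \<Longrightarrow> 0 < prob {\<omega> \<in> space M. u \<le> T \<omega>}"
  by (rule less_le_trans[OF T_atom]) (auto intro!: finite_measure_mono simp: T_def)

lemma at_risk_mean_pos:
  assumes "u \<le> tau" and h: "\<And>z. 0 < h z" and int: "integrable M (\<lambda>\<omega>. indicator {u..} (T \<omega>) * h (Z \<omega>))"
  shows "0 < at_risk_mean h u"
proof (rule ccontr)
  assume "\<not> 0 < at_risk_mean h u"
  moreover have "0 \<le> at_risk_mean h u"
    unfolding at_risk_mean_def using h by (intro Bochner_Integration.integral_nonneg) (simp add: less_imp_le)
  ultimately have "at_risk_mean h u = 0" by simp
  hence "AE \<omega> in M. indicator {u..} (T \<omega>) * h (Z \<omega>) = 0"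
    unfolding at_risk_mean_def using h
    by (subst (asm) integral_nonneg_eq_0_iff_AE[OF int]) (auto simp: less_imp_le)
  hence "AE \<omega> in M. \<not> u \<le> T \<omega>"
    using h by (auto elim!: eventually_mono simp: indicator_def) (metis less_irrefl)
  hence "prob {\<omega> \<in> space M. u \<le> T \<omega>} = 0" by (subst prob_eq_0) auto
  thus False using prob_at_risk_pos[OF assms(1)] by simp
qed

lemma Phi_pos: "u \<le> tau \<Longrightarrow> 0 < Phi M T Z beta0 u"
  unfolding Phi_eq by (rule at_risk_mean_pos) (use integrable_at_risk in auto)

text \<open>Both means equal the integral of \<open>lam\<close> times the at-risk mean of
  \<open>exp (beta0 \<bullet> z) * h z\<close>: the left one by the identity for \<open>Z\<close>,
  the right one by the identity for \<open>T\<close>, whose density contributes a factor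
  \<open>Phi\<close> that cancels the denominator.\<close>

lemma event_mean_eq_nonneg:
  assumes [measurable]: "h \<in> borel_measurable borel" and h0: "\<And>z. 0 \<le> h z"
    and int: "integrable M (\<lambda>\<omega>. expZ \<omega> * h (Z \<omega>))" and inth: "integrable M (\<lambda>\<omega>. indicator event \<omega> * h (Z \<omega>))"
  shows "integrable M (\<lambda>\<omega>. indicator event \<omega> * (at_risk_mean (\<lambda>z. exp (beta0 \<bullet> z) * h z) (T \<omega>) / Phi M T Z beta0 (T \<omega>)))"
    and "expectation (\<lambda>\<omega>. indicator event \<omega> * h (Z \<omega>)) =
      expectation (\<lambda>\<omega>. indicator event \<omega> * (at_risk_mean (\<lambda>z. exp (beta0 \<bullet> z) * h z) (T \<omega>) / Phi M T Z beta0 (T \<omega>)))"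
proof -
  let ?s = "at_risk_mean (\<lambda>z. exp (beta0 \<bullet> z) * h z)" and ?\<Phi> = "Phi M T Z beta0"
  have s0: "0 \<le> ?s u" for u unfolding at_risk_mean_def using h0 by (intro Bochner_Integration.integral_nonneg) auto
  have s_nn: "(\<integral>\<^sup>+\<omega>. ennreal (indicator {u..} (T \<omega>) * (expZ \<omega> * h (Z \<omega>))) \<partial>M) = ennreal (?s u)" for u
    unfolding at_risk_mean_def
    by (rule nn_integral_eq_integral, rule Bochner_Integration.integrable_bound[OF int]) (use h0 in \<open>auto simp: indicator_def\<close>)
  have eq: "(\<integral>\<^sup>+\<omega>. ennreal (indicator event \<omega> * h (Z \<omega>)) \<partial>M) = (\<integral>\<^sup>+\<omega>. ennreal (indicator event \<omega> * (?s (T \<omega>) / ?\<Phi> (T \<omega>))) \<partial>M)"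
  proof -
    have "(\<integral>\<^sup>+\<omega>. ennreal (indicator event \<omega> * h (Z \<omega>)) \<partial>M) = (\<integral>\<^sup>+\<omega>. indicator event \<omega> * ennreal (h (Z \<omega>)) \<partial>M)"
      by (intro nn_integral_cong) (auto simp: indicator_def)
    also have "\<dots> = (\<integral>\<^sup>+u. \<integral>\<^sup>+\<omega>. ennreal (lam u * (indicator {u..} (T \<omega>) * expZ \<omega>)) * ennreal (h (Z \<omega>)) \<partial>M \<partial>lborel)"
      by (rule nn_integral_event_Z) measurable
    also have "\<dots> = (\<integral>\<^sup>+u. \<integral>\<^sup>+\<omega>. ennreal (lam u) * ennreal (indicator {u..} (T \<omega>) * (expZ \<omega> * h (Z \<omega>))) \<partial>M \<partial>lborel)"
      by (intro nn_integral_cong) (simp add: h0 lam_nonneg mult_ac flip: ennreal_mult)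
    also have "\<dots> = (\<integral>\<^sup>+u. ennreal (lam u) * ennreal (?s u) \<partial>lborel)"
      by (simp add: nn_integral_cmult s_nn)
    also have "\<dots> = (\<integral>\<^sup>+u. ennreal (lam u * ?\<Phi> u) * ennreal (?s u / ?\<Phi> u) \<partial>lborel)"
    proof (intro nn_integral_cong)
      fix u
      show "ennreal (lam u) * ennreal (?s u) = ennreal (lam u * ?\<Phi> u) * ennreal (?s u / ?\<Phi> u)"
      proof (cases "u \<le> tau")
        case True
        thus ?thesis using Phi_pos[OF True] by (simp add: lam_nonneg s0 flip: ennreal_mult)
      qed (simp add: lam_def)
    qed
    also have "\<dots> = (\<integral>\<^sup>+\<omega>. indicator event \<omega> * ennreal (?s (T \<omega>) / ?\<Phi> (T \<omega>)) \<partial>M)"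
      by (rule nn_integral_event_T[symmetric]) measurable
    also have "\<dots> = (\<integral>\<^sup>+\<omega>. ennreal (indicator event \<omega> * (?s (T \<omega>) / ?\<Phi> (T \<omega>))) \<partial>M)"
      by (intro nn_integral_cong) (auto simp: indicator_def)
    finally show ?thesis .
  qed
  have fin: "(\<integral>\<^sup>+\<omega>. ennreal (indicator event \<omega> * h (Z \<omega>)) \<partial>M) = ennreal (expectation (\<lambda>\<omega>. indicator event \<omega> * h (Z \<omega>)))"
    by (rule nn_integral_eq_integral[OF inth]) (use h0 in auto)
  show i: "integrable M (\<lambda>\<omega>. indicator event \<omega> * (?s (T \<omega>) / ?\<Phi> (T \<omega>)))"
  proof (rule integrableI_nonneg)
    show "(\<integral>\<^sup>+\<omega>. ennreal (indicator event \<omega> * (?s (T \<omega>) / ?\<Phi> (T \<omega>))) \<partial>M) < \<infinity>"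
      unfolding eq[symmetric] fin by simp
  qed (use s0 Phi_nonneg in auto)
  have "ennreal (expectation (\<lambda>\<omega>. indicator event \<omega> * (?s (T \<omega>) / ?\<Phi> (T \<omega>)))) =
      (\<integral>\<^sup>+\<omega>. ennreal (indicator event \<omega> * (?s (T \<omega>) / ?\<Phi> (T \<omega>))) \<partial>M)"
    by (rule nn_integral_eq_integral[symmetric, OF i]) (use s0 Phi_nonneg in auto)
  thus "expectation (\<lambda>\<omega>. indicator event \<omega> * h (Z \<omega>)) = expectation (\<lambda>\<omega>. indicator event \<omega> * (?s (T \<omega>) / ?\<Phi> (T \<omega>)))"
    unfolding eq[symmetric] fin using s0 Phi_nonneg h0
    by (subst (asm) ennreal_inj) (auto intro!: Bochner_Integration.integral_nonneg)
qed

lemma score_mean_zero: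
  fixes k :: 'd
  shows "integrable M (\<lambda>\<omega>. indicator event \<omega> * (Z \<omega> $ k - at_risk_mean (\<lambda>z. exp (beta0 \<bullet> z) * z $ k) (T \<omega>) / Phi M T Z beta0 (T \<omega>)))"
    and "expectation (\<lambda>\<omega>. indicator event \<omega> * (Z \<omega> $ k - at_risk_mean (\<lambda>z. exp (beta0 \<bullet> z) * z $ k) (T \<omega>) / Phi M T Z beta0 (T \<omega>))) = 0"
proof -
  \<comment> \<open>The event identities concern nonnegative integrals, so the component is split
    into its positive and negative parts.\<close>
  define hp where "hp z = max 0 (z $ k)" for z :: "real ^ 'd"
  define hm where "hm z = max 0 (- z $ k)" for z :: "real ^ 'd"
  have [measurable]: "(\<lambda>z::real ^ 'd. z $ k) \<in> borel_measurable borel"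
    by (intro borel_measurable_continuous_onI continuous_intros)
  have hpm[measurable]: "hp \<in> borel_measurable borel" "hm \<in> borel_measurable borel"
    unfolding hp_def[abs_def] hm_def[abs_def] by measurable
  have h0: "0 \<le> hp z" "0 \<le> hm z" and hle: "hp z \<le> norm z" "hm z \<le> norm z" and hd: "z $ k = hp z - hm z" for z
    using component_le_norm_cart[of z k] by (auto simp: hp_def hm_def max_def)
  have int: "integrable M (\<lambda>\<omega>. expZ \<omega> * h (Z \<omega>))" "integrable M (\<lambda>\<omega>. indicator event \<omega> * h (Z \<omega>))"
    if [measurable]: "h \<in> borel_measurable borel" and "\<And>z. 0 \<le> h z" "\<And>z. h z \<le> norm z" for h
    by (rule Bochner_Integration.integrable_bound[OF integrable_norm_power_exp[of 1]], measurable,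
          use that(2,3) in \<open>simp add: abs_mult\<close>)
       (rule Bochner_Integration.integrable_bound[OF integrable_event_norm_power[of 1]], measurable,
          use that(2,3) in \<open>simp add: abs_mult mult_left_mono\<close>)
  note intp = int[OF hpm(1) h0(1) hle(1)] and intm = int[OF hpm(2) h0(2) hle(2)]
  note ep = event_mean_eq_nonneg[OF hpm(1) h0(1) intp] and em = event_mean_eq_nonneg[OF hpm(2) h0(2) intm]
  have s: "at_risk_mean (\<lambda>z. exp (beta0 \<bullet> z) * z $ k) u =
      at_risk_mean (\<lambda>z. exp (beta0 \<bullet> z) * hp z) u - at_risk_mean (\<lambda>z. exp (beta0 \<bullet> z) * hm z) u" for u
  proof -
    have "integrable M (\<lambda>\<omega>. indicator {u..} (T \<omega>) * (expZ \<omega> * hp (Z \<omega>)))" "integrable M (\<lambda>\<omega>. indicator {u..} (T \<omega>) * (expZ \<omega> * hm (Z \<omega>)))"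
      by (rule Bochner_Integration.integrable_bound[OF intp(1)], measurable, simp add: indicator_def h0)
         (rule Bochner_Integration.integrable_bound[OF intm(1)], measurable, simp add: indicator_def h0)
    thus ?thesis unfolding at_risk_mean_def by (simp add: hd algebra_simps flip: Bochner_Integration.integral_diff)
  qed
  let ?q = "\<lambda>h \<omega>. at_risk_mean (\<lambda>z. exp (beta0 \<bullet> z) * h z) (T \<omega>) / Phi M T Z beta0 (T \<omega>)"
  have e: "(\<lambda>\<omega>. indicator event \<omega> * (Z \<omega> $ k - at_risk_mean (\<lambda>z. exp (beta0 \<bullet> z) * z $ k) (T \<omega>) / Phi M T Z beta0 (T \<omega>))) =
    (\<lambda>\<omega>. (indicator event \<omega> * hp (Z \<omega>) - indicator event \<omega> * ?q hp \<omega>) - (indicator event \<omega> * hm (Z \<omega>) - indicator event \<omega> * ?q hm \<omega>))"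
    unfolding s by (auto simp: hd fun_eq_iff algebra_simps diff_divide_distrib)
  have i: "integrable M (\<lambda>\<omega>. indicator event \<omega> * hp (Z \<omega>) - indicator event \<omega> * ?q hp \<omega>)"
    "integrable M (\<lambda>\<omega>. indicator event \<omega> * hm (Z \<omega>) - indicator event \<omega> * ?q hm \<omega>)"
    using Bochner_Integration.integrable_diff[OF intp(2) ep(1)] Bochner_Integration.integrable_diff[OF intm(2) em(1)]
    by this
  show "integrable M (\<lambda>\<omega>. indicator event \<omega> * (Z \<omega> $ k - at_risk_mean (\<lambda>z. exp (beta0 \<bullet> z) * z $ k) (T \<omega>) / Phi M T Z beta0 (T \<omega>)))"
    unfolding e by (rule Bochner_Integration.integrable_diff[OF i])
  show "expectation (\<lambda>\<omega>. indicator event \<omega> * (Z \<omega> $ k - at_risk_mean (\<lambda>z. exp (beta0 \<bullet> z) * z $ k) (T \<omega>) / Phi M T Z beta0 (T \<omega>))) = 0"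
    unfolding e Bochner_Integration.integral_diff[OF i]
      Bochner_Integration.integral_diff[OF intp(2) ep(1)] Bochner_Integration.integral_diff[OF intm(2) em(1)]
      ep(2) em(2) by simp
qed

text \<open>On the events the law of \<open>T\<close> has a density, hence no atoms. The atom of
  \<open>T\<close> at \<open>tau\<close> therefore consists of censored observations.\<close>

lemma AE_no_event_at: "AE \<omega> in M. \<not> (X \<omega> \<le> C \<omega> \<and> T \<omega> = t)"
proof -
  have "(\<integral>\<^sup>+\<omega>. indicator event \<omega> * indicator {t} (T \<omega>) \<partial>M) = (\<integral>\<^sup>+u. ennreal (lam u * Phi M T Z beta0 u) * indicator {t} u \<partial>lborel)"
    by (rule nn_integral_event_T) measurable
  also have "\<dots> = (\<integral>\<^sup>+u. 0 \<partial>(lborel :: real measure))"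
    by (rule nn_integral_cong_AE, use AE_lborel_singleton[of t] in eventually_elim) simp
  also have "\<dots> = 0" by simp
  finally have "AE \<omega> in M. indicator event \<omega> * indicator {t} (T \<omega>) = (0 :: ennreal)"
    by (subst (asm) nn_integral_0_iff_AE) auto
  thus ?thesis using AE_space by eventually_elim (auto simp: indicator_def split: if_splits)
qed

end

section \<open>Consequences of a positive definite information matrix\<close>

lemma norm_outer_product: "norm (outer_product z z) = norm z * norm z"
proof -
  have "outer_product z z $ i = z $ i *\<^sub>R z" for i
    by (simp add: outer_product_def vec_eq_iff)
  hence "norm (outer_product z z) = L2_set (\<lambda>i. \<bar>z $ i\<bar> * norm z) UNIV"
    by (subst norm_vec_def) simp
  also have "\<dots> = norm z * norm z"
    by (subst L2_set_left_distrib[symmetric]) (auto simp: norm_vec_def)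
  finally show ?thesis .
qed

lemma outer_product_quadratic: "v \<bullet> (outer_product a a *v v) = (v \<bullet> a)\<^sup>2"
proof -
  have "outer_product a a *v v = (v \<bullet> a) *\<^sub>R a"
    by (simp add: outer_product_def matrix_vector_mult_def vec_eq_iff inner_vec_def sum_distrib_left sum_distrib_right mult_ac)
  thus ?thesis by (simp add: power2_eq_square)
qed

lemma bounded_linear_quadratic: "bounded_linear (\<lambda>A::real ^ 'd ^ 'd. v \<bullet> (A *v v))"
  unfolding linear_conv_bounded_linear[symmetric]
  by (rule linearI) (simp_all add: matrix_vector_mult_add_rdistrib inner_add_right flip: scaleR_matrix_vector_assoc)

lemma measurable_outer_product [measurable]:
  assumes "Z \<in> borel_measurable M"
  shows "(\<lambda>\<omega>. outer_product (Z \<omega>) (Z \<omega> :: real ^ 'd)) \<in> borel_measurable M"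
proof (rule measurable_compose[OF assms])
  show "(\<lambda>z::real ^ 'd. outer_product z z) \<in> borel_measurable borel"
    unfolding outer_product_def by (intro borel_measurable_continuous_onI continuous_intros)
qed

context cox_horizon
begin

text \<open>
  A lower bound for \<open>exp (\<beta> \<bullet> z)\<close> that is uniform over \<open>norm (\<beta> - beta0) \<le> kappa\<close> and bounded even
  after multiplication with powers of \<open>norm z\<close>.
\<close>

definition weight :: "real ^ 'd \<Rightarrow> real" where
  "weight z = exp (- ((norm beta0 + kappa) * norm z))"

lemma weight_rate_pos: "0 < norm beta0 + kappa"
  using kappa_pos by (simp add: add_nonneg_pos)

lemma weight_pos: "0 < weight z" and weight_le_1: "weight z \<le> 1"
  using weight_rate_pos by (auto simp: weight_def)

lemma measurable_weight [measurable]: "weight \<in> borel_measurable borel"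
  unfolding weight_def[abs_def] by measurable

lemma weight_norm_power_le: "weight z * norm z ^ m \<le> fact m / (norm beta0 + kappa) ^ m"
proof -
  have "weight z * norm z ^ m \<le> weight z * (fact m / (norm beta0 + kappa) ^ m * exp ((norm beta0 + kappa) * norm z))"
    by (intro mult_left_mono power_norm_le_exp weight_rate_pos) (auto simp: weight_pos less_imp_le)
  also have "\<dots> = fact m / (norm beta0 + kappa) ^ m" by (simp add: weight_def exp_minus)
  finally show ?thesis .
qed

lemma integrable_weight:
  assumes [measurable]: "g \<in> borel_measurable borel" and le: "\<And>z. \<bar>g z\<bar> \<le> c * norm z ^ m"
  shows "integrable M (\<lambda>\<omega>. indicator {u..} (T \<omega>) * (weight (Z \<omega>) * g (Z \<omega>)))"
proof (rule integrable_const_bound[where B="\<bar>c\<bar> * (fact m / (norm beta0 + kappa) ^ m)"])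
  have "\<bar>weight z * g z\<bar> \<le> \<bar>c\<bar> * (fact m / (norm beta0 + kappa) ^ m)" for z
  proof -
    have "\<bar>weight z * g z\<bar> \<le> weight z * (\<bar>c\<bar> * norm z ^ m)"
      using order_trans[OF le[of z] mult_right_mono[OF abs_ge_self]] weight_pos[of z]
      by (simp add: abs_mult mult_left_mono)
    also have "\<dots> = \<bar>c\<bar> * (weight z * norm z ^ m)" by simp
    also have "\<dots> \<le> \<bar>c\<bar> * (fact m / (norm beta0 + kappa) ^ m)"
      by (intro mult_left_mono weight_norm_power_le) auto
    finally show ?thesis .
  qed
  moreover have "0 \<le> \<bar>c\<bar> * (fact m / (norm beta0 + kappa) ^ m)" using weight_rate_pos by simp
  ultimately show "AE \<omega> in M. norm (indicator {u..} (T \<omega>) * (weight (Z \<omega>) * g (Z \<omega>))) \<le> \<bar>c\<bar> * (fact m / (norm beta0 + kappa) ^ m)"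
    by (auto simp: indicator_def)
qed measurable

text \<open>A covariance under the weighted at-risk law, multiplied by the square of its total mass.
  Without normalisation it is the population counterpart of the form in
  \<open>log_sum_exp_lower\<close> and a polynomial in finitely many means.\<close>

definition weighted_cov :: "real \<Rightarrow> 'd \<Rightarrow> 'd \<Rightarrow> real" where
  "weighted_cov u k l = at_risk_mean weight u * at_risk_mean (\<lambda>z. weight z * (z $ k * z $ l)) u -
     at_risk_mean (\<lambda>z. weight z * z $ k) u * at_risk_mean (\<lambda>z. weight z * z $ l) u"

definition weighted_var :: "real \<Rightarrow> real ^ 'd \<Rightarrow> real" where
  "weighted_var u v = (\<Sum>k\<in>UNIV. \<Sum>l\<in>UNIV. v $ k * v $ l * weighted_cov u k l)"

lemma measurable_component [measurable]: "(\<lambda>z::real ^ 'd. z $ k) \<in> borel_measurable borel"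
  by (intro borel_measurable_continuous_onI continuous_intros)

lemma integrable_weight_simps:
  "integrable M (\<lambda>\<omega>. indicator {u..} (T \<omega>) * weight (Z \<omega>))"
  "integrable M (\<lambda>\<omega>. indicator {u..} (T \<omega>) * (weight (Z \<omega>) * Z \<omega> $ k))"
  "integrable M (\<lambda>\<omega>. indicator {u..} (T \<omega>) * (weight (Z \<omega>) * (Z \<omega> $ k * Z \<omega> $ l)))"
proof -
  have "\<bar>z $ k * z $ l\<bar> \<le> 1 * norm z ^ 2" for z :: "real ^ 'd"
    by (auto simp: abs_mult power2_eq_square intro!: mult_mono component_le_norm_cart)
  thus "integrable M (\<lambda>\<omega>. indicator {u..} (T \<omega>) * (weight (Z \<omega>) * (Z \<omega> $ k * Z \<omega> $ l)))"
    by (intro integrable_weight) measurable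
  show "integrable M (\<lambda>\<omega>. indicator {u..} (T \<omega>) * weight (Z \<omega>))"
    "integrable M (\<lambda>\<omega>. indicator {u..} (T \<omega>) * (weight (Z \<omega>) * Z \<omega> $ k))"
    using integrable_weight[of "\<lambda>_. 1" 1 0 u] integrable_weight[of "\<lambda>z. z $ k" 1 1 u] component_le_norm_cart
    by auto
qed

lemma weighted_var_eq:
  "weighted_var u v = at_risk_mean weight u * at_risk_mean (\<lambda>z. weight z * (v \<bullet> z)\<^sup>2) u -
     (at_risk_mean (\<lambda>z. weight z * (v \<bullet> z)) u)\<^sup>2"
proof -
  have m1: "at_risk_mean (\<lambda>z. weight z * (v \<bullet> z)) u = (\<Sum>k\<in>UNIV. v $ k * at_risk_mean (\<lambda>z. weight z * z $ k) u)"
  proof -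
    have "at_risk_mean (\<lambda>z. weight z * (v \<bullet> z)) u =
       expectation (\<lambda>\<omega>. \<Sum>k\<in>UNIV. v $ k * (indicator {u..} (T \<omega>) * (weight (Z \<omega>) * Z \<omega> $ k)))"
      unfolding at_risk_mean_def by (simp add: inner_vec_def sum_distrib_left mult_ac)
    also have "\<dots> = (\<Sum>k\<in>UNIV. v $ k * at_risk_mean (\<lambda>z. weight z * z $ k) u)"
      unfolding at_risk_mean_def
      by (subst Bochner_Integration.integral_sum) (auto intro!: integrable_mult_right integrable_weight_simps)
    finally show ?thesis .
  qed
  have m2: "at_risk_mean (\<lambda>z. weight z * (v \<bullet> z)\<^sup>2) u =
      (\<Sum>k\<in>UNIV. \<Sum>l\<in>UNIV. v $ k * v $ l * at_risk_mean (\<lambda>z. weight z * (z $ k * z $ l)) u)"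
  proof -
    have "at_risk_mean (\<lambda>z. weight z * (v \<bullet> z)\<^sup>2) u =
       expectation (\<lambda>\<omega>. \<Sum>k\<in>UNIV. \<Sum>l\<in>UNIV. (v $ k * v $ l) * (indicator {u..} (T \<omega>) * (weight (Z \<omega>) * (Z \<omega> $ k * Z \<omega> $ l))))"
      unfolding at_risk_mean_def
      by (simp add: inner_vec_def power2_eq_square sum_product sum_distrib_left mult_ac)
    also have "\<dots> = (\<Sum>k\<in>UNIV. \<Sum>l\<in>UNIV. v $ k * v $ l * at_risk_mean (\<lambda>z. weight z * (z $ k * z $ l)) u)"
      unfolding at_risk_mean_def
      by (subst Bochner_Integration.integral_sum, intro Bochner_Integration.integrable_sum integrable_mult_right integrable_weight_simps)
         (subst Bochner_Integration.integral_sum, auto intro!: integrable_mult_right integrable_weight_simps)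
    finally show ?thesis .
  qed
  have "(at_risk_mean (\<lambda>z. weight z * (v \<bullet> z)) u)\<^sup>2 = (\<Sum>k\<in>UNIV. \<Sum>l\<in>UNIV. v $ k * v $ l *
      (at_risk_mean (\<lambda>z. weight z * z $ k) u * at_risk_mean (\<lambda>z. weight z * z $ l) u))"
    unfolding m1 by (simp add: power2_eq_square sum_product mult_ac)
  thus ?thesis unfolding m2 weighted_var_def weighted_cov_def
    by (simp add: sum_distrib_left right_diff_distrib mult_ac flip: sum_subtractf)
qed

lemma integrable_weight_linear:
  "integrable M (\<lambda>\<omega>. indicator {u..} (T \<omega>) * (weight (Z \<omega>) * (v \<bullet> Z \<omega>)))"
  "integrable M (\<lambda>\<omega>. indicator {u..} (T \<omega>) * (weight (Z \<omega>) * (v \<bullet> Z \<omega>)\<^sup>2))"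
proof -
  show "integrable M (\<lambda>\<omega>. indicator {u..} (T \<omega>) * (weight (Z \<omega>) * (v \<bullet> Z \<omega>)))"
    by (rule integrable_weight[where m=1 and c="norm v"]) (auto intro: Cauchy_Schwarz_ineq2)
  have "(v \<bullet> z)\<^sup>2 \<le> (norm v)\<^sup>2 * (norm z)\<^sup>2" for z
    using power_mono[OF Cauchy_Schwarz_ineq2[of v z] abs_ge_zero, of 2] by (simp add: power_mult_distrib)
  thus "integrable M (\<lambda>\<omega>. indicator {u..} (T \<omega>) * (weight (Z \<omega>) * (v \<bullet> Z \<omega>)\<^sup>2))"
    by (intro integrable_weight[where m=2 and c="(norm v)\<^sup>2"]) auto
qed

text \<open>The weighted mean square of \<open>v \<bullet> Z - m\<close>, with \<open>m\<close> the
  weighted mean, is the variance form over the total mass. As the weight is strictly positive, its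
  vanishing is an almost sure statement free of the weight, which allows changing over to the weight
  \<open>exp (beta0 \<bullet> z)\<close> of the information matrix.\<close>

lemma degenerate_if_weighted_var_nonpos:
  assumes "u \<le> tau" "weighted_var u v \<le> 0"
  shows "\<exists>m. AE \<omega> in M. u \<le> T \<omega> \<longrightarrow> v \<bullet> Z \<omega> = m"
proof -
  let ?b0 = "at_risk_mean weight u" and ?b1 = "at_risk_mean (\<lambda>z. weight z * (v \<bullet> z)) u"
    and ?b2 = "at_risk_mean (\<lambda>z. weight z * (v \<bullet> z)\<^sup>2) u"
  define m where "m = ?b1 / ?b0"
  have b0: "0 < ?b0" by (rule at_risk_mean_pos[OF assms(1) weight_pos integrable_weight_simps(1)])
  let ?g = "\<lambda>\<omega>. indicator {u..} (T \<omega>) * (weight (Z \<omega>) * (v \<bullet> Z \<omega> - m)\<^sup>2)"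
  have eq: "?g = (\<lambda>\<omega>. indicator {u..} (T \<omega>) * (weight (Z \<omega>) * (v \<bullet> Z \<omega>)\<^sup>2)
       - (2 * m) * (indicator {u..} (T \<omega>) * (weight (Z \<omega>) * (v \<bullet> Z \<omega>)))
       + m\<^sup>2 * (indicator {u..} (T \<omega>) * weight (Z \<omega>)))"
    by (auto simp: fun_eq_iff power2_eq_square algebra_simps)
  have int: "integrable M ?g" unfolding eq
    by (intro Bochner_Integration.integrable_add Bochner_Integration.integrable_diff integrable_mult_right
         integrable_weight_linear integrable_weight_simps)
  have "expectation ?g = ?b2 - (2 * m) * ?b1 + m\<^sup>2 * ?b0"
    unfolding eq at_risk_mean_def
    by (simp add: integrable_weight_linear integrable_weight_simps)
  also have "\<dots> = weighted_var u v / ?b0"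
    using b0 by (simp add: weighted_var_eq m_def power2_eq_square field_simps)
  also have "\<dots> \<le> 0" using assms(2) b0 by (simp add: divide_nonpos_pos)
  finally have "expectation ?g \<le> 0" .
  moreover have "0 \<le> expectation ?g"
    using weight_pos by (intro Bochner_Integration.integral_nonneg) (simp add: less_imp_le)
  ultimately have "expectation ?g = 0" by simp
  hence "AE \<omega> in M. ?g \<omega> = 0"
    using weight_pos by (subst (asm) integral_nonneg_eq_0_iff_AE[OF int]) (auto simp: less_imp_le)
  hence "AE \<omega> in M. u \<le> T \<omega> \<longrightarrow> v \<bullet> Z \<omega> = m"
  proof eventually_elim
    case (elim \<omega>)
    thus ?case using weight_pos[of "Z \<omega>"] by (auto simp: indicator_def)
  qed
  thus ?thesis ..
qed

lemma at_risk_mean_degenerate: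
  assumes "AE \<omega> in M. u \<le> T \<omega> \<longrightarrow> v \<bullet> Z \<omega> = m" and [measurable]: "h \<in> borel_measurable borel"
  shows "at_risk_mean (\<lambda>z. h z * (v \<bullet> z)) u = m * at_risk_mean h u"
    and "at_risk_mean (\<lambda>z. h z * (v \<bullet> z)\<^sup>2) u = m\<^sup>2 * at_risk_mean h u"
proof -
  have "at_risk_mean (\<lambda>z. h z * (v \<bullet> z)) u = expectation (\<lambda>\<omega>. m * (indicator {u..} (T \<omega>) * h (Z \<omega>)))"
    unfolding at_risk_mean_def
    by (rule integral_cong_AE, measurable, use assms(1) in eventually_elim) (auto simp: indicator_def)
  thus "at_risk_mean (\<lambda>z. h z * (v \<bullet> z)) u = m * at_risk_mean h u" by (simp add: at_risk_mean_def)
  have "at_risk_mean (\<lambda>z. h z * (v \<bullet> z)\<^sup>2) u = expectation (\<lambda>\<omega>. m\<^sup>2 * (indicator {u..} (T \<omega>) * h (Z \<omega>)))"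
    unfolding at_risk_mean_def
    by (rule integral_cong_AE, measurable, use assms(1) in eventually_elim) (auto simp: indicator_def)
  thus "at_risk_mean (\<lambda>z. h z * (v \<bullet> z)\<^sup>2) u = m\<^sup>2 * at_risk_mean h u" by (simp add: at_risk_mean_def)
qed

lemma weighted_var_degenerate:
  assumes "AE \<omega> in M. u \<le> T \<omega> \<longrightarrow> v \<bullet> Z \<omega> = m"
  shows "weighted_var u v = 0"
  unfolding weighted_var_eq at_risk_mean_degenerate[OF assms measurable_weight]
  by (simp add: power2_eq_square algebra_simps)

definition info_integrand :: "real \<Rightarrow> real ^ 'd ^ 'd" where
  "info_integrand u = (Phi M T Z beta0 u * lambda0 u) *\<^sub>R
      ((1 / Phi M T Z beta0 u) *\<^sub>R D2 M T Z beta0 u -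
       (1 / (Phi M T Z beta0 u)\<^sup>2) *\<^sub>R outer_product (D1 M T Z beta0 u) (D1 M T Z beta0 u))"

lemma info_integrand_degenerate:
  assumes deg: "AE \<omega> in M. u \<le> T \<omega> \<longrightarrow> v \<bullet> Z \<omega> = m" and "u \<le> tau"
  shows "v \<bullet> (info_integrand u *v v) = 0"
proof -
  let ?L = "\<lambda>A::real ^ 'd ^ 'd. v \<bullet> (A *v v)" and ?\<Phi> = "Phi M T Z beta0 u"
  interpret L: bounded_linear ?L by (rule bounded_linear_quadratic)
  have i1: "integrable M (\<lambda>\<omega>. (indicator {u..} (T \<omega>) * expZ \<omega>) *\<^sub>R Z \<omega>)"
    by (rule Bochner_Integration.integrable_bound[OF integrable_norm_power_exp[of 1]])
       (auto simp: indicator_def)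
  have i2: "integrable M (\<lambda>\<omega>. (indicator {u..} (T \<omega>) * expZ \<omega>) *\<^sub>R outer_product (Z \<omega>) (Z \<omega>))"
    by (rule Bochner_Integration.integrable_bound[OF integrable_norm_power_exp[of 2]])
       (auto simp: indicator_def norm_outer_product power2_eq_square abs_mult)
  have "v \<bullet> D1 M T Z beta0 u = expectation (\<lambda>\<omega>. v \<bullet> ((indicator {u..} (T \<omega>) * expZ \<omega>) *\<^sub>R Z \<omega>))"
    unfolding D1_def by (rule integral_inner_right[symmetric, OF i1])
  also have "\<dots> = at_risk_mean (\<lambda>z. exp (beta0 \<bullet> z) * (v \<bullet> z)) u"
    by (simp add: at_risk_mean_def mult_ac)
  also have "\<dots> = m * ?\<Phi>" unfolding Phi_eq by (rule at_risk_mean_degenerate[OF deg]) measurable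
  finally have d1: "v \<bullet> D1 M T Z beta0 u = m * ?\<Phi>" .
  have "?L (D2 M T Z beta0 u) = expectation (\<lambda>\<omega>. ?L ((indicator {u..} (T \<omega>) * expZ \<omega>) *\<^sub>R outer_product (Z \<omega>) (Z \<omega>)))"
    unfolding D2_def by (rule integral_bounded_linear[symmetric, OF bounded_linear_quadratic i2])
  also have "\<dots> = at_risk_mean (\<lambda>z. exp (beta0 \<bullet> z) * (v \<bullet> z)\<^sup>2) u"
    by (simp add: at_risk_mean_def L.scaleR outer_product_quadratic mult_ac)
  also have "\<dots> = m\<^sup>2 * ?\<Phi>" unfolding Phi_eq by (rule at_risk_mean_degenerate[OF deg]) measurable
  finally have d2: "?L (D2 M T Z beta0 u) = m\<^sup>2 * ?\<Phi>" .
  show ?thesis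
    unfolding info_integrand_def L.scaleR L.diff d2 outer_product_quadratic d1
    using Phi_pos[OF assms(2)] by (simp add: power2_eq_square)
qed

text \<open>The times before which no event is possible form an initial segment carrying no mass of
  the event times, so the density \<open>lam * Phi\<close> vanishes almost everywhere on it; before
  \<open>tau\<close> only \<open>lam\<close> can be responsible. Hence degeneracy at times with
  positive event probability already kills the whole information integral.\<close>

lemma AE_hazard_zero_or_event:
  "AE u in lborel. 0 < u \<and> u < tau \<longrightarrow> lambda0 u = 0 \<or> 0 < prob {\<omega> \<in> space M. X \<omega> \<le> C \<omega> \<and> T \<omega> \<le> u}"
proof -
  define g where "g u = prob {\<omega> \<in> space M. X \<omega> \<le> C \<omega> \<and> T \<omega> \<le> u}" for u
  have g_mono: "u \<le> v \<Longrightarrow> g u \<le> g v" for u v unfolding g_def by (intro finite_measure_mono) auto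
  have [measurable]: "g \<in> borel_measurable borel" by (rule borel_measurable_mono) (simp add: mono_def g_mono)
  have g0: "0 \<le> g u" for u by (simp add: g_def)
  \<comment> \<open>The boundary of the initial segment is the only place where an event could hide.
    Strictly inside, a rational time between the event and a later point of the segment excludes it;
    the boundary point itself is excluded because event times have no atoms.\<close>
  define s where "s = Sup {u. g u = 0}"
  have "AE \<omega> in M. \<forall>q\<in>\<rat>. g q = 0 \<longrightarrow> \<not> (X \<omega> \<le> C \<omega> \<and> T \<omega> \<le> q)"
  proof (rule AE_ball_countable[THEN iffD2, OF countable_rat], rule ballI)
    fix q
    show "AE \<omega> in M. g q = 0 \<longrightarrow> \<not> (X \<omega> \<le> C \<omega> \<and> T \<omega> \<le> q)"
    proof (cases "g q = 0")
      case True
      thus ?thesis unfolding g_def by (subst (asm) prob_eq_0) (auto elim!: eventually_mono)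
    qed simp
  qed
  hence "AE \<omega> in M. X \<omega> \<le> C \<omega> \<longrightarrow> g (T \<omega>) \<noteq> 0"
    using AE_no_event_at[of s]
  proof eventually_elim
    case (elim \<omega>)
    show ?case
    proof (intro impI notI)
      assume XC: "X \<omega> \<le> C \<omega>" and z: "g (T \<omega>) = 0"
      have up: "u \<le> T \<omega>" if "g u = 0" for u
      proof (rule ccontr)
        assume "\<not> u \<le> T \<omega>"
        then obtain q where q: "q \<in> \<rat>" "T \<omega> < q" "q < u" using Rats_dense_in_real[of "T \<omega>" u] by auto
        have "g q = 0" using g_mono[of q u] g0[of q] q that by simp
        thus False using elim(1) q XC by auto
      qed
      have "s = T \<omega>" unfolding s_def by (rule cSup_eq_maximum) (use z up in auto)
      thus False using elim(2) XC by simp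
    qed
  qed
  hence "AE \<omega> in M. indicator event \<omega> * indicator {u. g u = 0} (T \<omega>) = (0 :: ennreal)"
    by eventually_elim (auto simp: indicator_def)
  hence "(\<integral>\<^sup>+\<omega>. indicator event \<omega> * indicator {u. g u = 0} (T \<omega>) \<partial>M) = 0"
    by (subst nn_integral_0_iff_AE) auto
  also have "(\<integral>\<^sup>+\<omega>. indicator event \<omega> * indicator {u. g u = 0} (T \<omega>) \<partial>M) =
      (\<integral>\<^sup>+u. ennreal (lam u * Phi M T Z beta0 u) * indicator {u. g u = 0} u \<partial>lborel)"
    by (rule nn_integral_event_T) measurable
  finally have "AE u in lborel. ennreal (lam u * Phi M T Z beta0 u) * indicator {u. g u = 0} u = 0"
    by (subst (asm) nn_integral_0_iff_AE) auto
  thus ?thesis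
  proof eventually_elim
    case (elim u)
    show ?case
    proof (intro impI)
      assume u: "0 < u \<and> u < tau"
      show "lambda0 u = 0 \<or> 0 < prob {\<omega> \<in> space M. X \<omega> \<le> C \<omega> \<and> T \<omega> \<le> u}"
      proof (cases "g u = 0")
        case True
        hence "lam u * Phi M T Z beta0 u = 0"
          using elim mult_nonneg_nonneg[OF lam_nonneg[of u] Phi_nonneg[of u]] by (auto simp: ennreal_eq_0_iff)
        thus ?thesis using Phi_pos[of u] u by (auto simp: lam_def)
      next
        case False
        thus ?thesis using g0[of u] unfolding g_def by linarith
      qed
    qed
  qed
qed

lemma weighted_var_scaleR: "weighted_var u (c *\<^sub>R v) = c\<^sup>2 * weighted_var u v"
  by (simp add: weighted_var_def sum_distrib_left power2_eq_square mult_ac)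

lemma continuous_weighted_var: "continuous_on S (weighted_var u)"
  unfolding weighted_var_def by (intro continuous_intros)

text \<open>The closed sets of degenerate unit directions increase with \<open>u\<close>, so a
  finite intersection is represented by its smallest index. If all were nonempty, compactness would
  give one direction degenerate at every relevant time, and the information matrix would vanish in
  it.\<close>

lemma weighted_var_positive:
  assumes pd: "positive_definite (information_matrix M T Z lambda0 beta0 (ereal tau))"
  shows "\<exists>u c. 0 < prob {\<omega> \<in> space M. X \<omega> \<le> C \<omega> \<and> T \<omega> \<le> u} \<and> 0 < c \<and> (\<forall>v. c * (norm v)\<^sup>2 \<le> weighted_var u v)"
proof -
  define H where "H = {u. u \<le> tau \<and> 0 < prob {\<omega> \<in> space M. X \<omega> \<le> C \<omega> \<and> T \<omega> \<le> u}}"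
  let ?S = "sphere (0 :: real ^ 'd) 1"
  have "\<exists>u\<in>H. \<forall>v\<in>?S. 0 < weighted_var u v"
  proof (rule ccontr)
    assume "\<not> (\<exists>u\<in>H. \<forall>v\<in>?S. 0 < weighted_var u v)"
    hence deg: "\<And>u. u \<in> H \<Longrightarrow> \<exists>v\<in>?S. weighted_var u v \<le> 0" by (auto simp: not_less)
    have ne: "?S \<noteq> {}" by simp
    have "?S \<inter> (\<Inter>u\<in>H. {v. weighted_var u v \<le> 0}) \<noteq> {}"
    proof (rule compact_imp_fip_image)
      show "compact ?S" by simp
      show "closed {v. weighted_var u v \<le> 0}" for u
        by (intro closed_Collect_le continuous_weighted_var continuous_on_const)
      fix I assume I: "finite I" "I \<subseteq> H"
      show "?S \<inter> (\<Inter>u\<in>I. {v. weighted_var u v \<le> 0}) \<noteq> {}"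
      proof (cases "I = {}")
        \<comment> \<open>The smallest time of \<open>I\<close> has the largest risk set, so its
          degenerate direction serves all other times of \<open>I\<close>.\<close>
        case False
        have min: "Min I \<in> H" using Min_in[OF I(1) False] I(2) by blast
        obtain v where v: "v \<in> ?S" "weighted_var (Min I) v \<le> 0" using deg[OF min] by blast
        obtain m where "AE \<omega> in M. Min I \<le> T \<omega> \<longrightarrow> v \<bullet> Z \<omega> = m"
          using degenerate_if_weighted_var_nonpos[OF _ v(2)] min by (auto simp: H_def)
        hence "AE \<omega> in M. u \<le> T \<omega> \<longrightarrow> v \<bullet> Z \<omega> = m" if "u \<in> I" for u
          using Min_le[OF I(1) that] by (auto elim!: eventually_mono)
        hence "weighted_var u v = 0" if "u \<in> I" for u using weighted_var_degenerate that by blast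
        thus ?thesis using v(1) by auto
      qed (use ne in auto)
    qed
    then obtain v where "v \<in> ?S \<inter> (\<Inter>u\<in>H. {v. weighted_var u v \<le> 0})" by blast
    hence v: "v \<in> ?S" "\<And>u. u \<in> H \<Longrightarrow> weighted_var u v \<le> 0" by auto
    let ?L = "\<lambda>A::real ^ 'd ^ 'd. v \<bullet> (A *v v)"
    interpret L: bounded_linear ?L by (rule bounded_linear_quadratic)
    have zero: "AE u in lborel. indicator (einterval 0 (ereal tau)) u *\<^sub>R ?L (info_integrand u) = 0"
      using AE_hazard_zero_or_event
    proof eventually_elim
      case (elim u)
      show ?case
      proof (cases "0 < u \<and> u < tau")
        case True
        show ?thesis
        proof (cases "lambda0 u = 0")
          case True
          thus ?thesis by (simp add: info_integrand_def)
        next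
          case False
          hence "u \<in> H" using elim \<open>0 < u \<and> u < tau\<close> by (auto simp: H_def)
          then obtain m where "AE \<omega> in M. u \<le> T \<omega> \<longrightarrow> v \<bullet> Z \<omega> = m"
            using degenerate_if_weighted_var_nonpos[OF _ v(2)] True by fastforce
          thus ?thesis using info_integrand_degenerate True by simp
        qed
      next
        case False
        thus ?thesis by (auto simp: einterval_def indicator_def zero_ereal_def)
      qed
    qed
    have info: "information_matrix M T Z lambda0 beta0 (ereal tau) =
        (\<integral>u. indicator (einterval 0 (ereal tau)) u *\<^sub>R info_integrand u \<partial>lborel)"
      using tau_nonneg
      by (simp add: information_matrix_def interval_lebesgue_integral_def set_lebesgue_integral_def info_integrand_def zero_ereal_def)
    have "?L (information_matrix M T Z lambda0 beta0 (ereal tau)) = 0"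
    proof (cases "integrable lborel (\<lambda>u. indicator (einterval 0 (ereal tau)) u *\<^sub>R info_integrand u)")
      case True
      have "?L (information_matrix M T Z lambda0 beta0 (ereal tau)) =
          (\<integral>u. ?L (indicator (einterval 0 (ereal tau)) u *\<^sub>R info_integrand u) \<partial>lborel)"
        unfolding info by (rule integral_bounded_linear[symmetric, OF bounded_linear_quadratic True])
      also have "\<dots> = (\<integral>u. 0 \<partial>(lborel :: real measure))"
      proof (rule integral_cong_AE)
        show "(\<lambda>u. ?L (indicator (einterval 0 (ereal tau)) u *\<^sub>R info_integrand u)) \<in> borel_measurable lborel"
          by (rule borel_measurable_integrable[OF integrable_bounded_linear[OF bounded_linear_quadratic True]])
        show "AE u in lborel. ?L (indicator (einterval 0 (ereal tau)) u *\<^sub>R info_integrand u) = 0"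
          using zero unfolding L.scaleR .
      qed simp
      finally show ?thesis by simp
    next
      \<comment> \<open>A non-integrable integrand has integral 0 by convention, and the zero matrix
        is not positive definite either.\<close>
      case False
      thus ?thesis unfolding info by (simp add: not_integrable_integral_eq)
    qed
    moreover have "v \<noteq> 0" using v(1) by auto
    ultimately show False using pd by (auto simp: positive_definite_def)
  qed
  then obtain u where u: "u \<in> H" "\<And>v. v \<in> ?S \<Longrightarrow> 0 < weighted_var u v" by blast
  obtain v0 where v0: "v0 \<in> ?S" "\<And>v. v \<in> ?S \<Longrightarrow> weighted_var u v0 \<le> weighted_var u v"
    using continuous_attains_inf[of ?S "weighted_var u"] continuous_weighted_var by auto
  \<comment> \<open>The constant is the minimum over the unit sphere; quadratic homogeneity extends
    it to all directions.\<close>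
  have "weighted_var u v0 * (norm v)\<^sup>2 \<le> weighted_var u v" for v
  proof (cases "v = 0")
    case False
    have "weighted_var u v0 \<le> weighted_var u ((1 / norm v) *\<^sub>R v)" using False by (intro v0(2)) simp
    thus ?thesis using False by (simp add: weighted_var_scaleR field_simps power2_eq_square)
  qed (simp add: weighted_var_def)
  thus ?thesis using u v0(1) by (auto simp: H_def)
qed

end

section \<open>The partial likelihood\<close>

lemma convex_on_if_subgradient:
  fixes g :: "'a::euclidean_space \<Rightarrow> real"
  assumes "\<And>x. \<exists>p. \<forall>y. g x + p \<bullet> (y - x) \<le> g y"
  shows "convex_on UNIV g"
proof (rule convex_onI)
  fix t :: real and x y :: 'a assume t: "0 < t" "t < 1"
  define z where "z = (1 - t) *\<^sub>R x + t *\<^sub>R y"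
  obtain p where p: "\<And>y. g z + p \<bullet> (y - z) \<le> g y" using assms by blast
  have "(1 - t) * (g z + p \<bullet> (x - z)) + t * (g z + p \<bullet> (y - z)) \<le> (1 - t) * g x + t * g y"
    using t by (intro add_mono mult_left_mono p) auto
  moreover have "(1 - t) * (g z + p \<bullet> (x - z)) + t * (g z + p \<bullet> (y - z)) =
      g z + p \<bullet> ((1 - t) *\<^sub>R (x - z) + t *\<^sub>R (y - z))"
    by (simp add: inner_add_right algebra_simps)
  moreover have "(1 - t) *\<^sub>R (x - z) + t *\<^sub>R (y - z) = 0" by (simp add: z_def algebra_simps)
  ultimately show "g ((1 - t) *\<^sub>R x + t *\<^sub>R y) \<le> (1 - t) * g x + t * g y" by (simp add: z_def)
qed simp

text \<open>
  Negated logarithms are used throughout: the objective becomes convex, and \<open>neg_score\<close> is its gradient.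
\<close>

definition risk_sum :: "nat \<Rightarrow> (nat \<Rightarrow> real) \<Rightarrow> (nat \<Rightarrow> real ^ 'd) \<Rightarrow> real ^ 'd \<Rightarrow> real \<Rightarrow> real" where
  "risk_sum n T Z \<beta> t = (\<Sum>j<n. indicator {t..} (T j) * exp (\<beta> \<bullet> Z j))"

definition risk_vec :: "nat \<Rightarrow> (nat \<Rightarrow> real) \<Rightarrow> (nat \<Rightarrow> real ^ 'd) \<Rightarrow> real ^ 'd \<Rightarrow> real \<Rightarrow> real ^ 'd" where
  "risk_vec n T Z \<beta> t = (\<Sum>j<n. (indicator {t..} (T j) * exp (\<beta> \<bullet> Z j)) *\<^sub>R Z j)"

definition neg_log_likelihood :: "nat \<Rightarrow> (nat \<Rightarrow> real) \<Rightarrow> (nat \<Rightarrow> real) \<Rightarrow> (nat \<Rightarrow> real ^ 'd) \<Rightarrow> real ^ 'd \<Rightarrow> real" where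
  "neg_log_likelihood n T D Z \<beta> = (\<Sum>i<n. of_bool (D i = 1) * (ln (risk_sum n T Z \<beta> (T i)) - \<beta> \<bullet> Z i))"

definition neg_score :: "nat \<Rightarrow> (nat \<Rightarrow> real) \<Rightarrow> (nat \<Rightarrow> real) \<Rightarrow> (nat \<Rightarrow> real ^ 'd) \<Rightarrow> real ^ 'd \<Rightarrow> real ^ 'd" where
  "neg_score n T D Z \<beta> = (\<Sum>i<n. of_bool (D i = 1) *\<^sub>R
      ((1 / risk_sum n T Z \<beta> (T i)) *\<^sub>R risk_vec n T Z \<beta> (T i) - Z i))"

lemma risk_sum_pos:
  assumes "i < n"
  shows "0 < risk_sum n T Z \<beta> (T i)"
proof -
  have "0 < indicator {T i..} (T i) * exp (\<beta> \<bullet> Z i)" by simp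
  also have "\<dots> \<le> risk_sum n T Z \<beta> (T i)"
    unfolding risk_sum_def by (rule member_le_sum) (use assms in auto)
  finally show ?thesis .
qed

text \<open>Without ties among the events, \<open>T\<close> is injective on the subjects with an
  event and \<open>event_subject\<close> is its inverse. This turns the product over a set of times
  into a product over subjects, so that maximizing the likelihood is minimizing a sum.\<close>

lemma partial_likelihood_eq_exp:
  assumes noties: "\<And>i j. i < n \<Longrightarrow> j < n \<Longrightarrow> D i = 1 \<Longrightarrow> D j = 1 \<Longrightarrow> T i = T j \<Longrightarrow> i = j"
  shows "partial_likelihood n T D Z \<beta> = exp (- neg_log_likelihood n T D Z \<beta>)"
proof -
  let ?I = "{i. i < n \<and> D i = 1}"
  have subj: "event_subject n T D (T i) = i" if "i \<in> ?I" for i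
    unfolding event_subject_def by (rule some_equality) (use that noties in auto)
  have et: "event_times n T D = T ` ?I" by (auto simp: event_times_def)
  have inj: "inj_on T ?I" using noties by (auto simp: inj_on_def)
  have "partial_likelihood n T D Z \<beta> = (\<Prod>i\<in>?I. exp (\<beta> \<bullet> Z i) / risk_sum n T Z \<beta> (T i))"
    unfolding partial_likelihood_def et prod.reindex[OF inj] risk_sum_def o_def
    by (rule prod.cong) (auto simp: subj)
  also have "\<dots> = (\<Prod>i\<in>?I. exp (- (ln (risk_sum n T Z \<beta> (T i)) - \<beta> \<bullet> Z i)))"
    by (rule prod.cong) (auto simp: exp_diff risk_sum_pos)
  also have "\<dots> = exp (- (\<Sum>i\<in>?I. ln (risk_sum n T Z \<beta> (T i)) - \<beta> \<bullet> Z i))"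
    by (simp add: exp_sum sum_negf[symmetric] del: minus_diff_eq)
  also have "(\<Sum>i\<in>?I. ln (risk_sum n T Z \<beta> (T i)) - \<beta> \<bullet> Z i) = neg_log_likelihood n T D Z \<beta>"
    unfolding neg_log_likelihood_def by (rule sum.mono_neutral_cong_left) auto
  finally show ?thesis .
qed

lemma log_risk_sum_lower:
  fixes Z :: "nat \<Rightarrow> real ^ 'd"
  assumes i: "i < n" and q0: "\<And>j. 0 \<le> q j"
    and q1: "\<And>j s. j < n \<Longrightarrow> 0 \<le> s \<Longrightarrow> s \<le> 1 \<Longrightarrow> q j \<le> indicator {T i..} (T j) * exp ((\<beta> + s *\<^sub>R h) \<bullet> Z j)"
    and D: "\<And>s. 0 \<le> s \<Longrightarrow> s \<le> 1 \<Longrightarrow> risk_sum n T Z (\<beta> + s *\<^sub>R h) (T i) \<le> Dm"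
  shows "ln (risk_sum n T Z \<beta> (T i)) + (1 / risk_sum n T Z \<beta> (T i)) *\<^sub>R risk_vec n T Z \<beta> (T i) \<bullet> h
      + ((\<Sum>j<n. q j) * (\<Sum>j<n. q j * (h \<bullet> Z j)\<^sup>2) - (\<Sum>j<n. q j * (h \<bullet> Z j))\<^sup>2) / (2 * Dm\<^sup>2)
      \<le> ln (risk_sum n T Z (\<beta> + h) (T i))"
proof -
  let ?a = "\<lambda>j. indicator {T i..} (T j) * exp (\<beta> \<bullet> Z j)"
  have e: "?a j * exp (s * (h \<bullet> Z j)) = indicator {T i..} (T j) * exp ((\<beta> + s *\<^sub>R h) \<bullet> Z j)" for j s
    by (simp add: inner_add_left exp_add)
  have "ln (\<Sum>j<n. ?a j) + (\<Sum>j<n. ?a j * (h \<bullet> Z j)) / (\<Sum>j<n. ?a j)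
      + ((\<Sum>j<n. q j) * (\<Sum>j<n. q j * (h \<bullet> Z j)\<^sup>2) - (\<Sum>j<n. q j * (h \<bullet> Z j))\<^sup>2) / (2 * Dm\<^sup>2)
      \<le> ln (\<Sum>j<n. ?a j * exp (h \<bullet> Z j))"
  proof (rule log_sum_exp_lower)
    show "0 < (\<Sum>j<n. ?a j)" using risk_sum_pos[OF i] by (simp add: risk_sum_def)
    show "(\<Sum>j<n. ?a j * exp (s * (h \<bullet> Z j))) \<le> Dm" if "0 \<le> s" "s \<le> 1" for s
      unfolding e using D[OF that] by (simp add: risk_sum_def)
  qed (use q0 q1 in \<open>auto simp: e\<close>)
  moreover have "(\<Sum>j<n. ?a j * exp (h \<bullet> Z j)) = risk_sum n T Z (\<beta> + h) (T i)"
    unfolding risk_sum_def by (intro sum.cong refl) (simp add: inner_add_left exp_add)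
  moreover have "(\<Sum>j<n. ?a j * (h \<bullet> Z j)) = risk_vec n T Z \<beta> (T i) \<bullet> h"
    unfolding risk_vec_def inner_sum_left by (intro sum.cong refl) (simp add: inner_commute)
  ultimately show ?thesis by (simp add: risk_sum_def)
qed

text \<open>The case \<open>q = 0\<close> of \<open>log_risk_sum_lower\<close>, where only the
  linear part of the Taylor bound remains. It yields convexity without a Hessian in several
  variables.\<close>

lemma neg_log_likelihood_subgradient:
  "neg_log_likelihood n T D Z \<beta> + neg_score n T D Z \<beta> \<bullet> h \<le> neg_log_likelihood n T D Z (\<beta> + h)"
proof -
  have "of_bool (D i = 1) * (ln (risk_sum n T Z \<beta> (T i)) - \<beta> \<bullet> Z i) +
      of_bool (D i = 1) *\<^sub>R ((1 / risk_sum n T Z \<beta> (T i)) *\<^sub>R risk_vec n T Z \<beta> (T i) - Z i) \<bullet> h \<le>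
      of_bool (D i = 1) * (ln (risk_sum n T Z (\<beta> + h) (T i)) - (\<beta> + h) \<bullet> Z i)" if "i < n" for i
  proof -
    \<comment> \<open>Any finite bound is good enough, because for \<open>q = 0\<close> the term
      with this denominator is zero.\<close>
    have b: "risk_sum n T Z (\<beta> + s *\<^sub>R h) (T i) \<le> (\<Sum>j<n. exp (\<bar>\<beta> \<bullet> Z j\<bar> + \<bar>h \<bullet> Z j\<bar>))" if "0 \<le> s" "s \<le> 1" for s
      unfolding risk_sum_def
    proof (rule sum_mono)
      fix j
      have "s * (h \<bullet> Z j) \<le> \<bar>h \<bullet> Z j\<bar>"
        using that mult_left_le_one_le[of "\<bar>h \<bullet> Z j\<bar>" s] abs_ge_self[of "s * (h \<bullet> Z j)"] by (simp add: abs_mult)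
      hence "(\<beta> + s *\<^sub>R h) \<bullet> Z j \<le> \<bar>\<beta> \<bullet> Z j\<bar> + \<bar>h \<bullet> Z j\<bar>"
        by (simp add: inner_add_left)
      thus "indicator {T i..} (T j) * exp ((\<beta> + s *\<^sub>R h) \<bullet> Z j) \<le> exp (\<bar>\<beta> \<bullet> Z j\<bar> + \<bar>h \<bullet> Z j\<bar>)"
        by (simp add: indicator_def)
    qed
    have "ln (risk_sum n T Z \<beta> (T i)) + (1 / risk_sum n T Z \<beta> (T i)) *\<^sub>R risk_vec n T Z \<beta> (T i) \<bullet> h
      \<le> ln (risk_sum n T Z (\<beta> + h) (T i))"
      using log_risk_sum_lower[where q="\<lambda>_. 0", OF that _ _ b] by simp
    thus ?thesis by (simp add: inner_diff_left inner_add_left inner_commute[of "Z i" h])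
  qed
  hence "(\<Sum>i<n. of_bool (D i = 1) * (ln (risk_sum n T Z \<beta> (T i)) - \<beta> \<bullet> Z i) +
      of_bool (D i = 1) *\<^sub>R ((1 / risk_sum n T Z \<beta> (T i)) *\<^sub>R risk_vec n T Z \<beta> (T i) - Z i) \<bullet> h) \<le>
      neg_log_likelihood n T D Z (\<beta> + h)"
    unfolding neg_log_likelihood_def by (intro sum_mono) auto
  thus ?thesis by (simp only: sum.distrib neg_log_likelihood_def neg_score_def inner_sum_left)
qed

lemma convex_neg_log_likelihood: "convex_on UNIV (neg_log_likelihood n T D Z)"
proof (rule convex_on_if_subgradient)
  fix x
  show "\<exists>p. \<forall>y. neg_log_likelihood n T D Z x + p \<bullet> (y - x) \<le> neg_log_likelihood n T D Z y"
    using neg_log_likelihood_subgradient[of n T D Z x] by (metis add.commute diff_add_cancel)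
qed

text \<open>For an event at a time \<open>T i \<le> u0\<close> the risk set contains all subjects at
  risk at \<open>u0\<close>, and \<open>q\<close> bounds their weights from below along the whole
  segment from \<open>\<beta>\<close> to \<open>\<beta> + h\<close>. Each such event contributes the
  same curvature; later events contribute only convexity.\<close>

lemma neg_log_likelihood_quadratic_growth:
  fixes Z :: "nat \<Rightarrow> real ^ 'd"
  assumes \<kappa>: "0 < \<kappa>" and h: "norm h \<le> \<kappa>"
    and Dm: "(\<Sum>j<n. exp (\<beta> \<bullet> Z j + \<kappa> * norm (Z j))) \<le> real n * Dm" and Dm0: "0 < Dm"
    and ev: "real n * p0 \<le> (\<Sum>i<n. of_bool (D i = 1 \<and> T i \<le> u0))" and c1: "0 \<le> c1"
    and var: "real n ^ 2 * (c1 * (norm h)\<^sup>2) \<le> (\<Sum>j<n. q j) * (\<Sum>j<n. q j * (h \<bullet> Z j)\<^sup>2) - (\<Sum>j<n. q j * (h \<bullet> Z j))\<^sup>2"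
    and q: "\<And>j. q j = of_bool (u0 \<le> T j) * exp (- ((norm \<beta> + \<kappa>) * norm (Z j)))"
  shows "neg_log_likelihood n T D Z \<beta> + neg_score n T D Z \<beta> \<bullet> h + real n * (p0 * c1 / Dm\<^sup>2) / 2 * (norm h)\<^sup>2
     \<le> neg_log_likelihood n T D Z (\<beta> + h)"
proof (cases "n = 0")
  case True
  thus ?thesis using neg_log_likelihood_subgradient[of n T D Z \<beta> h] by simp
next
  case n: False
  let ?k = "c1 * (norm h)\<^sup>2 / (2 * Dm\<^sup>2)"
  have k0: "0 \<le> ?k" using c1 by simp
  have up: "(\<beta> + s *\<^sub>R h) \<bullet> z \<le> \<beta> \<bullet> z + \<kappa> * norm z" and dn: "- ((norm \<beta> + \<kappa>) * norm z) \<le> (\<beta> + s *\<^sub>R h) \<bullet> z"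
    if "0 \<le> s" "s \<le> 1" for s z
  proof -
    have "\<bar>(s *\<^sub>R h) \<bullet> z\<bar> \<le> norm (s *\<^sub>R h) * norm z" by (rule Cauchy_Schwarz_ineq2)
    also have "\<dots> \<le> \<kappa> * norm z"
      using that h mult_mono[of s 1 "norm h" \<kappa>] \<kappa> by (intro mult_right_mono) auto
    finally have a: "\<bar>(s *\<^sub>R h) \<bullet> z\<bar> \<le> \<kappa> * norm z" .
    show "(\<beta> + s *\<^sub>R h) \<bullet> z \<le> \<beta> \<bullet> z + \<kappa> * norm z" using a by (simp add: inner_add_left)
    show "- ((norm \<beta> + \<kappa>) * norm z) \<le> (\<beta> + s *\<^sub>R h) \<bullet> z"
      using a Cauchy_Schwarz_ineq2[of \<beta> z] by (simp add: inner_add_left algebra_simps abs_le_iff)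
  qed
  have D: "risk_sum n T Z (\<beta> + s *\<^sub>R h) t \<le> real n * Dm" if "0 \<le> s" "s \<le> 1" for s t
  proof -
    have "risk_sum n T Z (\<beta> + s *\<^sub>R h) t \<le> (\<Sum>j<n. exp (\<beta> \<bullet> Z j + \<kappa> * norm (Z j)))"
      unfolding risk_sum_def using up[OF that] by (intro sum_mono) (auto simp: indicator_def)
    thus ?thesis using Dm by simp
  qed
  have "of_bool (D i = 1) * (ln (risk_sum n T Z \<beta> (T i)) - \<beta> \<bullet> Z i) +
      of_bool (D i = 1) *\<^sub>R ((1 / risk_sum n T Z \<beta> (T i)) *\<^sub>R risk_vec n T Z \<beta> (T i) - Z i) \<bullet> h
       + of_bool (D i = 1 \<and> T i \<le> u0) * ?k \<le>
      of_bool (D i = 1) * (ln (risk_sum n T Z (\<beta> + h) (T i)) - (\<beta> + h) \<bullet> Z i)" if i: "i < n" for i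
  proof (cases "T i \<le> u0")
    case True
    have q1: "q j \<le> indicator {T i..} (T j) * exp ((\<beta> + s *\<^sub>R h) \<bullet> Z j)" if "0 \<le> s" "s \<le> 1" for j s
      using dn[OF that] True by (auto simp: q indicator_def)
    \<comment> \<open>The variance form and the squared risk sum are both of order
      \<open>n ^ 2\<close>, so the curvature per event does not depend on \<open>n\<close>.\<close>
    have "?k = real n ^ 2 * (c1 * (norm h)\<^sup>2) / (2 * (real n * Dm)\<^sup>2)"
      using n by (simp add: power_mult_distrib)
    also have "\<dots> \<le> ((\<Sum>j<n. q j) * (\<Sum>j<n. q j * (h \<bullet> Z j)\<^sup>2) - (\<Sum>j<n. q j * (h \<bullet> Z j))\<^sup>2) / (2 * (real n * Dm)\<^sup>2)"
      by (intro divide_right_mono var) simp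
    finally have k: "?k \<le> \<dots>" .
    have "ln (risk_sum n T Z \<beta> (T i)) + (1 / risk_sum n T Z \<beta> (T i)) *\<^sub>R risk_vec n T Z \<beta> (T i) \<bullet> h
      + ((\<Sum>j<n. q j) * (\<Sum>j<n. q j * (h \<bullet> Z j)\<^sup>2) - (\<Sum>j<n. q j * (h \<bullet> Z j))\<^sup>2) / (2 * (real n * Dm)\<^sup>2)
      \<le> ln (risk_sum n T Z (\<beta> + h) (T i))"
      by (rule log_risk_sum_lower[OF i _ q1 D]) (auto simp: q)
    thus ?thesis using k True by (simp add: inner_diff_left inner_add_left inner_commute[of "Z i" h])
  next
    case False
    have "ln (risk_sum n T Z \<beta> (T i)) + (1 / risk_sum n T Z \<beta> (T i)) *\<^sub>R risk_vec n T Z \<beta> (T i) \<bullet> h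
      \<le> ln (risk_sum n T Z (\<beta> + h) (T i))"
      using log_risk_sum_lower[where q="\<lambda>_. 0", OF i _ _ D] by simp
    thus ?thesis using False by (simp add: inner_diff_left inner_add_left inner_commute[of "Z i" h])
  qed
  hence "(\<Sum>i<n. of_bool (D i = 1) * (ln (risk_sum n T Z \<beta> (T i)) - \<beta> \<bullet> Z i) +
      of_bool (D i = 1) *\<^sub>R ((1 / risk_sum n T Z \<beta> (T i)) *\<^sub>R risk_vec n T Z \<beta> (T i) - Z i) \<bullet> h
       + of_bool (D i = 1 \<and> T i \<le> u0) * ?k) \<le> neg_log_likelihood n T D Z (\<beta> + h)"
    unfolding neg_log_likelihood_def by (intro sum_mono) auto
  hence sum_le: "neg_log_likelihood n T D Z \<beta> + neg_score n T D Z \<beta> \<bullet> h + (\<Sum>i<n. of_bool (D i = 1 \<and> T i \<le> u0)) * ?k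
      \<le> neg_log_likelihood n T D Z (\<beta> + h)"
    by (simp only: sum.distrib neg_log_likelihood_def neg_score_def inner_sum_left sum_distrib_right)
  have eq: "real n * (p0 * c1 / Dm\<^sup>2) / 2 * (norm h)\<^sup>2 = real n * p0 * ?k" by simp
  have le: "real n * p0 * ?k \<le> (\<Sum>i<n. of_bool (D i = 1 \<and> T i \<le> u0)) * ?k"
    by (rule mult_right_mono[OF ev k0])
  show ?thesis unfolding eq by (rule order_trans[OF add_left_mono[OF le] sum_le])
qed

text \<open>All premises concern a single realisation. Existence of a maximizer belongs to the
  conclusion because the estimator is only prescribed when one exists.\<close>

lemma argmax_partial_likelihood_bound:
  fixes Z :: "nat \<Rightarrow> real ^ 'd"
  assumes noties: "\<And>i j. i < n \<Longrightarrow> j < n \<Longrightarrow> D i = 1 \<Longrightarrow> D j = 1 \<Longrightarrow> T i = T j \<Longrightarrow> i = j"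
    and n: "0 < n" and \<kappa>: "0 < \<kappa>"
    and Dm: "(\<Sum>j<n. exp (\<beta> \<bullet> Z j + \<kappa> * norm (Z j))) \<le> real n * Dm" and Dm0: "0 < Dm"
    and ev: "real n * p0 \<le> (\<Sum>i<n. of_bool (D i = 1 \<and> T i \<le> u0))" and c1: "0 < c1" and p0: "0 < p0"
    and var: "\<And>h. real n ^ 2 * (c1 * (norm h)\<^sup>2) \<le> (\<Sum>j<n. q j) * (\<Sum>j<n. q j * (h \<bullet> Z j)\<^sup>2) - (\<Sum>j<n. q j * (h \<bullet> Z j))\<^sup>2"
    and q: "\<And>j. q j = of_bool (u0 \<le> T j) * exp (- ((norm \<beta> + \<kappa>) * norm (Z j)))"
    and U: "norm (neg_score n T D Z \<beta>) < real n * (p0 * c1 / Dm\<^sup>2) * \<kappa> / 2"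
  shows "\<exists>b. is_arg_max (partial_likelihood n T D Z) (\<lambda>_. True) b"
    and "is_arg_max (partial_likelihood n T D Z) (\<lambda>_. True) b \<Longrightarrow>
      norm (b - \<beta>) \<le> 2 / (real n * (p0 * c1 / Dm\<^sup>2)) * norm (neg_score n T D Z \<beta>)"
proof -
  have L: "partial_likelihood n T D Z z = exp (- neg_log_likelihood n T D Z z)" for z
    using noties by (rule partial_likelihood_eq_exp)
  have am: "is_arg_max (partial_likelihood n T D Z) (\<lambda>_. True) b \<longleftrightarrow>
      (\<forall>z. neg_log_likelihood n T D Z b \<le> neg_log_likelihood n T D Z z)" for b
    unfolding is_arg_max_def L by (simp add: not_less)
  have c0: "0 < real n * (p0 * c1 / Dm\<^sup>2)" using n p0 c1 Dm0 by simp
  have growth: "neg_log_likelihood n T D Z \<beta> + neg_score n T D Z \<beta> \<bullet> h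
      + real n * (p0 * c1 / Dm\<^sup>2) / 2 * (norm h)\<^sup>2 \<le> neg_log_likelihood n T D Z (\<beta> + h)"
    if "norm h \<le> \<kappa>" for h
    by (rule neg_log_likelihood_quadratic_growth[OF \<kappa> that Dm Dm0 ev less_imp_le[OF c1] var q])
  note min = convex_quadratic_growth_minimizer[OF convex_neg_log_likelihood[of n T D Z] _ \<kappa> c0 U]
  show "\<exists>b. is_arg_max (partial_likelihood n T D Z) (\<lambda>_. True) b" unfolding am by (rule min(1)) (rule growth)
  assume "is_arg_max (partial_likelihood n T D Z) (\<lambda>_. True) b"
  hence le: "neg_log_likelihood n T D Z b \<le> neg_log_likelihood n T D Z \<beta>" using am by blast
  show "norm (b - \<beta>) \<le> 2 / (real n * (p0 * c1 / Dm\<^sup>2)) * norm (neg_score n T D Z \<beta>)"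
    by (rule min(2)[OF _ le]) (rule growth)
qed

section \<open>The estimator in an i.i.d. sample\<close>

locale cox_horizon_sample = cox_horizon M X C Z F f G lambda0 beta0 tau kappa + cox_sample M X C Z F f G lambda0 beta0 Ti Di Zi
  for M :: "'w measure" and X C :: "'w \<Rightarrow> real" and Z :: "'w \<Rightarrow> real ^ 'd"
    and F f G :: "real \<Rightarrow> real ^ 'd \<Rightarrow> real" and lambda0 :: "real \<Rightarrow> real" and beta0 :: "real ^ 'd"
    and tau kappa :: real and Ti Di :: "nat \<Rightarrow> 'w \<Rightarrow> real" and Zi :: "nat \<Rightarrow> 'w \<Rightarrow> real ^ 'd"
begin

definition W :: "nat \<Rightarrow> 'w \<Rightarrow> real \<times> real \<times> (real ^ 'd)" where "W i \<omega> = (Ti i \<omega>, Di i \<omega>, Zi i \<omega>)"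

text \<open>The population vector, with the same law as every \<open>W i\<close>. Only statements
  about laws are transferred between the two, since nothing is known about their joint
  distribution.\<close>

definition V :: "'w \<Rightarrow> real \<times> real \<times> (real ^ 'd)" where "V \<omega> = (T \<omega>, of_bool (X \<omega> \<le> C \<omega>), Z \<omega>)"

lemma indep_W: "indep_vars (\<lambda>_. borel) W UNIV"
  using sample_indep by (simp add: W_def[abs_def])

lemma measurable_W [measurable]: "W i \<in> borel_measurable M"
  using indep_W by (simp add: indep_vars_def)

lemma measurable_V [measurable]: "V \<in> borel_measurable M"
  unfolding V_def[abs_def] by (intro borel_measurable_Pair) measurable

lemma distr_W: "distr M borel (W i) = distr M borel V"
  using sample_distr[of i] by (simp add: W_def[abs_def] V_def[abs_def] T_def)

lemma W_simps: "fst (W i \<omega>) = Ti i \<omega>" "fst (snd (W i \<omega>)) = Di i \<omega>" "snd (snd (W i \<omega>)) = Zi i \<omega>"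
  and V_simps: "fst (V \<omega>) = T \<omega>" "fst (snd (V \<omega>)) = of_bool (X \<omega> \<le> C \<omega>)" "snd (snd (V \<omega>)) = Z \<omega>"
  by (simp_all add: W_def V_def)

lemma measurable_projections [measurable]:
  "(fst :: real \<times> real \<times> (real ^ 'd) \<Rightarrow> real) \<in> borel_measurable borel"
  "(\<lambda>x :: real \<times> real \<times> (real ^ 'd). fst (snd x)) \<in> borel_measurable borel"
  "(\<lambda>x :: real \<times> real \<times> (real ^ 'd). snd (snd x)) \<in> borel_measurable borel"
  by (intro borel_measurable_continuous_onI continuous_intros)+

lemma measurable_sample [measurable]:
  "Ti i \<in> borel_measurable M" "Di i \<in> borel_measurable M" "Zi i \<in> borel_measurable M"
  using measurable_compose[OF measurable_W measurable_projections(1), of i]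
    measurable_compose[OF measurable_W measurable_projections(2), of i]
    measurable_compose[OF measurable_W measurable_projections(3), of i]
  by (simp_all add: W_simps)

lemma transfer_nn:
  assumes "g \<in> borel_measurable borel"
  shows "(\<integral>\<^sup>+\<omega>. g (W i \<omega>) \<partial>M) = (\<integral>\<^sup>+\<omega>. g (V \<omega>) \<partial>M)"
  using nn_integral_distr[of "W i" M borel g] nn_integral_distr[of V M borel g] assms
  by (simp add: distr_W)

lemma transfer_integrable:
  assumes "g \<in> borel_measurable borel"
  shows "integrable M (\<lambda>\<omega>. g (W i \<omega>) :: real) \<longleftrightarrow> integrable M (\<lambda>\<omega>. g (V \<omega>))"
  using integrable_distr_eq[of "W i" M borel g] integrable_distr_eq[of V M borel g] assms
  by (simp add: distr_W)

lemma transfer_expectation: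
  assumes "g \<in> borel_measurable borel"
  shows "expectation (\<lambda>\<omega>. g (W i \<omega>) :: real) = expectation (\<lambda>\<omega>. g (V \<omega>))"
  using integral_distr[of "W i" M borel g] integral_distr[of V M borel g] assms
  by (simp add: distr_W)

lemma transfer_AE:
  assumes "AE \<omega> in M. P (V \<omega>)" "{x. P x} \<in> sets borel"
  shows "AE \<omega> in M. P (W i \<omega>)"
proof -
  have "AE x in distr M borel V. P x" using assms by (subst AE_distr_iff) auto
  hence "AE x in distr M borel (W i). P x" by (simp only: distr_W)
  thus ?thesis using assms(2) by (subst (asm) AE_distr_iff) auto
qed

definition deviation :: "(real \<times> real \<times> (real ^ 'd) \<Rightarrow> real) \<Rightarrow> nat \<Rightarrow> 'w \<Rightarrow> real" where
  "deviation g n \<omega> = (\<Sum>i<n. g (W i \<omega>) - expectation (\<lambda>\<omega>. g (V \<omega>))) / sqrt (real n)"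

lemma bounded_moments_deviation:
  assumes [measurable]: "g \<in> borel_measurable borel" and int: "\<And>r. integrable M (\<lambda>\<omega>. g (V \<omega>) ^ r)"
  shows "bounded_moments (deviation g)"
proof -
  let ?m = "expectation (\<lambda>\<omega>. g (V \<omega>))"
  have i: "integrable M (\<lambda>\<omega>. (g (V \<omega>) - ?m) ^ r)" for r
  proof -
    have "integrable M (\<lambda>\<omega>. \<Sum>k\<le>r. of_nat (r choose k) * g (V \<omega>) ^ k * (- ?m) ^ (r - k))"
      by (intro Bochner_Integration.integrable_sum integrable_mult_left integrable_mult_right int)
    thus ?thesis using binomial_ring[of "g (V _)" "- ?m" r] by simp
  qed
  have "bounded_moments (\<lambda>n \<omega>. (\<Sum>i<n. (\<lambda>x. g x - ?m) (W i \<omega>)) / sqrt (real n))"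
  proof (rule bounded_moments_indep_sum[OF indep_W, where m="\<lambda>r. expectation (\<lambda>\<omega>. (g (V \<omega>) - ?m) ^ (2 * r))"])
    show "integrable M (\<lambda>\<omega>. (g (W i \<omega>) - ?m) ^ r)" for i r
      using transfer_integrable[of "\<lambda>x. (g x - ?m) ^ r" i] i by simp
    show "expectation (\<lambda>\<omega>. g (W i \<omega>) - ?m) = 0" for i
      using transfer_expectation[of "\<lambda>x. g x - ?m" i] int[of 1] by (simp add: prob_space)
    show "expectation (\<lambda>\<omega>. (g (W i \<omega>) - ?m) ^ (2 * r)) \<le> expectation (\<lambda>\<omega>. (g (V \<omega>) - ?m) ^ (2 * r))" for i r
      using transfer_expectation[of "\<lambda>x. (g x - ?m) ^ (2 * r)" i] by simp
  qed measurable
  thus ?thesis by (simp add: deviation_def[abs_def])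
qed

text \<open>The absolute value stands inside the average over \<open>i\<close>, so that bounded
  factors such as event indicators can be attached to each \<open>i\<close> later. The diagonal
  \<open>j = i\<close> is included, although it is not centred given subject
  \<open>i\<close>.\<close>

definition kernel_deviation :: "(real ^ 'd \<Rightarrow> real) \<Rightarrow> nat \<Rightarrow> 'w \<Rightarrow> real" where
  "kernel_deviation h n \<omega> = (\<Sum>i<n. \<bar>\<Sum>j<n. indicator {Ti i \<omega>..} (Ti j \<omega>) * h (Zi j \<omega>) - at_risk_mean h (Ti i \<omega>)\<bar> / sqrt (real n)) / real n"

lemma bounded_moments_kernel_deviation:
  assumes [measurable]: "h \<in> borel_measurable borel" and le: "\<And>z. \<bar>h z\<bar> \<le> c * exp (beta0 \<bullet> z + kappa * norm z)"
  shows "bounded_moments (kernel_deviation h)"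
proof -
  define k where "k p = of_bool (fst (fst p) \<le> fst (snd p)) * h (snd (snd (snd p))) - at_risk_mean h (fst (fst p))"
    for p :: "(real \<times> real \<times> (real ^ 'd)) \<times> (real \<times> real \<times> (real ^ 'd))"
  have intY: "integrable M Y" using moments[of 1] by simp
  have c0: "0 \<le> c"
  proof -
    have "0 \<le> c * exp (beta0 \<bullet> 0 + kappa * norm (0 :: real ^ 'd))" using le[of 0] abs_ge_zero order_trans by blast
    thus ?thesis by simp
  qed
  have EY: "0 \<le> expectation Y" by (rule Bochner_Integration.integral_nonneg) simp
  have int: "integrable M (\<lambda>\<omega>. indicator {u..} (T \<omega>) * h (Z \<omega>))" for u
    by (rule Bochner_Integration.integrable_bound[OF integrable_mult_right[OF intY, of c]])
       (use le c0 in \<open>auto simp: indicator_def\<close>)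
  have s_le: "\<bar>at_risk_mean h u\<bar> \<le> c * expectation Y" for u
  proof -
    have "\<bar>at_risk_mean h u\<bar> \<le> expectation (\<lambda>\<omega>. \<bar>indicator {u..} (T \<omega>) * h (Z \<omega>)\<bar>)"
      unfolding at_risk_mean_def using integral_norm_bound[of M "\<lambda>\<omega>. indicator {u..} (T \<omega>) * h (Z \<omega>)"] by simp
    also have "\<dots> \<le> expectation (\<lambda>\<omega>. c * Y \<omega>)"
      by (intro integral_mono integrable_abs int integrable_mult_right intY)
         (use le c0 in \<open>auto simp: indicator_def\<close>)
    finally show ?thesis by simp
  qed
  \<comment> \<open>The centring term is at most \<open>c * expectation Y\<close> at every time, so
    one constant serves for every frozen first argument, as the kernel bound requires.\<close>
  define c' where "c' = c + c * expectation Y"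
  have c'0: "0 \<le> c'" using c0 EY by (simp add: c'_def)
  have k_le: "\<bar>k (x, V \<omega>)\<bar> \<le> c' * Y \<omega> + c'" "\<bar>k (V \<omega>, V \<omega>)\<bar> \<le> c' * Y \<omega> + c'" for x \<omega>
  proof -
    have *: "\<bar>of_bool b * h (Z \<omega>) - at_risk_mean h u\<bar> \<le> c' * Y \<omega> + c'" for b u
    proof -
      have "\<bar>of_bool b * h (Z \<omega>) - at_risk_mean h u\<bar> \<le> \<bar>h (Z \<omega>)\<bar> + \<bar>at_risk_mean h u\<bar>"
        by (cases b) auto
      also have "\<dots> \<le> c * Y \<omega> + c * expectation Y" by (intro add_mono le s_le)
      also have "\<dots> \<le> c' * Y \<omega> + c'"
        using c0 EY by (intro add_mono mult_right_mono) (auto simp: c'_def)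
      finally show ?thesis .
    qed
    thus "\<bar>k (x, V \<omega>)\<bar> \<le> c' * Y \<omega> + c'" "\<bar>k (V \<omega>, V \<omega>)\<bar> \<le> c' * Y \<omega> + c'"
      using *[of "fst x \<le> T \<omega>" "fst x"] *[of True "T \<omega>"] by (simp_all add: k_def V_simps)
  qed
  have [measurable]: "k \<in> borel_measurable (borel \<Otimes>\<^sub>M borel)"
    unfolding k_def by measurable
  have [measurable]: "(\<lambda>y. k (x, y)) \<in> borel_measurable borel" for x by measurable
  have [measurable]: "(\<lambda>y. k (y, y)) \<in> borel_measurable borel" by measurable
  have kV: "(\<lambda>\<omega>. k (x, V \<omega>)) \<in> borel_measurable M" "(\<lambda>\<omega>. k (V \<omega>, V \<omega>)) \<in> borel_measurable M" for x
    by measurable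
  define m where "m r = expectation (\<lambda>\<omega>. (c' * Y \<omega> + c') ^ (2 * r))" for r
  have dom: "integrable M (\<lambda>\<omega>. k (x, V \<omega>) ^ r)" "expectation (\<lambda>\<omega>. k (x, V \<omega>) ^ (2 * r)) \<le> m r" for x r
    using integrable_power_dominated[OF kV(1) k_le(1)] by (auto simp: m_def)
  have dom2: "integrable M (\<lambda>\<omega>. k (V \<omega>, V \<omega>) ^ r)" "expectation (\<lambda>\<omega>. k (V \<omega>, V \<omega>) ^ (2 * r)) \<le> m r" for r
    using integrable_power_dominated[OF kV(2) k_le(2)] by (auto simp: m_def)
  have "bounded_moments (\<lambda>n \<omega>. (\<Sum>i<n. \<bar>\<Sum>j<n. k (W i \<omega>, W j \<omega>)\<bar> / sqrt (real n)) / real n)"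
  proof (rule bounded_moments_indep_kernel[OF indep_W, where m=m])
    fix x :: "real \<times> real \<times> (real ^ 'd)" and i r :: nat
    show "integrable M (\<lambda>\<omega>. k (x, W i \<omega>) ^ r)"
      using transfer_integrable[of "\<lambda>y. k (x, y) ^ r" i] dom(1)[of x r] by simp
    show "expectation (\<lambda>\<omega>. k (x, W i \<omega>) ^ (2 * r)) \<le> m r"
      using transfer_expectation[of "\<lambda>y. k (x, y) ^ (2 * r)" i] dom(2)[of x r] by simp
    have "expectation (\<lambda>\<omega>. k (x, W i \<omega>)) = expectation (\<lambda>\<omega>. indicator {fst x..} (T \<omega>) * h (Z \<omega>) - at_risk_mean h (fst x))"
      using transfer_expectation[of "\<lambda>y. k (x, y)" i] by (simp add: k_def V_simps indicator_def)
    also have "\<dots> = 0" using int[of "fst x"] by (simp add: at_risk_mean_def prob_space)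
    finally show "expectation (\<lambda>\<omega>. k (x, W i \<omega>)) = 0" .
    have "(\<integral>\<^sup>+\<omega>. ennreal (k (W i \<omega>, W i \<omega>) ^ (2 * r)) \<partial>M) = (\<integral>\<^sup>+\<omega>. ennreal (k (V \<omega>, V \<omega>) ^ (2 * r)) \<partial>M)"
      by (rule transfer_nn) measurable
    also have "\<dots> = ennreal (expectation (\<lambda>\<omega>. k (V \<omega>, V \<omega>) ^ (2 * r)))"
      by (rule nn_integral_eq_integral[OF dom2(1)]) (auto simp: zero_le_even_power)
    also have "\<dots> \<le> ennreal (m r)" by (rule ennreal_leI[OF dom2(2)])
    finally show "(\<integral>\<^sup>+\<omega>. ennreal (k (W i \<omega>, W i \<omega>) ^ (2 * r)) \<partial>M) \<le> ennreal (m r)" .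
  qed measurable
  moreover have "k (W i \<omega>, W j \<omega>) = indicator {Ti i \<omega>..} (Ti j \<omega>) * h (Zi j \<omega>) - at_risk_mean h (Ti i \<omega>)" for i j \<omega>
    by (simp add: k_def W_simps indicator_def)
  ultimately show ?thesis by (simp add: kernel_deviation_def[abs_def])
qed

lemma AE_T_sample: "AE \<omega> in M. \<forall>i. Ti i \<omega> \<le> tau"
proof -
  have "AE \<omega> in M. fst (V \<omega>) \<le> tau" using AE_T_le_tau by (simp add: V_simps T_def)
  hence "AE \<omega> in M. fst (W i \<omega>) \<le> tau" for i
    by (rule transfer_AE) (auto intro!: closed_Collect_le continuous_intros borel_closed)
  thus ?thesis by (simp add: W_simps AE_all_countable)
qed

text \<open>With subject \<open>i\<close> frozen, a tie means an event of subject \<open>j\<close>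
  at a fixed time, which has probability zero.\<close>

lemma AE_no_ties: "AE \<omega> in M. \<forall>i j. i \<noteq> j \<longrightarrow> Di i \<omega> = 1 \<longrightarrow> Di j \<omega> = 1 \<longrightarrow> Ti i \<omega> \<noteq> Ti j \<omega>"
proof -
  have "AE \<omega> in M. i \<noteq> j \<longrightarrow> Di i \<omega> = 1 \<longrightarrow> Di j \<omega> = 1 \<longrightarrow> Ti i \<omega> \<noteq> Ti j \<omega>" for i j
  proof (cases "i = j")
    case False
    define h :: "_ \<Rightarrow> ennreal" where "h p = indicator {p. fst (snd (snd p)) = (1::real) \<and> fst (fst p) = fst (snd p)} p"
      for p :: "(real \<times> real \<times> (real ^ 'd)) \<times> (real \<times> real \<times> (real ^ 'd))"
    have "(\<integral>\<^sup>+\<omega>. (h (W i \<omega>, W j \<omega>) :: ennreal) \<partial>M) \<le> 0"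
    proof (rule indep_var_nn_integral_le)
      show "indep_var borel (W i) borel (W j)"
        using indep_var_compose[OF indep_var_restrict[OF indep_W, of "{i}" "{j}"],
            of "\<lambda>f. f i" borel "\<lambda>f. f j" borel] False
        by (simp add: o_def measurable_component_singleton)
      have [measurable]: "Measurable.pred (borel \<Otimes>\<^sub>M borel) (\<lambda>p :: (real \<times> real \<times> (real ^ 'd)) \<times> (real \<times> real \<times> (real ^ 'd)). fst (snd (snd p)) = (1::real) \<and> fst (fst p) = fst (snd p))"
        by measurable
      show "(h :: _ \<Rightarrow> ennreal) \<in> borel_measurable (borel \<Otimes>\<^sub>M borel)" unfolding h_def by measurable
      fix x :: "real \<times> real \<times> (real ^ 'd)"
      have "AE \<omega> in M. \<not> (fst (snd (V \<omega>)) = 1 \<and> fst x = fst (V \<omega>))"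
        using AE_no_event_at[of "fst x"] by eventually_elim (auto simp: V_simps)
      hence "AE \<omega> in M. \<not> (fst (snd (W j \<omega>)) = 1 \<and> fst x = fst (W j \<omega>))"
        by (rule transfer_AE) measurable
      hence "AE \<omega> in M. h (x, W j \<omega>) = (0 :: ennreal)" by eventually_elim (auto simp: h_def)
      thus "(\<integral>\<^sup>+\<omega>. (h (x, W j \<omega>) :: ennreal) \<partial>M) \<le> 0"
        by (subst nn_integral_cong_AE[where v="\<lambda>_. 0"]) auto
    qed
    hence "AE \<omega> in M. h (W i \<omega>, W j \<omega>) = (0 :: ennreal)"
      by (subst (asm) le_zero_eq, subst (asm) nn_integral_0_iff_AE) (auto simp: h_def)
    thus ?thesis by eventually_elim (auto simp: h_def W_simps indicator_def split: if_splits)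
  qed simp
  thus ?thesis by (simp add: AE_all_countable)
qed

end

section \<open>Perturbation bounds and the control of the score\<close>

lemma ratio_difference_le:
  fixes S0 S1 s0 s1 c L N :: real
  assumes "0 < c" "0 < N" "N * c \<le> S0" "0 < s0" "\<bar>s1 / s0\<bar> \<le> L"
  shows "\<bar>S1 / S0 - s1 / s0\<bar> \<le> (\<bar>S1 - N * s1\<bar> + L * \<bar>S0 - N * s0\<bar>) / (N * c)"
proof -
  have Nc: "0 < N * c" using assms by simp
  hence S0: "0 < S0" using assms(3) by linarith
  \<comment> \<open>With the random denominator in front, only \<open>S0\<close> has to be bounded
    below, and the coefficient of its deviation is the population ratio, which is bounded by
    \<open>L\<close>.\<close>
  have "S1 / S0 - s1 / s0 = ((S1 - N * s1) - (s1 / s0) * (S0 - N * s0)) / S0"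
    using S0 assms(4) by (simp add: field_simps)
  hence "\<bar>S1 / S0 - s1 / s0\<bar> = \<bar>(S1 - N * s1) - (s1 / s0) * (S0 - N * s0)\<bar> / S0"
    using S0 by simp
  also have "\<dots> \<le> (\<bar>S1 - N * s1\<bar> + L * \<bar>S0 - N * s0\<bar>) / (N * c)"
  proof (rule frac_le)
    have "\<bar>(S1 - N * s1) - (s1 / s0) * (S0 - N * s0)\<bar> \<le> \<bar>S1 - N * s1\<bar> + \<bar>s1 / s0\<bar> * \<bar>S0 - N * s0\<bar>"
      using abs_triangle_ineq4[of "S1 - N * s1" "(s1 / s0) * (S0 - N * s0)"] by (simp only: abs_mult)
    also have "\<dots> \<le> \<bar>S1 - N * s1\<bar> + L * \<bar>S0 - N * s0\<bar>"
      by (intro add_left_mono mult_right_mono assms(5)) simp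
    finally show "\<bar>(S1 - N * s1) - (s1 / s0) * (S0 - N * s0)\<bar> \<le> \<bar>S1 - N * s1\<bar> + L * \<bar>S0 - N * s0\<bar>" .
    have "0 \<le> L" using assms(5) abs_ge_zero order_trans by blast
    thus "0 \<le> \<bar>S1 - N * s1\<bar> + L * \<bar>S0 - N * s0\<bar>" by simp
  qed (use Nc assms(3) in auto)
  finally show ?thesis .
qed

lemma product_deviation_le:
  fixes a b x y m \<delta> :: real
  assumes "\<bar>a - x\<bar> \<le> \<delta>" "\<bar>b - y\<bar> \<le> \<delta>" "\<bar>x\<bar> \<le> m" "\<bar>y\<bar> \<le> m" "\<delta> \<le> 1"
  shows "\<bar>a * b - x * y\<bar> \<le> (2 * m + 1) * \<delta>"
proof -
  have \<delta>: "0 \<le> \<delta>" using assms(1) abs_ge_zero order_trans by blast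
  have a: "\<bar>a\<bar> \<le> m + 1" using assms by linarith
  have "a * b - x * y = a * (b - y) + y * (a - x)" by (simp add: algebra_simps)
  hence "\<bar>a * b - x * y\<bar> \<le> \<bar>a\<bar> * \<bar>b - y\<bar> + \<bar>y\<bar> * \<bar>a - x\<bar>"
    using abs_triangle_ineq[of "a * (b - y)" "y * (a - x)"] by (simp only: abs_mult)
  also have "\<dots> \<le> (m + 1) * \<delta> + m * \<delta>"
    using assms a \<delta> by (intro add_mono mult_mono) auto
  finally show ?thesis by (simp add: algebra_simps)
qed

text \<open>Expanding in components lets finitely many empirical means control the variance form in
  all directions \<open>h\<close> at once.\<close>

lemma variance_form_quadratic:
  fixes z :: "'a \<Rightarrow> real ^ 'd" and q :: "'a \<Rightarrow> real"
  shows "(\<Sum>j\<in>J. q j) * (\<Sum>j\<in>J. q j * (h \<bullet> z j)\<^sup>2) - (\<Sum>j\<in>J. q j * (h \<bullet> z j))\<^sup>2 =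
    (\<Sum>k\<in>UNIV. \<Sum>l\<in>UNIV. h $ k * h $ l * ((\<Sum>j\<in>J. q j) * (\<Sum>j\<in>J. q j * (z j $ k * z j $ l)) -
       (\<Sum>j\<in>J. q j * z j $ k) * (\<Sum>j\<in>J. q j * z j $ l)))"
proof -
  have m1: "(\<Sum>j\<in>J. q j * (h \<bullet> z j)) = (\<Sum>k\<in>UNIV. h $ k * (\<Sum>j\<in>J. q j * z j $ k))"
    unfolding inner_vec_def sum_distrib_left by (subst sum.swap) (simp add: mult_ac)
  have "(\<Sum>j\<in>J. q j * (h \<bullet> z j)\<^sup>2) = (\<Sum>j\<in>J. \<Sum>k\<in>UNIV. \<Sum>l\<in>UNIV. h $ k * h $ l * (q j * (z j $ k * z j $ l)))"
    by (simp add: inner_vec_def power2_eq_square sum_product sum_distrib_left mult_ac)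
  also have "\<dots> = (\<Sum>k\<in>UNIV. \<Sum>l\<in>UNIV. \<Sum>j\<in>J. h $ k * h $ l * (q j * (z j $ k * z j $ l)))"
    by (subst sum.swap) (subst (2) sum.swap, rule refl)
  finally have m2: "(\<Sum>j\<in>J. q j * (h \<bullet> z j)\<^sup>2) = (\<Sum>k\<in>UNIV. \<Sum>l\<in>UNIV. h $ k * h $ l * (\<Sum>j\<in>J. q j * (z j $ k * z j $ l)))"
    by (simp add: sum_distrib_left)
  have "(\<Sum>j\<in>J. q j * (h \<bullet> z j))\<^sup>2 = (\<Sum>k\<in>UNIV. \<Sum>l\<in>UNIV. h $ k * h $ l * ((\<Sum>j\<in>J. q j * z j $ k) * (\<Sum>j\<in>J. q j * z j $ l)))"
    unfolding m1 by (simp add: power2_eq_square sum_product mult_ac)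
  thus ?thesis unfolding m2
    by (simp add: sum_distrib_left right_diff_distrib mult_ac flip: sum_subtractf)
qed

lemma quadratic_form_perturbation:
  fixes h :: "real ^ 'd"
  assumes "\<And>k l. \<bar>A k l - B k l\<bar> \<le> \<epsilon>"
  shows "(\<Sum>k\<in>UNIV. \<Sum>l\<in>UNIV. h $ k * h $ l * B k l) - real CARD('d) ^ 2 * \<epsilon> * (norm h)\<^sup>2 \<le>
    (\<Sum>k\<in>UNIV. \<Sum>l\<in>UNIV. h $ k * h $ l * A k l)"
proof -
  have "h $ k * h $ l * B k l - \<epsilon> * (norm h)\<^sup>2 \<le> h $ k * h $ l * A k l" for k l
  proof -
    have "\<bar>h $ k * h $ l * (A k l - B k l)\<bar> \<le> (norm h * norm h) * \<epsilon>"
      unfolding abs_mult by (intro mult_mono component_le_norm_cart assms) auto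
    thus ?thesis by (simp add: algebra_simps power2_eq_square abs_le_iff)
  qed
  hence "(\<Sum>k\<in>UNIV. \<Sum>l\<in>UNIV. h $ k * h $ l * B k l - \<epsilon> * (norm h)\<^sup>2) \<le> (\<Sum>k\<in>UNIV. \<Sum>l\<in>UNIV. h $ k * h $ l * A k l)"
    by (intro sum_mono)
  thus ?thesis by (simp add: sum_subtractf power2_eq_square mult_ac)
qed

context cox_horizon_sample
begin

definition score_term :: "'d \<Rightarrow> real \<times> real \<times> (real ^ 'd) \<Rightarrow> real" where
  "score_term k x = of_bool (fst (snd x) = 1) * (snd (snd x) $ k -
     at_risk_mean (\<lambda>z. exp (beta0 \<bullet> z) * z $ k) (fst x) / Phi M T Z beta0 (fst x))"

text \<open>The numerator dominates the at-risk mean at every time, and \<open>Phi tau\<close> is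
  the smallest value of \<open>Phi\<close> up to \<open>tau\<close>.\<close>

definition ratio_bound :: real where
  "ratio_bound = expectation (\<lambda>\<omega>. norm (Z \<omega>) ^ 1 * expZ \<omega>) / Phi M T Z beta0 tau"

lemma measurable_score_term [measurable]: "score_term k \<in> borel_measurable borel"
  unfolding score_term_def[abs_def] by measurable

lemma integrable_at_risk_component:
  "integrable M (\<lambda>\<omega>. indicator {u..} (T \<omega>) * (expZ \<omega> * Z \<omega> $ k))"
  by (rule Bochner_Integration.integrable_bound[OF integrable_norm_power_exp[of 1]])
     (auto simp: indicator_def abs_mult mult.commute intro!: AE_I2 mult_left_mono component_le_norm_cart)

lemma ratio_le:
  assumes "u \<le> tau"
  shows "\<bar>at_risk_mean (\<lambda>z. exp (beta0 \<bullet> z) * z $ k) u / Phi M T Z beta0 u\<bar> \<le> ratio_bound"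
proof -
  have "\<bar>at_risk_mean (\<lambda>z. exp (beta0 \<bullet> z) * z $ k) u\<bar> \<le> expectation (\<lambda>\<omega>. \<bar>indicator {u..} (T \<omega>) * (expZ \<omega> * Z \<omega> $ k)\<bar>)"
    unfolding at_risk_mean_def using integral_norm_bound[of M "\<lambda>\<omega>. indicator {u..} (T \<omega>) * (expZ \<omega> * Z \<omega> $ k)"] by simp
  also have "\<dots> \<le> expectation (\<lambda>\<omega>. norm (Z \<omega>) ^ 1 * expZ \<omega>)"
    by (intro integral_mono integrable_abs integrable_at_risk_component integrable_norm_power_exp)
       (auto simp: indicator_def abs_mult mult.commute intro!: mult_left_mono component_le_norm_cart)
  finally show ?thesis
    using Phi_pos[OF assms] Phi_pos[of tau] Phi_anti[OF assms]
    unfolding ratio_bound_def abs_divide by (intro frac_le) auto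
qed

lemma expectation_score_term: "expectation (\<lambda>\<omega>. score_term k (V \<omega>)) = 0"
proof -
  have "expectation (\<lambda>\<omega>. score_term k (V \<omega>)) = expectation (\<lambda>\<omega>. indicator event \<omega> *
      (Z \<omega> $ k - at_risk_mean (\<lambda>z. exp (beta0 \<bullet> z) * z $ k) (T \<omega>) / Phi M T Z beta0 (T \<omega>)))"
    by (intro Bochner_Integration.integral_cong) (auto simp: score_term_def V_simps indicator_def)
  thus ?thesis by (simp only: score_mean_zero)
qed

lemma integrable_score_term_power: "integrable M (\<lambda>\<omega>. score_term k (V \<omega>) ^ r)"
proof -
  let ?b = "\<lambda>\<omega>. 2 ^ r * (indicator event \<omega> * norm (Z \<omega>) ^ r + ratio_bound ^ r)"
  show ?thesis
  proof (rule Bochner_Integration.integrable_bound)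
    show "integrable M ?b"
      by (intro integrable_mult_right Bochner_Integration.integrable_add integrable_event_norm_power) simp
    show "AE \<omega> in M. norm (score_term k (V \<omega>) ^ r) \<le> norm (?b \<omega>)"
      using AE_T_le_tau AE_space
    proof eventually_elim
      case (elim \<omega>)
      have T: "T \<omega> \<le> tau" using elim by (simp add: T_def)
      let ?r = "at_risk_mean (\<lambda>z. exp (beta0 \<bullet> z) * z $ k) (T \<omega>) / Phi M T Z beta0 (T \<omega>)"
      have L: "0 \<le> ratio_bound" using ratio_le[OF T] abs_ge_zero order_trans by blast
      have "\<bar>score_term k (V \<omega>)\<bar> ^ r \<le> ?b \<omega>"
      proof (cases "X \<omega> \<le> C \<omega>")
        case True
        have "\<bar>score_term k (V \<omega>)\<bar> \<le> \<bar>Z \<omega> $ k\<bar> + \<bar>?r\<bar>"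
        proof -
          have "score_term k (V \<omega>) = Z \<omega> $ k - ?r" using True by (simp add: score_term_def V_simps)
          thus ?thesis by (simp only: abs_triangle_ineq4)
        qed
        also have "\<dots> \<le> norm (Z \<omega>) + ratio_bound" by (intro add_mono component_le_norm_cart ratio_le T)
        also have "\<dots> \<le> 2 * max (norm (Z \<omega>)) ratio_bound" by auto
        finally have "\<bar>score_term k (V \<omega>)\<bar> ^ r \<le> (2 * max (norm (Z \<omega>)) ratio_bound) ^ r"
          by (intro power_mono) auto
        also have "\<dots> \<le> 2 ^ r * (norm (Z \<omega>) ^ r + ratio_bound ^ r)"
          using L by (simp add: power_mult_distrib max_def)
        finally show ?thesis using True elim by simp
      next
        case False
        have "\<bar>score_term k (V \<omega>)\<bar> ^ r = 0 ^ r" using False by (simp add: score_term_def V_simps)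
        also have "\<dots> \<le> 2 ^ r * ratio_bound ^ r" using L by (cases r) auto
        finally show ?thesis using False by (simp add: indicator_def)
      qed
      thus ?case by (simp add: power_abs)
    qed
  qed measurable
qed

lemma kernel_deviation_nonneg: "0 \<le> kernel_deviation h n \<omega>"
  unfolding kernel_deviation_def by (intro divide_nonneg_nonneg sum_nonneg) auto

text \<open>Adding and subtracting the population ratio at \<open>T i\<close> splits each summand
  into minus a centred \<open>score_term\<close> and the error of the empirical ratio. All observed
  times are at most \<open>tau\<close> and risk sums decrease in time, so the lower bound at
  \<open>tau\<close> serves for every denominator.\<close>

lemma neg_score_le:
  assumes n: "0 < n" and le: "\<And>i. Ti i \<omega> \<le> tau"
    and low: "real n * (Phi M T Z beta0 tau / 2) \<le> risk_sum n (\<lambda>i. Ti i \<omega>) (\<lambda>i. Zi i \<omega>) beta0 tau"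
  shows "norm (neg_score n (\<lambda>i. Ti i \<omega>) (\<lambda>i. Di i \<omega>) (\<lambda>i. Zi i \<omega>) beta0) \<le>
    sqrt (real n) * (\<Sum>k\<in>UNIV. \<bar>deviation (score_term k) n \<omega>\<bar> + (kernel_deviation (\<lambda>z. exp (beta0 \<bullet> z) * z $ k) n \<omega>
       + ratio_bound * kernel_deviation (\<lambda>z. exp (beta0 \<bullet> z)) n \<omega>) / (Phi M T Z beta0 tau / 2))"
proof -
  let ?T = "\<lambda>i. Ti i \<omega>" and ?D = "\<lambda>i. Di i \<omega>" and ?Z = "\<lambda>i. Zi i \<omega>"
  let ?c = "Phi M T Z beta0 tau / 2" and ?\<Phi> = "Phi M T Z beta0"
  let ?s = "\<lambda>k. at_risk_mean (\<lambda>z. exp (beta0 \<bullet> z) * z $ k)"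
  have c: "0 < ?c" using Phi_pos[of tau] by simp
  let ?S0 = "risk_sum n ?T ?Z beta0" and ?S1 = "\<lambda>k t. risk_vec n ?T ?Z beta0 t $ k"
  have S0_anti: "?S0 tau \<le> ?S0 t" if "t \<le> tau" for t
    unfolding risk_sum_def using that by (intro sum_mono) (auto simp: indicator_def)
  have comp: "\<bar>neg_score n ?T ?D ?Z beta0 $ k\<bar> \<le> sqrt (real n) * (\<bar>deviation (score_term k) n \<omega>\<bar> +
     (kernel_deviation (\<lambda>z. exp (beta0 \<bullet> z) * z $ k) n \<omega> + ratio_bound * kernel_deviation (\<lambda>z. exp (beta0 \<bullet> z)) n \<omega>) / ?c)" for k
  proof -
    let ?a = "\<lambda>i. of_bool (?D i = 1) * (?S1 k (?T i) / ?S0 (?T i) - ?s k (?T i) / ?\<Phi> (?T i))"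
    let ?e1 = "\<lambda>i. \<bar>?S1 k (?T i) - real n * ?s k (?T i)\<bar>" and ?e0 = "\<lambda>i. \<bar>?S0 (?T i) - real n * ?\<Phi> (?T i)\<bar>"
    have "neg_score n ?T ?D ?Z beta0 $ k = (\<Sum>i<n. of_bool (?D i = 1) * (?S1 k (?T i) / ?S0 (?T i) - ?Z i $ k))"
      by (simp add: neg_score_def sum_component)
    also have "\<dots> = (\<Sum>i<n. ?a i - score_term k (W i \<omega>))"
      by (intro sum.cong refl) (simp add: score_term_def W_simps algebra_simps)
    also have "\<dots> = (\<Sum>i<n. ?a i) - sqrt (real n) * deviation (score_term k) n \<omega>"
      using n by (simp add: sum_subtractf deviation_def expectation_score_term)
    finally have "\<bar>neg_score n ?T ?D ?Z beta0 $ k\<bar> \<le> \<bar>\<Sum>i<n. ?a i\<bar> + \<bar>sqrt (real n) * deviation (score_term k) n \<omega>\<bar>"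
      by simp
    also have "\<bar>\<Sum>i<n. ?a i\<bar> \<le> (\<Sum>i<n. \<bar>?a i\<bar>)" by (rule sum_abs)
    also have "(\<Sum>i<n. \<bar>?a i\<bar>) \<le> (\<Sum>i<n. (?e1 i + ratio_bound * ?e0 i) / (real n * ?c))"
    proof (rule sum_mono)
      fix i
      have "\<bar>?a i\<bar> \<le> \<bar>?S1 k (?T i) / ?S0 (?T i) - ?s k (?T i) / ?\<Phi> (?T i)\<bar>" by (simp add: abs_mult)
      also have "\<dots> \<le> (?e1 i + ratio_bound * ?e0 i) / (real n * ?c)"
        by (rule ratio_difference_le[OF c _ _ Phi_pos[OF le] ratio_le[OF le]])
           (use n order_trans[OF low S0_anti[OF le]] in auto)
      finally show "\<bar>?a i\<bar> \<le> (?e1 i + ratio_bound * ?e0 i) / (real n * ?c)" .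
    qed
    also have "(\<Sum>i<n. (?e1 i + ratio_bound * ?e0 i) / (real n * ?c)) =
        ((\<Sum>i<n. ?e1 i) / real n + ratio_bound * ((\<Sum>i<n. ?e0 i) / real n)) / ?c"
    proof -
      have "(\<Sum>i<n. (x i + r * y i) / (N * c)) = ((\<Sum>i<n. x i) / N + r * ((\<Sum>i<n. y i) / N)) / c"
        for x y :: "nat \<Rightarrow> real" and r N c
        by (simp add: sum.distrib add_divide_distrib flip: sum_divide_distrib sum_distrib_left)
      thus ?thesis .
    qed
    also have "(\<Sum>i<n. ?e1 i) / real n = sqrt (real n) * kernel_deviation (\<lambda>z. exp (beta0 \<bullet> z) * z $ k) n \<omega>"
    proof -
      have "(\<Sum>j<n. indicator {?T i..} (?T j) * (exp (beta0 \<bullet> ?Z j) * ?Z j $ k) - ?s k (?T i)) =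
          ?S1 k (?T i) - real n * ?s k (?T i)" for i
        by (simp add: risk_vec_def sum_component sum_subtractf mult.assoc)
      thus ?thesis using n by (simp add: kernel_deviation_def flip: sum_divide_distrib)
    qed
    also have "(\<Sum>i<n. ?e0 i) / real n = sqrt (real n) * kernel_deviation (\<lambda>z. exp (beta0 \<bullet> z)) n \<omega>"
    proof -
      have "(\<Sum>j<n. indicator {?T i..} (?T j) * exp (beta0 \<bullet> ?Z j) - at_risk_mean (\<lambda>z. exp (beta0 \<bullet> z)) (?T i)) =
          ?S0 (?T i) - real n * ?\<Phi> (?T i)" for i
        by (simp add: risk_sum_def sum_subtractf Phi_eq)
      thus ?thesis using n by (simp add: kernel_deviation_def flip: sum_divide_distrib)
    qed
    finally show ?thesis by (simp add: abs_mult algebra_simps add_divide_distrib)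
  qed
  have "norm (neg_score n ?T ?D ?Z beta0) \<le> (\<Sum>k\<in>UNIV. \<bar>neg_score n ?T ?D ?Z beta0 $ k\<bar>)" by (rule norm_le_l1_cart)
  also have "\<dots> \<le> (\<Sum>k\<in>UNIV. sqrt (real n) * (\<bar>deviation (score_term k) n \<omega>\<bar> +
     (kernel_deviation (\<lambda>z. exp (beta0 \<bullet> z) * z $ k) n \<omega> + ratio_bound * kernel_deviation (\<lambda>z. exp (beta0 \<bullet> z)) n \<omega>) / ?c))"
    by (intro sum_mono comp)
  finally show ?thesis by (simp only: sum_distrib_left)
qed

definition at_risk_fun :: "(real ^ 'd \<Rightarrow> real) \<Rightarrow> real \<Rightarrow> real \<times> real \<times> (real ^ 'd) \<Rightarrow> real" where
  "at_risk_fun h u x = of_bool (u \<le> fst x) * h (snd (snd x))"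

definition event_fun :: "real \<Rightarrow> real \<times> real \<times> (real ^ 'd) \<Rightarrow> real" where
  "event_fun u x = of_bool (fst (snd x) = 1 \<and> fst x \<le> u)"

definition score_control :: "nat \<Rightarrow> 'w \<Rightarrow> real" where
  "score_control n \<omega> = (\<Sum>k\<in>UNIV. \<bar>deviation (score_term k) n \<omega>\<bar> + (kernel_deviation (\<lambda>z. exp (beta0 \<bullet> z) * z $ k) n \<omega>
       + ratio_bound * kernel_deviation (\<lambda>z. exp (beta0 \<bullet> z)) n \<omega>) / (Phi M T Z beta0 tau / 2))"

text \<open>The first summand bounds the normalised score; the others are the deviations of the
  finitely many empirical means that have to be close to their limits.\<close>

definition control :: "real \<Rightarrow> nat \<Rightarrow> 'w \<Rightarrow> real" where
  "control u n \<omega> = score_control n \<omega>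
     + \<bar>deviation (at_risk_fun (\<lambda>z. exp (beta0 \<bullet> z)) tau) n \<omega>\<bar>
     + \<bar>deviation (\<lambda>x. exp (beta0 \<bullet> snd (snd x) + kappa * norm (snd (snd x)))) n \<omega>\<bar>
     + \<bar>deviation (event_fun u) n \<omega>\<bar>
     + \<bar>deviation (at_risk_fun weight u) n \<omega>\<bar>
     + (\<Sum>k\<in>UNIV. \<bar>deviation (at_risk_fun (\<lambda>z. weight z * z $ k) u) n \<omega>\<bar>)
     + (\<Sum>k\<in>UNIV. \<Sum>l\<in>UNIV. \<bar>deviation (at_risk_fun (\<lambda>z. weight z * (z $ k * z $ l)) u) n \<omega>\<bar>)"

lemma ratio_bound_nonneg: "0 \<le> ratio_bound"
  using ratio_le[OF order_refl] abs_ge_zero order_trans by blast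

lemma score_control_nonneg: "0 \<le> score_control n \<omega>"
  unfolding score_control_def using Phi_pos[of tau] ratio_bound_nonneg
  by (intro sum_nonneg add_nonneg_nonneg divide_nonneg_nonneg mult_nonneg_nonneg kernel_deviation_nonneg) auto

lemma bounded_moments_deviation_dominated:
  assumes "g \<in> borel_measurable borel" "\<And>\<omega>. \<bar>g (V \<omega>)\<bar> \<le> c * Y \<omega> + c"
  shows "bounded_moments (deviation g)"
  by (rule bounded_moments_deviation[OF assms(1)], rule integrable_power_dominated(1)[OF _ assms(2)])
     (use assms(1) in measurable)

lemma bounded_moments_at_risk_weight:
  assumes [measurable]: "g \<in> borel_measurable borel" and le: "\<And>z. \<bar>g z\<bar> \<le> norm z ^ m"
  shows "bounded_moments (deviation (at_risk_fun (\<lambda>z. weight z * g z) u))"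
proof (rule bounded_moments_deviation_dominated[where c="fact m / (norm beta0 + kappa) ^ m"])
  show "at_risk_fun (\<lambda>z. weight z * g z) u \<in> borel_measurable borel"
    unfolding at_risk_fun_def[abs_def] by measurable
  fix \<omega>
  have c: "0 \<le> fact m / (norm beta0 + kappa) ^ m" using weight_rate_pos by simp
  have "\<bar>weight (Z \<omega>) * g (Z \<omega>)\<bar> \<le> weight (Z \<omega>) * norm (Z \<omega>) ^ m"
    using le weight_pos[of "Z \<omega>"] by (simp add: abs_mult)
  also have "\<dots> \<le> fact m / (norm beta0 + kappa) ^ m" by (rule weight_norm_power_le)
  finally have le': "\<bar>weight (Z \<omega>) * g (Z \<omega>)\<bar> \<le> fact m / (norm beta0 + kappa) ^ m" .
  show "\<bar>at_risk_fun (\<lambda>z. weight z * g z) u (V \<omega>)\<bar> \<le>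
      fact m / (norm beta0 + kappa) ^ m * Y \<omega> + fact m / (norm beta0 + kappa) ^ m"
  proof -
    have "0 \<le> fact m / (norm beta0 + kappa) ^ m * Y \<omega>" by (rule mult_nonneg_nonneg[OF c]) simp
    moreover have "\<bar>at_risk_fun (\<lambda>z. weight z * g z) u (V \<omega>)\<bar> \<le> \<bar>weight (Z \<omega>) * g (Z \<omega>)\<bar>"
      by (simp add: at_risk_fun_def V_simps)
    ultimately show ?thesis using le' by linarith
  qed
qed

lemma bounded_moments_control: "bounded_moments (control u)"
proof -
  have e: "\<bar>exp (beta0 \<bullet> z)\<bar> \<le> 1 * exp (beta0 \<bullet> z + kappa * norm z)" for z
    using kappa_pos by simp
  have ek: "\<bar>exp (beta0 \<bullet> z) * z $ k\<bar> \<le> (fact 1 / kappa ^ 1) * exp (beta0 \<bullet> z + kappa * norm z)" for z k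
  proof -
    have "\<bar>exp (beta0 \<bullet> z) * z $ k\<bar> \<le> norm z ^ 1 * exp (beta0 \<bullet> z)"
      by (auto simp: abs_mult mult.commute intro!: mult_left_mono component_le_norm_cart)
    thus ?thesis using norm_power_exp_le[of z 1] by linarith
  qed
  have kd: "bounded_moments (kernel_deviation (\<lambda>z. exp (beta0 \<bullet> z)))"
    "bounded_moments (kernel_deviation (\<lambda>z. exp (beta0 \<bullet> z) * z $ k))" for k
    by (rule bounded_moments_kernel_deviation[OF _ e], measurable)
       (rule bounded_moments_kernel_deviation[OF _ ek], measurable)
  have sc: "bounded_moments score_control"
  proof -
    have "bounded_moments (\<lambda>n \<omega>. \<Sum>k\<in>UNIV. \<bar>deviation (score_term k) n \<omega>\<bar> + (1 / (Phi M T Z beta0 tau / 2)) *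
       (kernel_deviation (\<lambda>z. exp (beta0 \<bullet> z) * z $ k) n \<omega> + ratio_bound * kernel_deviation (\<lambda>z. exp (beta0 \<bullet> z)) n \<omega>))"
      by (intro bounded_moments_sum bounded_moments_add bounded_moments_abs bounded_moments_cmult kd
          bounded_moments_deviation integrable_score_term_power measurable_score_term)
    thus ?thesis by (simp add: score_control_def[abs_def] mult.commute)
  qed
  have d1: "bounded_moments (deviation (at_risk_fun (\<lambda>z. exp (beta0 \<bullet> z)) tau))"
  proof (rule bounded_moments_deviation_dominated[where c=1])
    show "at_risk_fun (\<lambda>z. exp (beta0 \<bullet> z)) tau \<in> borel_measurable borel"
      unfolding at_risk_fun_def[abs_def] by measurable
    show "\<bar>at_risk_fun (\<lambda>z. exp (beta0 \<bullet> z)) tau (V \<omega>)\<bar> \<le> 1 * Y \<omega> + 1" for \<omega>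
    proof -
      have "expZ \<omega> \<le> Y \<omega>" using kappa_pos by simp
      thus ?thesis by (simp add: at_risk_fun_def V_simps add_increasing2)
    qed
  qed
  have d2: "bounded_moments (deviation (\<lambda>x. exp (beta0 \<bullet> snd (snd x) + kappa * norm (snd (snd x)))))"
    by (rule bounded_moments_deviation_dominated[where c=1]) (measurable, simp add: V_simps)
  have d3: "bounded_moments (deviation (event_fun u))"
  proof (rule bounded_moments_deviation_dominated[where c=1])
    show "event_fun u \<in> borel_measurable borel"
      unfolding event_fun_def[abs_def] by measurable
    show "\<bar>event_fun u (V \<omega>)\<bar> \<le> 1 * Y \<omega> + 1" for \<omega>
      by (simp add: event_fun_def)
  qed
  have d4: "bounded_moments (deviation (at_risk_fun weight u))"
    using bounded_moments_at_risk_weight[of "\<lambda>_. 1" 0 u] by simp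
  have d5: "bounded_moments (deviation (at_risk_fun (\<lambda>z. weight z * z $ k) u))" for k
    by (rule bounded_moments_at_risk_weight[where m=1]) (use component_le_norm_cart in auto)
  have d6: "bounded_moments (deviation (at_risk_fun (\<lambda>z. weight z * (z $ k * z $ l)) u))" for k l
    by (rule bounded_moments_at_risk_weight[where m=2], measurable)
       (auto simp: abs_mult power2_eq_square intro!: mult_mono component_le_norm_cart)
  show ?thesis
    unfolding control_def[abs_def]
    by (intro bounded_moments_add bounded_moments_sum bounded_moments_abs sc d1 d2 d3 d4 d5 d6)
qed

lemma control_ge:
  "score_control n \<omega> \<le> control u n \<omega>"
  "\<bar>deviation (at_risk_fun (\<lambda>z. exp (beta0 \<bullet> z)) tau) n \<omega>\<bar> \<le> control u n \<omega>"
  "\<bar>deviation (\<lambda>x. exp (beta0 \<bullet> snd (snd x) + kappa * norm (snd (snd x)))) n \<omega>\<bar> \<le> control u n \<omega>"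
  "\<bar>deviation (event_fun u) n \<omega>\<bar> \<le> control u n \<omega>"
  "\<bar>deviation (at_risk_fun weight u) n \<omega>\<bar> \<le> control u n \<omega>"
  "\<bar>deviation (at_risk_fun (\<lambda>z. weight z * z $ k) u) n \<omega>\<bar> \<le> control u n \<omega>"
  "\<bar>deviation (at_risk_fun (\<lambda>z. weight z * (z $ k * z $ l)) u) n \<omega>\<bar> \<le> control u n \<omega>"
proof -
  let ?A = "\<lambda>k. \<bar>deviation (at_risk_fun (\<lambda>z. weight z * z $ k) u) n \<omega>\<bar>"
  let ?B = "\<lambda>k l. \<bar>deviation (at_risk_fun (\<lambda>z. weight z * (z $ k * z $ l)) u) n \<omega>\<bar>"
  have A: "?A k \<le> (\<Sum>k\<in>UNIV. ?A k)" by (rule member_le_sum) auto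
  have "?B k l \<le> (\<Sum>l\<in>UNIV. ?B k l)" by (rule member_le_sum) auto
  also have "\<dots> \<le> (\<Sum>k\<in>UNIV. \<Sum>l\<in>UNIV. ?B k l)"
    by (rule member_le_sum[where f="\<lambda>k. \<Sum>l\<in>UNIV. ?B k l"]) (auto intro: sum_nonneg)
  finally have B: "?B k l \<le> (\<Sum>k\<in>UNIV. \<Sum>l\<in>UNIV. ?B k l)" .
  have A0: "0 \<le> (\<Sum>k\<in>UNIV. ?A k)" and B0: "0 \<le> (\<Sum>k\<in>UNIV. \<Sum>l\<in>UNIV. ?B k l)"
    by (auto intro!: sum_nonneg)
  note nn = score_control_nonneg[of n \<omega>] A0 B0
  show "score_control n \<omega> \<le> control u n \<omega>"
    "\<bar>deviation (at_risk_fun (\<lambda>z. exp (beta0 \<bullet> z)) tau) n \<omega>\<bar> \<le> control u n \<omega>"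
    "\<bar>deviation (\<lambda>x. exp (beta0 \<bullet> snd (snd x) + kappa * norm (snd (snd x)))) n \<omega>\<bar> \<le> control u n \<omega>"
    "\<bar>deviation (event_fun u) n \<omega>\<bar> \<le> control u n \<omega>"
    "\<bar>deviation (at_risk_fun weight u) n \<omega>\<bar> \<le> control u n \<omega>"
    unfolding control_def using nn by linarith+
  show "?A k \<le> control u n \<omega>" unfolding control_def using nn A by linarith
  show "?B k l \<le> control u n \<omega>" unfolding control_def using nn B by linarith
qed

lemma sum_deviation_le:
  assumes "\<bar>deviation g n \<omega>\<bar> \<le> c" "c \<le> \<delta> * sqrt (real n)" "0 < n"
  shows "\<bar>(\<Sum>i<n. g (W i \<omega>)) / real n - expectation (\<lambda>\<omega>. g (V \<omega>))\<bar> \<le> \<delta>"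
proof -
  let ?m = "expectation (\<lambda>\<omega>. g (V \<omega>))"
  have "(\<Sum>i<n. g (W i \<omega>)) / real n - ?m = deviation g n \<omega> / sqrt (real n)"
    using assms(3) by (simp add: deviation_def sum_subtractf field_simps)
  also have "\<bar>\<dots>\<bar> \<le> \<delta> * sqrt (real n) / sqrt (real n)"
    unfolding abs_divide using assms by (intro frac_le) auto
  also have "\<dots> = \<delta>" using assms(3) by simp
  finally show ?thesis .
qed

lemma expectation_at_risk_fun: "expectation (\<lambda>\<omega>. at_risk_fun h u (V \<omega>)) = at_risk_mean h u"
  by (simp add: at_risk_mean_def at_risk_fun_def V_simps indicator_def)

lemma expectation_event_fun:
  "expectation (\<lambda>\<omega>. event_fun u (V \<omega>)) = prob {\<omega> \<in> space M. X \<omega> \<le> C \<omega> \<and> T \<omega> \<le> u}"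
proof -
  have "expectation (\<lambda>\<omega>. event_fun u (V \<omega>)) = expectation (indicator {\<omega> \<in> space M. X \<omega> \<le> C \<omega> \<and> T \<omega> \<le> u})"
    by (intro Bochner_Integration.integral_cong) (auto simp: event_fun_def V_simps indicator_def)
  thus ?thesis by simp
qed

text \<open>The deterministic core: once \<open>control\<close> is at most
  \<open>\<delta> * sqrt n\<close>, each empirical mean is within \<open>\<delta>\<close> of its
  limit, and all premises of \<open>argmax_partial_likelihood_bound\<close> hold with halved
  constants.\<close>

lemma estimator_error_le_control:
  assumes est: "max_partial_likelihood_estimator M Ti Di Zi b"
    and u: "0 < prob {\<omega> \<in> space M. X \<omega> \<le> C \<omega> \<and> T \<omega> \<le> u}"
    and c1: "0 < c1" "\<And>v. c1 * (norm v)\<^sup>2 \<le> weighted_var u v"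
  shows "\<exists>\<delta>>0. \<exists>K\<ge>0. \<forall>n>0. AE \<omega> in M. control u n \<omega> \<le> \<delta> * sqrt (real n) \<longrightarrow>
    sqrt (real n) * norm (b n \<omega> - beta0) \<le> K * control u n \<omega>"
proof -
  define P where "P = prob {\<omega> \<in> space M. X \<omega> \<le> C \<omega> \<and> T \<omega> \<le> u}"
  define \<Phi>0 where "\<Phi>0 = Phi M T Z beta0 tau"
  \<comment> \<open>The summand 1 absorbs the deviation of the empirical mean of \<open>Y\<close>,
    since \<open>\<delta> \<le> 1\<close>.\<close>
  define Dm where "Dm = expectation Y + 1"
  define c where "c = (P / 2) * (c1 / 2) / Dm\<^sup>2"
  define m where "m = \<bar>at_risk_mean weight u\<bar> + (\<Sum>k\<in>UNIV. \<bar>at_risk_mean (\<lambda>z. weight z * z $ k) u\<bar>)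
      + (\<Sum>k\<in>UNIV. \<Sum>l\<in>UNIV. \<bar>at_risk_mean (\<lambda>z. weight z * (z $ k * z $ l)) u\<bar>)"
  \<comment> \<open>Chosen so that entrywise errors of \<open>2 * (2 * m + 1) * \<eta>\<close> in
    the covariance change the quadratic form by at most half of \<open>c1\<close>.\<close>
  define \<eta> where "\<eta> = c1 / 2 / (real CARD('d) ^ 2 * (2 * (2 * m + 1)))"
  \<comment> \<open>The five entries serve, in order, the product estimate, the covariance, the risk
    sum at \<open>tau\<close>, the frequency of events, and the smallness of the score. A quarter in
    the last one leaves room for the strict inequality with one half.\<close>
  define \<delta> where "\<delta> = min (min 1 \<eta>) (min (min (\<Phi>0 / 2) (P / 2)) (c * kappa / 4))"
  have m: "\<bar>at_risk_mean weight u\<bar> \<le> m" "\<bar>at_risk_mean (\<lambda>z. weight z * z $ k) u\<bar> \<le> m"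
    "\<bar>at_risk_mean (\<lambda>z. weight z * (z $ k * z $ l)) u\<bar> \<le> m" for k l
  proof -
    let ?A = "\<lambda>k. \<bar>at_risk_mean (\<lambda>z. weight z * z $ k) u\<bar>" and ?B = "\<lambda>k l. \<bar>at_risk_mean (\<lambda>z. weight z * (z $ k * z $ l)) u\<bar>"
    have A: "?A k \<le> (\<Sum>k\<in>UNIV. ?A k)" by (rule member_le_sum) auto
    have "?B k l \<le> (\<Sum>l\<in>UNIV. ?B k l)" by (rule member_le_sum) auto
    also have "\<dots> \<le> (\<Sum>k\<in>UNIV. \<Sum>l\<in>UNIV. ?B k l)"
      by (rule member_le_sum[where f="\<lambda>k. \<Sum>l\<in>UNIV. ?B k l"]) (auto intro: sum_nonneg)
    finally have B: "?B k l \<le> (\<Sum>k\<in>UNIV. \<Sum>l\<in>UNIV. ?B k l)" .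
    have "0 \<le> (\<Sum>k\<in>UNIV. ?A k)" "0 \<le> (\<Sum>k\<in>UNIV. \<Sum>l\<in>UNIV. ?B k l)" by (auto intro!: sum_nonneg)
    thus "\<bar>at_risk_mean weight u\<bar> \<le> m" "?A k \<le> m" "?B k l \<le> m" using A B unfolding m_def by linarith+
  qed
  have m0: "0 \<le> m" using m(1) abs_ge_zero order_trans by blast
  have \<Phi>0: "0 < \<Phi>0" using Phi_pos[of tau] by (simp add: \<Phi>0_def)
  have Dm: "0 < Dm" unfolding Dm_def by (intro add_nonneg_pos Bochner_Integration.integral_nonneg) auto
  have P: "0 < P" using u by (simp add: P_def)
  have c: "0 < c" using P c1 Dm by (simp add: c_def)
  have \<eta>: "0 < \<eta>" using c1 m0 by (simp add: \<eta>_def)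
  have \<delta>: "0 < \<delta>" using \<Phi>0 P c kappa_pos \<eta> by (simp add: \<delta>_def)
  have \<delta>_le: "\<delta> \<le> 1" "\<delta> \<le> \<eta>" "\<delta> \<le> \<Phi>0 / 2" "\<delta> \<le> P / 2" "\<delta> \<le> c * kappa / 4" by (auto simp: \<delta>_def)
  have main: "AE \<omega> in M. control u n \<omega> \<le> \<delta> * sqrt (real n) \<longrightarrow>
    sqrt (real n) * norm (b n \<omega> - beta0) \<le> 2 / c * control u n \<omega>" if n: "0 < n" for n
  proof -
    let ?L = "\<lambda>\<omega>. partial_likelihood n (\<lambda>i. Ti i \<omega>) (\<lambda>i. Di i \<omega>) (\<lambda>i. Zi i \<omega>)"
    have "AE \<omega> in M. (\<exists>\<beta>. is_arg_max (?L \<omega>) (\<lambda>_. True) \<beta>) \<longrightarrow> is_arg_max (?L \<omega>) (\<lambda>_. True) (b n \<omega>)"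
      using est by (auto simp: max_partial_likelihood_estimator_def Let_def)
    thus ?thesis using AE_T_sample AE_no_ties
    proof eventually_elim
      case (elim \<omega>)
      let ?T = "\<lambda>i. Ti i \<omega>" and ?D = "\<lambda>i. Di i \<omega>" and ?Z = "\<lambda>i. Zi i \<omega>" and ?A = "control u n \<omega>"
      show ?case
      proof
        assume A: "?A \<le> \<delta> * sqrt (real n)"
        note dev = sum_deviation_le[OF control_ge(2)[where n=n and \<omega>=\<omega> and u=u] A n] sum_deviation_le[OF control_ge(3)[where n=n and \<omega>=\<omega> and u=u] A n]
          sum_deviation_le[OF control_ge(4)[where n=n and \<omega>=\<omega> and u=u] A n] sum_deviation_le[OF control_ge(5)[where n=n and \<omega>=\<omega> and u=u] A n]
        define q where "q j = of_bool (u \<le> ?T j) * exp (- ((norm beta0 + kappa) * norm (?Z j)))" for j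
        have low: "real n * (\<Phi>0 / 2) \<le> risk_sum n ?T ?Z beta0 tau"
        proof -
          have "risk_sum n ?T ?Z beta0 tau = (\<Sum>i<n. at_risk_fun (\<lambda>z. exp (beta0 \<bullet> z)) tau (W i \<omega>))"
            by (simp add: risk_sum_def at_risk_fun_def W_simps indicator_def)
          hence "\<Phi>0 / 2 \<le> risk_sum n ?T ?Z beta0 tau / real n"
            using dev(1) \<delta>_le(3) by (simp add: expectation_at_risk_fun \<Phi>0_def Phi_eq abs_le_iff)
          thus ?thesis using n by (simp add: field_simps)
        qed
        have up: "(\<Sum>j<n. exp (beta0 \<bullet> ?Z j + kappa * norm (?Z j))) \<le> real n * Dm"
        proof -
          have "(\<Sum>j<n. exp (beta0 \<bullet> ?Z j + kappa * norm (?Z j))) / real n \<le> Dm"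
            using dev(2) \<delta>_le(1) by (simp add: W_simps V_simps Dm_def abs_le_iff)
          thus ?thesis using n by (simp add: field_simps)
        qed
        have ev: "real n * (P / 2) \<le> (\<Sum>i<n. of_bool (?D i = 1 \<and> ?T i \<le> u))"
        proof -
          have "P / 2 \<le> (\<Sum>i<n. of_bool (?D i = 1 \<and> ?T i \<le> u)) / real n"
            using dev(3) \<delta>_le(4) unfolding expectation_event_fun by (simp add: event_fun_def W_simps P_def abs_le_iff)
          thus ?thesis using n by (simp add: field_simps)
        qed
        have var: "real n ^ 2 * (c1 / 2 * (norm h)\<^sup>2) \<le> (\<Sum>j<n. q j) * (\<Sum>j<n. q j * (h \<bullet> ?Z j)\<^sup>2) - (\<Sum>j<n. q j * (h \<bullet> ?Z j))\<^sup>2" for h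
        proof -
          let ?a0 = "(\<Sum>j<n. q j) / real n" and ?a1 = "\<lambda>k. (\<Sum>j<n. q j * ?Z j $ k) / real n"
            and ?a2 = "\<lambda>k l. (\<Sum>j<n. q j * (?Z j $ k * ?Z j $ l)) / real n"
          let ?A = "\<lambda>k l. ?a0 * ?a2 k l - ?a1 k * ?a1 l"
          have qw: "q j * g = at_risk_fun (\<lambda>z. weight z * g) u (W j \<omega>)" "q j = at_risk_fun weight u (W j \<omega>)" for j g
            by (simp_all add: q_def at_risk_fun_def W_simps weight_def)
          have a0: "\<bar>?a0 - at_risk_mean weight u\<bar> \<le> \<delta>"
            using dev(4) by (simp add: qw(2) expectation_at_risk_fun)
          have a1: "\<bar>?a1 k - at_risk_mean (\<lambda>z. weight z * z $ k) u\<bar> \<le> \<delta>" for k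
            using sum_deviation_le[OF control_ge(6)[where n=n and \<omega>=\<omega> and u=u and k=k] A n] unfolding expectation_at_risk_fun
            by (simp add: q_def at_risk_fun_def W_simps weight_def mult.assoc)
          have a2: "\<bar>?a2 k l - at_risk_mean (\<lambda>z. weight z * (z $ k * z $ l)) u\<bar> \<le> \<delta>" for k l
            using sum_deviation_le[OF control_ge(7)[where n=n and \<omega>=\<omega> and u=u and k=k and l=l] A n] unfolding expectation_at_risk_fun
            by (simp add: q_def at_risk_fun_def W_simps weight_def mult.assoc)
          have diff: "\<bar>?A k l - weighted_cov u k l\<bar> \<le> 2 * (2 * m + 1) * \<delta>" for k l
            using product_deviation_le[OF a0 a2[of k l] m(1) m(3) \<delta>_le(1)]
              product_deviation_le[OF a1[of k] a1[of l] m(2) m(2) \<delta>_le(1)]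
            unfolding weighted_cov_def by linarith
          have "real CARD('d) ^ 2 * (2 * (2 * m + 1) * \<delta>) \<le> real CARD('d) ^ 2 * (2 * (2 * m + 1) * \<eta>)"
            using m0 \<delta>_le(2) by (intro mult_left_mono) auto
          also have "\<dots> = c1 / 2"
          proof -
            have "2 * m + 1 \<noteq> 0" using m0 by linarith
            hence "real CARD('d) ^ 2 * (2 * (2 * m + 1)) \<noteq> 0" by simp
            hence "real CARD('d) ^ 2 * (2 * (2 * m + 1)) * \<eta> = c1 / 2"
              unfolding \<eta>_def by (metis nonzero_mult_div_cancel_left times_divide_eq_right)
            thus ?thesis by (simp only: mult.assoc)
          qed
          finally have "real CARD('d) ^ 2 * (2 * (2 * m + 1) * \<delta>) * (norm h)\<^sup>2 \<le> c1 / 2 * (norm h)\<^sup>2"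
            by (rule mult_right_mono) simp
          hence "c1 / 2 * (norm h)\<^sup>2 \<le> weighted_var u h - real CARD('d) ^ 2 * (2 * (2 * m + 1) * \<delta>) * (norm h)\<^sup>2"
            using c1(2)[of h] by linarith
          also have "\<dots> \<le> (\<Sum>k\<in>UNIV. \<Sum>l\<in>UNIV. h $ k * h $ l * ?A k l)"
            unfolding weighted_var_def by (rule quadratic_form_perturbation[OF diff])
          finally have "real n ^ 2 * (c1 / 2 * (norm h)\<^sup>2) \<le> real n ^ 2 * (\<Sum>k\<in>UNIV. \<Sum>l\<in>UNIV. h $ k * h $ l * ?A k l)"
            by (rule mult_left_mono) simp
          also have "\<dots> = (\<Sum>k\<in>UNIV. \<Sum>l\<in>UNIV. h $ k * h $ l * ((\<Sum>j<n. q j) * (\<Sum>j<n. q j * (?Z j $ k * ?Z j $ l)) -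
              (\<Sum>j<n. q j * ?Z j $ k) * (\<Sum>j<n. q j * ?Z j $ l)))"
          proof -
            have "real n ^ 2 * (h $ k * h $ l * ?A k l) = h $ k * h $ l * ((\<Sum>j<n. q j) * (\<Sum>j<n. q j * (?Z j $ k * ?Z j $ l)) -
              (\<Sum>j<n. q j * ?Z j $ k) * (\<Sum>j<n. q j * ?Z j $ l))" for k l
            proof -
              have "N ^ 2 * (x * (a / N * (d / N) - e / N * (f / N))) = x * (a * d - e * f)"
                if "N \<noteq> 0" for N x a d e f :: real
                using that by (simp add: power2_eq_square field_simps)
              thus ?thesis using n by simp
            qed
            thus ?thesis by (simp only: sum_distrib_left)
          qed
          finally show ?thesis unfolding variance_form_quadratic .
        qed
        have score: "norm (neg_score n ?T ?D ?Z beta0) \<le> sqrt (real n) * ?A"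
        proof -
          have "norm (neg_score n ?T ?D ?Z beta0) \<le> sqrt (real n) * score_control n \<omega>"
            unfolding score_control_def using elim(2) low by (intro neg_score_le n) (auto simp: \<Phi>0_def)
          also have "\<dots> \<le> sqrt (real n) * ?A" by (intro mult_left_mono control_ge) simp
          finally show ?thesis .
        qed
        have small: "norm (neg_score n ?T ?D ?Z beta0) < real n * c * kappa / 2"
        proof -
          have "sqrt (real n) * ?A \<le> sqrt (real n) * (\<delta> * sqrt (real n))" by (intro mult_left_mono A) simp
          also have "\<dots> = real n * \<delta>" by simp
          also have "\<dots> \<le> real n * (c * kappa / 4)" by (intro mult_left_mono \<delta>_le) simp
          also have "\<dots> < real n * c * kappa / 2" using n c kappa_pos by simp
          finally show ?thesis using score by linarith
        qed
        have noties: "i = j" if "?D i = 1" "?D j = 1" "?T i = ?T j" for i j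
          using elim(3) that by blast
        have p0: "0 < P / 2" and c1': "0 < c1 / 2" using P c1 by auto
        note bound = argmax_partial_likelihood_bound[where D="?D" and T="?T" and Z="?Z",
            OF _ n kappa_pos up Dm ev c1' p0 var q_def small[unfolded c_def]]
        have "\<exists>\<beta>. is_arg_max (?L \<omega>) (\<lambda>_. True) \<beta>" by (rule bound(1)) (rule noties)
        hence "is_arg_max (?L \<omega>) (\<lambda>_. True) (b n \<omega>)" using elim(1) by blast
        hence "norm (b n \<omega> - beta0) \<le> 2 / (real n * c) * norm (neg_score n ?T ?D ?Z beta0)"
          unfolding c_def by (rule bound(2)[rotated]) (rule noties)
        also have "\<dots> \<le> 2 / (real n * c) * (sqrt (real n) * ?A)"
          using score c by (intro mult_left_mono) auto
        finally have "sqrt (real n) * norm (b n \<omega> - beta0) \<le> sqrt (real n) * (2 / (real n * c) * (sqrt (real n) * ?A))"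
          by (rule mult_left_mono) simp
        also have "\<dots> = 2 / c * ?A" using n c by (simp add: field_simps)
        finally show "sqrt (real n) * norm (b n \<omega> - beta0) \<le> 2 / c * ?A" .
      qed
    qed
  qed
  show ?thesis
    by (intro exI[of _ \<delta>] exI[of _ "2 / c"] conjI allI impI \<delta> main) (use c in auto)
qed

lemma estimator_moment_bound:
  assumes est: "max_partial_likelihood_estimator M Ti Di Zi b"
    and pd: "positive_definite (information_matrix M T Z lambda0 beta0 (ereal tau))" and p: "1 \<le> p"
  shows "\<exists>(E :: nat \<Rightarrow> 'w set) (K :: real).
    (\<forall>n. E n \<in> sets M) \<and> (\<lambda>n. prob (E n)) \<longlonglongrightarrow> 1 \<and> K > 0 \<and>
    limsup (\<lambda>n. \<integral>\<^sup>+\<omega>. indicator (E n) \<omega> *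
        ennreal (real n powr (p / 2) * norm (b n \<omega> - beta0) powr p) \<partial>M) \<le> ennreal K"
proof -
  obtain u c1 where u: "0 < prob {\<omega> \<in> space M. X \<omega> \<le> C \<omega> \<and> T \<omega> \<le> u}" and c1: "0 < c1" "\<And>v. c1 * (norm v)\<^sup>2 \<le> weighted_var u v"
    using weighted_var_positive[OF pd] by blast
  obtain \<delta> L where \<delta>: "0 < \<delta>" and L: "0 \<le> L" and err: "\<And>n. 0 < n \<Longrightarrow> AE \<omega> in M. control u n \<omega> \<le> \<delta> * sqrt (real n) \<longrightarrow>
      sqrt (real n) * norm (b n \<omega> - beta0) \<le> L * control u n \<omega>"
    using estimator_error_le_control[OF est u c1] by blast
  note bm = bounded_moments_control[of u]
  note [measurable] = bounded_moments_measurable[OF bm]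
  have A0: "0 \<le> control u n \<omega>" for n \<omega> using score_control_nonneg control_ge(1) order_trans by blast
  define E where "E n = {\<omega> \<in> space M. \<bar>control u n \<omega>\<bar> \<le> \<delta> * sqrt (real n)}" for n
  \<comment> \<open>Moments of \<open>control\<close> are bounded for natural exponents; a real
    exponent \<open>p\<close> is reached through \<open>x powr p \<le> 1 + x ^ q\<close>.\<close>
  define q where "q = nat \<lceil>p\<rceil>"
  have pq: "p \<le> real q" unfolding q_def by linarith
  obtain K where K: "\<And>n. (\<integral>\<^sup>+\<omega>. ennreal (\<bar>control u n \<omega>\<bar> ^ q) \<partial>M) \<le> ennreal K"
    using bm unfolding bounded_moments_def by meson
  \<comment> \<open>The last summand keeps the constant positive even if
    \<open>L = 0\<close>.\<close>
  let ?K = "L powr p * (1 + max 0 K) + 1"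
  have bound: "(\<integral>\<^sup>+\<omega>. indicator (E n) \<omega> * ennreal (real n powr (p / 2) * norm (b n \<omega> - beta0) powr p) \<partial>M) \<le> ennreal ?K"
    if n: "0 < n" for n
  proof -
    have pw: "x powr p \<le> 1 + x ^ q" if "0 \<le> x" for x :: real
    proof (cases "x \<le> 1")
      case True
      have "x powr p \<le> 1" using that True p by (intro powr_le1) auto
      thus ?thesis using that by (simp add: add_increasing2)
    next
      case False
      have "x powr p \<le> x powr real q" using False pq by (intro powr_mono) auto
      also have "\<dots> = x ^ q" using False by (intro powr_realpow) auto
      finally show ?thesis by simp
    qed
    have "(\<integral>\<^sup>+\<omega>. indicator (E n) \<omega> * ennreal (real n powr (p / 2) * norm (b n \<omega> - beta0) powr p) \<partial>M) \<le>
       (\<integral>\<^sup>+\<omega>. ennreal (L powr p) * (1 + ennreal (\<bar>control u n \<omega>\<bar> ^ q)) \<partial>M)"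
    proof (rule nn_integral_mono_AE)
      show "AE \<omega> in M. indicator (E n) \<omega> * ennreal (real n powr (p / 2) * norm (b n \<omega> - beta0) powr p) \<le>
          ennreal (L powr p) * (1 + ennreal (\<bar>control u n \<omega>\<bar> ^ q))"
        using err[OF n]
      proof eventually_elim
        case (elim \<omega>)
        show ?case
        proof (cases "\<omega> \<in> E n")
          case True
          have "real n powr (p / 2) * norm (b n \<omega> - beta0) powr p = (sqrt (real n) * norm (b n \<omega> - beta0)) powr p"
            by (simp add: powr_mult powr_powr flip: powr_half_sqrt)
          also have "\<dots> \<le> (L * control u n \<omega>) powr p"
            using elim True p by (intro powr_mono2) (auto simp: E_def)
          also have "\<dots> = L powr p * control u n \<omega> powr p" using L A0 by (intro powr_mult)
          also have "\<dots> \<le> L powr p * (1 + \<bar>control u n \<omega>\<bar> ^ q)"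
            using pw[OF A0] A0 by (intro mult_left_mono) auto
          finally have "ennreal (real n powr (p / 2) * norm (b n \<omega> - beta0) powr p) \<le> ennreal (L powr p * (1 + \<bar>control u n \<omega>\<bar> ^ q))"
            by (rule ennreal_leI)
          also have "\<dots> = ennreal (L powr p) * (1 + ennreal (\<bar>control u n \<omega>\<bar> ^ q))"
            by (simp add: ennreal_mult)
          finally show ?thesis using True by simp
        qed simp
      qed
    qed
    also have "\<dots> = ennreal (L powr p) * (1 + (\<integral>\<^sup>+\<omega>. ennreal (\<bar>control u n \<omega>\<bar> ^ q) \<partial>M))"
      by (simp add: nn_integral_cmult nn_integral_add emeasure_space_1)
    also have "\<dots> \<le> ennreal (L powr p) * (1 + ennreal (max 0 K))"
      using K[of n] by (intro mult_left_mono add_left_mono) (auto simp: max_def ennreal_neg)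
    also have "\<dots> = ennreal (L powr p * (1 + max 0 K))" by (simp add: ennreal_mult)
    also have "\<dots> \<le> ennreal ?K" by (intro ennreal_leI) simp
    finally show ?thesis .
  qed
  have "?K > 0" by (intro add_nonneg_pos mult_nonneg_nonneg) auto
  moreover have "E n \<in> sets M" for n unfolding E_def by measurable
  moreover have "(\<lambda>n. prob (E n)) \<longlonglongrightarrow> 1"
    unfolding E_def by (rule bounded_moments_prob_tendsto_1[OF bm \<delta>])
  moreover have "limsup (\<lambda>n. \<integral>\<^sup>+\<omega>. indicator (E n) \<omega> *
        ennreal (real n powr (p / 2) * norm (b n \<omega> - beta0) powr p) \<partial>M) \<le> ennreal ?K"
    by (rule Limsup_bounded) (use bound in \<open>auto intro!: eventually_sequentiallyI[of 1]\<close>)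
  ultimately show ?thesis by blast
qed

end

section \<open>From the hypotheses of the theorem to the finite horizon\<close>

lemma null_above_right_end_point:
  assumes "finite_measure \<nu>" and sets: "sets \<nu> = sets borel" and end_pt: "right_end_point \<nu> = ereal t"
  shows "{t<..} \<in> null_sets \<nu>"
proof -
  interpret finite_measure \<nu> by fact
  let ?U = "{U :: real set. open U \<and> measure \<nu> U = 0}"
  have cover: "{t<..} \<subseteq> \<Union>?U"
  proof
    fix x assume x: "x \<in> {t<..}"
    have "\<not> (\<forall>U. open U \<and> x \<in> U \<longrightarrow> measure \<nu> U > 0)"
    proof
      assume "\<forall>U. open U \<and> x \<in> U \<longrightarrow> measure \<nu> U > 0"
      hence "ereal x \<le> right_end_point \<nu>" unfolding right_end_point_def by (intro Sup_upper) auto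
      thus False using x end_pt by simp
    qed
    thus "x \<in> \<Union>?U" by (auto simp: zero_less_measure_iff)
  qed
  \<comment> \<open>Every point above the end point has an open null neighbourhood; countably many
    of them already cover, so their union is null.\<close>
  obtain \<U> where \<U>: "\<U> \<subseteq> ?U" "countable \<U>" "\<Union>\<U> = \<Union>?U"
    using Lindelof[of ?U] by auto
  have "\<Union>\<U> \<in> null_sets \<nu>"
  proof (rule null_sets_UN'[OF \<U>(2), of "\<lambda>U. U", simplified])
    fix U assume "U \<in> \<U>"
    thus "U \<in> null_sets \<nu>" using \<U>(1) sets by (auto simp: null_sets_def emeasure_eq_measure)
  qed
  moreover have "{t<..} \<in> sets \<nu>" using sets by simp
  ultimately show ?thesis using cover \<U>(3) null_sets_subset by metis
qed

text \<open>On a vector with sign pattern \<open>s\<close> the linear functional of the sign vector dominates the norm,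
  so exponential weights with a norm in the exponent are controlled by finitely many linear ones.\<close>

definition sign_vector :: "('d \<Rightarrow> bool) \<Rightarrow> real ^ 'd" where
  "sign_vector s = (\<chi> k. if s k then 1 else -1)"

lemma norm_sign_vector_le: "norm (sign_vector s :: real ^ 'd) \<le> real CARD('d)"
proof -
  have "norm (sign_vector s :: real ^ 'd) \<le> (\<Sum>k\<in>UNIV. \<bar>sign_vector s $ k :: real\<bar>)" by (rule norm_le_l1_cart)
  also have "\<dots> = (\<Sum>k\<in>(UNIV :: 'd set). 1)" by (intro sum.cong) (auto simp: sign_vector_def)
  finally show ?thesis by simp
qed

lemma norm_le_inner_sign_vector: "norm z \<le> sign_vector (\<lambda>k. 0 \<le> z $ k) \<bullet> z"
proof -
  have "sign_vector (\<lambda>k. 0 \<le> z $ k) \<bullet> z = (\<Sum>k\<in>UNIV. \<bar>z $ k\<bar>)"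
    unfolding inner_vec_def by (intro sum.cong) (auto simp: sign_vector_def)
  thus ?thesis using norm_le_l1_cart[of z] by simp
qed

text \<open>The moment hypothesis always carries a factor \<open>(z $ k) ^ (2 * q)\<close>. If some
  component exceeds 1 in absolute value, this factor is at least 1 and can be inserted; otherwise
  \<open>z\<close> is bounded and so is the exponential.\<close>

lemma exp_norm_power_le:
  fixes z \<beta> :: "real ^ 'd"
  assumes "0 \<le> \<kappa>"
  shows "exp (\<beta> \<bullet> z + \<kappa> * norm z) ^ q \<le> exp (norm \<beta> * real CARD('d) + \<kappa> * real CARD('d)) ^ q +
    (\<Sum>s\<in>UNIV. \<Sum>k\<in>UNIV. (z $ k) ^ (2 * q) * exp (real q * ((\<beta> + \<kappa> *\<^sub>R sign_vector s) \<bullet> z)))"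
proof -
  let ?t = "\<lambda>s k. (z $ k) ^ (2 * q) * exp (real q * ((\<beta> + \<kappa> *\<^sub>R sign_vector s) \<bullet> z))"
  have t0: "0 \<le> ?t s k" for s k by (simp add: zero_le_even_power)
  have s0: "0 \<le> (\<Sum>k\<in>UNIV. ?t s k)" for s using t0 by (intro sum_nonneg) auto
  show ?thesis
  proof (cases "\<forall>k. \<bar>z $ k\<bar> \<le> 1")
    case True
    have "norm z \<le> (\<Sum>k\<in>UNIV. \<bar>z $ k\<bar>)" by (rule norm_le_l1_cart)
    also have "\<dots> \<le> (\<Sum>k\<in>(UNIV :: 'd set). 1)" using True by (intro sum_mono) auto
    finally have n: "norm z \<le> real CARD('d)" by simp
    have "\<beta> \<bullet> z \<le> norm \<beta> * norm z" by (rule norm_cauchy_schwarz)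
    also have "\<dots> \<le> norm \<beta> * real CARD('d)" by (intro mult_left_mono n) simp
    finally have "\<beta> \<bullet> z + \<kappa> * norm z \<le> norm \<beta> * real CARD('d) + \<kappa> * real CARD('d)"
      using n assms by (intro add_mono mult_left_mono) auto
    hence "exp (\<beta> \<bullet> z + \<kappa> * norm z) ^ q \<le> exp (norm \<beta> * real CARD('d) + \<kappa> * real CARD('d)) ^ q"
      by (intro power_mono) auto
    moreover have "0 \<le> (\<Sum>s\<in>UNIV. \<Sum>k\<in>UNIV. ?t s k)" using s0 by (intro sum_nonneg) auto
    ultimately show ?thesis by linarith
  next
    case False
    then obtain k where k: "\<bar>z $ k\<bar> > 1" by (auto simp: not_le)
    let ?s = "\<lambda>k. 0 \<le> z $ k"
    have "\<kappa> * norm z \<le> \<kappa> * (sign_vector ?s \<bullet> z)"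
      by (intro mult_left_mono norm_le_inner_sign_vector assms)
    hence "\<beta> \<bullet> z + \<kappa> * norm z \<le> (\<beta> + \<kappa> *\<^sub>R sign_vector ?s) \<bullet> z" by (simp add: inner_add_left)
    hence "exp (\<beta> \<bullet> z + \<kappa> * norm z) ^ q \<le> exp ((\<beta> + \<kappa> *\<^sub>R sign_vector ?s) \<bullet> z) ^ q"
      by (intro power_mono) auto
    also have "\<dots> = 1 * exp (real q * ((\<beta> + \<kappa> *\<^sub>R sign_vector ?s) \<bullet> z))" by (simp add: exp_of_nat_mult)
    also have "\<dots> \<le> ?t ?s k"
    proof (intro mult_right_mono)
      have "1 \<le> \<bar>z $ k\<bar> ^ (2 * q)" using k by (intro one_le_power) simp
      thus "1 \<le> (z $ k) ^ (2 * q)" by (simp add: power_even_abs)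
    qed simp
    also have "\<dots> \<le> (\<Sum>k\<in>UNIV. ?t ?s k)" by (rule member_le_sum) (use t0 in auto)
    also have "\<dots> \<le> (\<Sum>s\<in>UNIV. \<Sum>k\<in>UNIV. ?t s k)"
      by (rule member_le_sum[where f="\<lambda>s. \<Sum>k\<in>UNIV. ?t s k"]) (use s0 in auto)
    finally show ?thesis by (simp add: add_increasing)
  qed
qed

lemma (in prob_space) integrable_exp_norm_power:
  fixes Z :: "'a \<Rightarrow> real ^ 'd"
  assumes [measurable]: "Z \<in> borel_measurable M" and \<epsilon>: "0 < \<epsilon>"
    and fin: "\<And>k. q \<ge> 1 \<Longrightarrow> (SUP \<beta>\<in>cball \<beta>0 \<epsilon>. \<integral>\<^sup>+\<omega>. ennreal ((Z \<omega> $ k) ^ (2 * q) * exp (real q * (\<beta> \<bullet> Z \<omega>))) \<partial>M) < \<infinity>"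
  shows "integrable M (\<lambda>\<omega>. exp (\<beta>0 \<bullet> Z \<omega> + \<epsilon> / real CARD('d) * norm (Z \<omega>)) ^ q)"
proof (cases "q = 0")
  case False
  \<comment> \<open>Sign vectors have norm at most the dimension, so this scaling keeps
    \<open>\<beta>0 + \<kappa> *\<^sub>R sign_vector s\<close> within distance
    \<open>\<epsilon>\<close> of \<open>\<beta>0\<close>.\<close>
  define \<kappa> where "\<kappa> = \<epsilon> / real CARD('d)"
  have \<kappa>: "0 \<le> \<kappa>" using \<epsilon> by (simp add: \<kappa>_def)
  have [measurable]: "(\<lambda>\<omega>. Z \<omega> $ k) \<in> borel_measurable M" for k
    by (rule measurable_compose[OF assms(1)]) (intro borel_measurable_continuous_onI continuous_intros)
  let ?t = "\<lambda>s k \<omega>. (Z \<omega> $ k) ^ (2 * q) * exp (real q * ((\<beta>0 + \<kappa> *\<^sub>R sign_vector s) \<bullet> Z \<omega>))"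
  let ?B = "exp (norm \<beta>0 * real CARD('d) + \<kappa> * real CARD('d)) ^ q"
  have t: "integrable M (?t s k)" for s k
  proof (rule integrableI_nonneg)
    have "norm (\<kappa> *\<^sub>R sign_vector s :: real ^ 'd) \<le> \<kappa> * real CARD('d)"
      using norm_sign_vector_le[of s] \<kappa> by (simp add: mult_left_mono)
    hence "\<beta>0 + \<kappa> *\<^sub>R sign_vector s \<in> cball \<beta>0 \<epsilon>" by (simp add: dist_norm \<kappa>_def)
    hence "(\<integral>\<^sup>+\<omega>. ennreal (?t s k \<omega>) \<partial>M) \<le>
        (SUP \<beta>\<in>cball \<beta>0 \<epsilon>. \<integral>\<^sup>+\<omega>. ennreal ((Z \<omega> $ k) ^ (2 * q) * exp (real q * (\<beta> \<bullet> Z \<omega>))) \<partial>M)"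
      by (rule SUP_upper)
    also have "\<dots> < \<infinity>" using fin False by simp
    finally show "(\<integral>\<^sup>+\<omega>. ennreal (?t s k \<omega>) \<partial>M) < \<infinity>" .
  qed (auto simp: zero_le_even_power)
  have "integrable M (\<lambda>\<omega>. ?B + (\<Sum>s\<in>UNIV. \<Sum>k\<in>UNIV. ?t s k \<omega>))"
    by (intro Bochner_Integration.integrable_add Bochner_Integration.integrable_sum t) simp
  thus ?thesis
  proof (rule Bochner_Integration.integrable_bound)
    show "AE \<omega> in M. norm (exp (\<beta>0 \<bullet> Z \<omega> + \<epsilon> / real CARD('d) * norm (Z \<omega>)) ^ q) \<le>
        norm (?B + (\<Sum>s\<in>UNIV. \<Sum>k\<in>UNIV. ?t s k \<omega>))"
      using exp_norm_power_le[OF \<kappa>, of \<beta>0 "Z _" q] unfolding \<kappa>_def[symmetric]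
      by (intro AE_I2) (use abs_ge_self order_trans in \<open>simp, blast\<close>)
  qed measurable
qed simp

theorem theorem1:
  fixes M :: "'w measure"
    and X C T :: "'w \<Rightarrow> real" and Z :: "'w \<Rightarrow> real ^ 'd"
    and F f G :: "real \<Rightarrow> real ^ 'd \<Rightarrow> real"
    and lambda0 :: "real \<Rightarrow> real" and beta0 :: "real ^ 'd"
    and Ti Di :: "nat \<Rightarrow> 'w \<Rightarrow> real" and Zi betahat :: "nat \<Rightarrow> 'w \<Rightarrow> real ^ 'd"
    and \<tau>\<^sub>F \<tau>\<^sub>G :: ereal and p :: real
  assumes model: "cox_sample M X C Z F f G lambda0 beta0 Ti Di Zi"
    and estimator: "max_partial_likelihood_estimator M Ti Di Zi betahat"
    and T: "T = (\<lambda>\<omega>. min (X \<omega>) (C \<omega>))"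
    and tau_F: "\<tau>\<^sub>F = right_end_point (distr M borel X)"
    and tau_G: "\<tau>\<^sub>G = right_end_point (distr M borel C)"
    and nondegenerate: "positive_definite (information_matrix M T Z lambda0 beta0 \<tau>\<^sub>G)"
    and i: "\<tau>\<^sub>G < \<tau>\<^sub>F" "measure M {\<omega> \<in> space M. ereal (T \<omega>) = \<tau>\<^sub>G} > 0"
    and ii: "\<exists>\<epsilon>>0. (SUP \<beta>\<in>cball beta0 \<epsilon>.
               \<integral>\<^sup>+\<omega>. ennreal ((norm (Z \<omega>))\<^sup>2 * exp (2 * (\<beta> \<bullet> Z \<omega>))) \<partial>M) < \<infinity>"
    and iii: "\<exists>\<epsilon>>0. \<forall>q::nat. \<forall>k. q \<ge> 1 \<longrightarrow> (SUP \<beta>\<in>cball beta0 \<epsilon>.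
               \<integral>\<^sup>+\<omega>. ennreal ((Z \<omega> $ k) ^ (2 * q) * exp (real q * (\<beta> \<bullet> Z \<omega>))) \<partial>M) < \<infinity>"
    and iv: "continuous_on {t. 0 \<le> t \<and> ereal t < \<tau>\<^sub>F} lambda0"
    and p: "p \<ge> 1"
  shows "\<exists>(E :: nat \<Rightarrow> 'w set) (K :: real).
    (\<forall>n. E n \<in> sets M) \<and> (\<lambda>n. measure M (E n)) \<longlonglongrightarrow> 1 \<and> K > 0 \<and>
    limsup (\<lambda>n. \<integral>\<^sup>+\<omega>. indicator (E n) \<omega> *
        ennreal (real n powr (p / 2) * norm (betahat n \<omega> - beta0) powr p) \<partial>M) \<le> ennreal K"
proof -
  interpret S: cox_sample M X C Z F f G lambda0 beta0 Ti Di Zi by (rule model)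
  \<comment> \<open>A real-valued \<open>T\<close> attains the end point, hence
    \<open>\<tau>\<^sub>G\<close> is a real number.\<close>
  have "{\<omega> \<in> space M. ereal (T \<omega>) = \<tau>\<^sub>G} \<noteq> {}" using i(2) by (metis less_irrefl measure_empty)
  then obtain tau where tau: "\<tau>\<^sub>G = ereal tau" by auto
  have atom: "0 < measure M {\<omega> \<in> space M. min (X \<omega>) (C \<omega>) = tau}" using i(2) unfolding tau T by (simp only: ereal.inject)
  obtain \<epsilon> where \<epsilon>: "0 < \<epsilon>" and fin: "\<And>q k. q \<ge> 1 \<Longrightarrow> (SUP \<beta>\<in>cball beta0 \<epsilon>.
      \<integral>\<^sup>+\<omega>. ennreal ((Z \<omega> $ k) ^ (2 * q) * exp (real q * (\<beta> \<bullet> Z \<omega>))) \<partial>M) < \<infinity>"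
    using iii by blast
  have tau_nonneg: "0 \<le> tau"
  proof (rule ccontr)
    assume neg: "\<not> 0 \<le> tau"
    have "AE \<omega> in M. \<omega> \<notin> {\<omega> \<in> space M. min (X \<omega>) (C \<omega>) = tau}"
      using S.X_nonneg S.C_nonneg by eventually_elim (use neg in \<open>auto simp: min_def split: if_splits\<close>)
    hence "measure M {\<omega> \<in> space M. min (X \<omega>) (C \<omega>) = tau} = 0"
      by (subst (asm) AE_iff_null) (auto simp: null_sets_def S.emeasure_eq_measure)
    thus False using atom by simp
  qed
  have AE_le: "AE \<omega> in M. min (X \<omega>) (C \<omega>) \<le> tau"
  proof -
    have "{tau<..} \<in> null_sets (distr M borel C)"
      by (rule null_above_right_end_point)
         (use tau_G tau in \<open>auto intro!: prob_space.finite_measure S.prob_space_distr\<close>)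
    hence "AE x in distr M borel C. x \<notin> {tau<..}" by (rule AE_not_in)
    hence "AE \<omega> in M. C \<omega> \<notin> {tau<..}" by (subst (asm) AE_distr_iff) auto
    thus ?thesis by eventually_elim auto
  qed
  interpret cox_horizon_sample M X C Z F f G lambda0 beta0 tau "\<epsilon> / real CARD('d)" Ti Di Zi
  proof (intro cox_horizon_sample.intro cox_horizon.intro cox_horizon_axioms.intro)
    \<comment> \<open>Because \<open>\<tau>\<^sub>G < \<tau>\<^sub>F\<close>, the closed interval up
      to \<open>tau\<close> lies inside the range where the hazard is continuous; this makes it
      bounded up to and including \<open>tau\<close>.\<close>
    show "continuous_on {0..tau} lambda0"
      using i(1) by (intro continuous_on_subset[OF iv]) (auto simp: tau intro: le_less_trans[of _ "ereal tau"])
    show "0 < \<epsilon> / real CARD('d)" using \<epsilon> by simp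
    show "integrable M (\<lambda>\<omega>. exp (beta0 \<bullet> Z \<omega> + \<epsilon> / real CARD('d) * norm (Z \<omega>)) ^ q)" for q
      by (rule S.integrable_exp_norm_power[OF S.measurable_Z \<epsilon> fin])
  qed (fact S.cox_model_axioms tau_nonneg AE_le atom model)+
  have "T = cox_horizon.T X C" unfolding T T_def[abs_def] ..
  hence "positive_definite (information_matrix M (cox_horizon.T X C) Z lambda0 beta0 (ereal tau))"
    using nondegenerate tau by simp
  from estimator_moment_bound[OF estimator this p] show ?thesis .
qed

end
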